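(* Let $J$ be a (possibly unbounded) one-sided Jacobi matrix with parameters $a_n>0$, $b_n\in\mathbb{R}$ ($n=1,2,\dots$) such that $$\sup_n|a_n|<\infty .$$ Let $\mathcal{R}$ be the set of right limit points of $J$, where the right limits $J^{(r)}$ are allowed to have some $a_n^{(r)}=0$ and/or some $b_n^{(r)}=\pm\infty$. Then, with the conventions of the context on when $\pm\infty$ belongs to $\sigma$ and $\sigma_{\mathrm{ess}}$, $$\overline{\bigcup_{r\in\mathcal{R}}\sigma(J^{(r)})}=\sigma_{\mathrm{ess}}(J).$$
   Context: The Jacobi matrix $J$ is the selfadjoint tridiagonal operator on $\ell^2(\{1,2,\dots\})$ with $J_{n,n}=b_n$, $J_{n,n+1}=J_{n+1,n}=a_n$ (a bounded perturbation of the diagonal operator with entries $b_n$). Right limits: a right limit point $J^{(r)}$ is given by parameters $\{a_n^{(r)},b_n^{(r)}\}_{n=-\infty}^\infty$ with $a_n^{(r)}\in[0,\infty)$ and $b_n^{(r)}\in[-\infty,\infty]$ for which there is a subsequence $n_j\to\infty$ such that, for each fixed $\ell=0,\pm1,\pm2,\dots$, $a_{n_j+\ell}\to a_\ell^{(r)}$ and $b_{n_j+\ell}\to b_\ell^{(r)}$ (in $[-\infty,\infty]$) as $j\to\infty$. It is interpreted as follows: if all $b^{(r)}_n$ are finite, $J^{(r)}$ is the two-sided tridiagonal operator on $\ell^2(\mathbb{Z})$ with these entries; if $a_n^{(r)}=0$ it decouples on $\ell^2(-\infty,n]\oplus\ell^2[n+1,\infty)$; if $|b_n^{(r)}|=\infty$,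 the site $n$ is removed, the operator decouples on $\ell^2(-\infty,n-1]\oplus\ell^2[n+1,\infty)$, and the value $b_n^{(r)}\in\{+\infty,-\infty\}$ is placed in the (essential) spectrum of $J^{(r)}$. Conventions on $\pm\infty$: for a possibly unbounded selfadjoint operator $A$, one says that $+\infty\in\sigma_{\mathrm{ess}}(A)$ if $\sigma(A)$ is not bounded above, and $-\infty\in\sigma_{\mathrm{ess}}(A)$ if $\sigma(A)$ is not bounded below. Thus spectra and essential spectra are regarded as subsets of $[-\infty,\infty]$ (points $\pm\infty$ in $\sigma_{\mathrm{ess}}$ also being counted in $\sigma$), and the closure is taken in $[-\infty,\infty]$. *)

theory Defs
  imports "HOL-Analysis.Analysis"
begin

section \<open>Spectra of unbounded operators on sequence spaces\<close>

text \<open>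
  The Hilbert space \<open>ell2 S\<close> of square-summable families on the index set \<open>S\<close> is
  represented by functions on the whole index type that vanish outside \<open>S\<close>.
\<close>

definition ell2 :: "'i set \<Rightarrow> ('i \<Rightarrow> complex) set" where
  "ell2 S = {u. (\<forall>n. n \<notin> S \<longrightarrow> u n = 0) \<and> (\<lambda>n. (cmod (u n))\<^sup>2) summable_on UNIV}"

definition ell2_norm :: "('i \<Rightarrow> complex) \<Rightarrow> real" where
  "ell2_norm u = sqrt (\<Sum>\<^sub>\<infinity>n. (cmod (u n))\<^sup>2)"

text \<open>
  An unbounded operator in a space \<open>H\<close> is given by its domain \<open>D\<close> and its action \<open>T\<close>,
  whose values outside \<open>D\<close> are irrelevant.
\<close>

definition shifted_op ::
  "(('i \<Rightarrow> complex) \<Rightarrow> ('i \<Rightarrow> complex)) \<Rightarrow> complex \<Rightarrow> ('i \<Rightarrow> complex) \<Rightarrow> ('i \<Rightarrow> complex)" where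
  "shifted_op T z u = (\<lambda>n. T u n - z * u n)"

definition resolvent_set ::
  "('i \<Rightarrow> complex) set \<Rightarrow> ('i \<Rightarrow> complex) set \<Rightarrow> (('i \<Rightarrow> complex) \<Rightarrow> ('i \<Rightarrow> complex)) \<Rightarrow> complex set" where
  "resolvent_set H D T =
     {z. bij_betw (shifted_op T z) D H \<and>
         (\<exists>C. \<forall>u\<in>D. ell2_norm u \<le> C * ell2_norm (shifted_op T z u))}"

definition spectrum ::
  "('i \<Rightarrow> complex) set \<Rightarrow> ('i \<Rightarrow> complex) set \<Rightarrow> (('i \<Rightarrow> complex) \<Rightarrow> ('i \<Rightarrow> complex)) \<Rightarrow> complex set" where
  "spectrum H D T = - resolvent_set H D T"

definition finite_multiplicity ::
  "('i \<Rightarrow> complex) set \<Rightarrow> (('i \<Rightarrow> complex) \<Rightarrow> ('i \<Rightarrow> complex)) \<Rightarrow> complex \<Rightarrow> bool" where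
  "finite_multiplicity D T z \<longleftrightarrow>
     (\<exists>B. finite B \<and> (\<forall>u\<in>D. shifted_op T z u = (\<lambda>n. 0) \<longrightarrow> (\<exists>c. u = (\<lambda>n. \<Sum>v\<in>B. c v * v n))))"

text \<open>
  The discrete spectrum of a selfadjoint operator consists of the isolated points of the
  spectrum that have finite multiplicity; the essential spectrum is the rest of the spectrum.
\<close>

definition essential_spectrum ::
  "('i \<Rightarrow> complex) set \<Rightarrow> ('i \<Rightarrow> complex) set \<Rightarrow> (('i \<Rightarrow> complex) \<Rightarrow> ('i \<Rightarrow> complex)) \<Rightarrow> complex set" where
  "essential_spectrum H D T =
     {z \<in> spectrum H D T. z islimpt spectrum H D T \<or> \<not> finite_multiplicity D T z}"

text \<open>
  Spectra of selfadjoint operators are real, so they may be read as subsets of \<open>[-\<infinity>, \<infinity>]\<close>.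
  The points \<open>\<plusminus>\<infinity>\<close> belong to the extended essential spectrum, and hence to the extended
  spectrum, exactly when the spectrum (not the essential spectrum) is unbounded
  in the respective direction.
\<close>

definition infinite_points :: "complex set \<Rightarrow> ereal set" where
  "infinite_points \<Sigma> =
     {x. x = \<infinity> \<and> \<not> bdd_above {l::real. complex_of_real l \<in> \<Sigma>} \<or>
         x = -\<infinity> \<and> \<not> bdd_below {l::real. complex_of_real l \<in> \<Sigma>}}"

definition ext_spectrum ::
  "('i \<Rightarrow> complex) set \<Rightarrow> ('i \<Rightarrow> complex) set \<Rightarrow> (('i \<Rightarrow> complex) \<Rightarrow> ('i \<Rightarrow> complex)) \<Rightarrow> ereal set" where
  "ext_spectrum H D T =
     ereal ` {l. complex_of_real l \<in> spectrum H D T} \<union> infinite_points (spectrum H D T)"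

definition ext_essential_spectrum ::
  "('i \<Rightarrow> complex) set \<Rightarrow> ('i \<Rightarrow> complex) set \<Rightarrow> (('i \<Rightarrow> complex) \<Rightarrow> ('i \<Rightarrow> complex)) \<Rightarrow> ereal set" where
  "ext_essential_spectrum H D T =
     ereal ` {l. complex_of_real l \<in> essential_spectrum H D T} \<union> infinite_points (spectrum H D T)"

section \<open>Jacobi operators\<close>

text \<open>
  The tridiagonal operator on \<open>ell2 S\<close>, for a set \<open>S\<close> of integer sites, has diagonal
  entries \<open>b n\<close> and entries \<open>a n\<close> at \<open>(n, n + 1)\<close> and \<open>(n + 1, n)\<close>. Since elements of \<open>ell2 S\<close>
  vanish off \<open>S\<close>, only the couplings between two sites of \<open>S\<close> matter. For bounded \<open>a\<close> the
  operator is a bounded perturbation of multiplication by \<open>b\<close> and is selfadjoint on the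
  domain of that multiplication operator.
\<close>

definition jacobi_domain :: "int set \<Rightarrow> (int \<Rightarrow> real) \<Rightarrow> (int \<Rightarrow> complex) set" where
  "jacobi_domain S b = {u \<in> ell2 S. (\<lambda>n. complex_of_real (b n) * u n) \<in> ell2 S}"

definition jacobi_op ::
  "int set \<Rightarrow> (int \<Rightarrow> real) \<Rightarrow> (int \<Rightarrow> real) \<Rightarrow> (int \<Rightarrow> complex) \<Rightarrow> (int \<Rightarrow> complex)" where
  "jacobi_op S a b u =
     (\<lambda>n. if n \<in> S
          then complex_of_real (a (n - 1)) * u (n - 1) + complex_of_real (b n) * u n
               + complex_of_real (a n) * u (n + 1)
          else 0)"

text \<open>The one-sided Jacobi matrix lives on the sites \<open>1, 2, \<dots>\<close>; \<open>a 0\<close> and \<open>b 0\<close> play no role.\<close>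

definition jacobi_sigma_ess :: "(nat \<Rightarrow> real) \<Rightarrow> (nat \<Rightarrow> real) \<Rightarrow> ereal set" where
  "jacobi_sigma_ess a b =
     ext_essential_spectrum (ell2 {1..}) (jacobi_domain {1..} (\<lambda>n. b (nat n)))
       (jacobi_op {1..} (\<lambda>n. a (nat n)) (\<lambda>n. b (nat n)))"

text \<open>
  For fixed \<open>l\<close>, the index \<open>int (k j) + l\<close> is positive for all but finitely many \<open>j\<close>, so the
  truncation by \<open>nat\<close> does not affect the limits.
\<close>

definition right_limits ::
  "(nat \<Rightarrow> real) \<Rightarrow> (nat \<Rightarrow> real) \<Rightarrow> ((int \<Rightarrow> real) \<times> (int \<Rightarrow> ereal)) set" where
  "right_limits a b =
     {(ar, br). (\<forall>l. 0 \<le> ar l) \<and>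
        (\<exists>k :: nat \<Rightarrow> nat. strict_mono k \<and>
           (\<forall>l. (\<lambda>j. a (nat (int (k j) + l))) \<longlonglongrightarrow> ar l \<and>
                (\<lambda>j. ereal (b (nat (int (k j) + l)))) \<longlonglongrightarrow> br l))}"

text \<open>
  Sites where \<open>br\<close> is infinite are removed, which decouples the two sides, and the infinite
  values of \<open>br\<close> are adjoined to the spectrum.
\<close>

definition finite_sites :: "(int \<Rightarrow> ereal) \<Rightarrow> int set" where
  "finite_sites br = {n. \<bar>br n\<bar> \<noteq> \<infinity>}"

definition right_limit_sigma :: "(int \<Rightarrow> real) \<Rightarrow> (int \<Rightarrow> ereal) \<Rightarrow> ereal set" where
  "right_limit_sigma ar br =
     ext_spectrum (ell2 (finite_sites br))
       (jacobi_domain (finite_sites br) (\<lambda>n. real_of_ereal (br n)))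
       (jacobi_op (finite_sites br) ar (\<lambda>n. real_of_ereal (br n)))
     \<union> {br n |n. \<bar>br n\<bar> = \<infinity>}"

end

theory Submission
  imports Defs
begin

text \<open>
  Since \<open>J - b\<close> is bounded, \<open>J\<close> and its right limits are selfadjoint and their spectra consist of the real
  approximate eigenvalues. As all \<open>a n\<close> are positive, eigenvalues of \<open>J\<close> are simple, so the finite essential
  spectrum is the set of limit points of the spectrum.

  If \<open>l\<close> is such a limit point, there are approximate eigenvectors that tend weakly to \<open>0\<close>. Averaging
  over all windows of a large fixed length shows that some window far out carries an approximate eigenvector
  as well, and by compactness the coefficients and vectors on such windows converge along a subsequence to a
  right limit and an approximate eigenvector of it. Conversely, approximate eigenvectors of a right limit are
  transplanted to \<open>J\<close>, arbitrarily far out. If \<open>l\<close> were at most an isolated point of the spectrum, every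
  vector would be close to the kernel of \<open>J - l\<close>, up to a multiple of the size of its image under \<open>J - l\<close>;
  but a kernel element is controlled by its value at the site \<open>1\<close>, where the transplants vanish.

  The points \<open>\<plusminus>\<infinity>\<close> occur on either side exactly if \<open>b\<close> is unbounded in the respective direction.
\<close>

section \<open>The Hilbert space of square-summable families\<close>

text \<open>Two quantitative facts stand in for the spectral theorem: a vector with relative
  residual below \<open>r\<close> at \<mu> forces spectrum within \<open>r\<close> of \<mu>, and at
  an at most isolated spectral point the residual bounds the distance to the kernel. Both are proved
  in real inner product spaces; complex scalars act through \<open>cs\<close>.

  Windows have a fixed length because a coordinatewise limit of unit vectors can lose norm unless
  all supports lie in one finite set. The length grows like 1/\<epsilon>^2, so the right limit
  obtained depends on \<epsilon> and reproduces the spectral point only up to \<epsilon>; this is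
  how the closure enters.

  In the converse direction infinite diagonal entries are the obstacle. Extending a vector by zero
  to a removed site leaves an error there of the size of the neighbouring values, since the
  off-diagonal entries couple the site to them. A value of order 1/(\<open>b n\<close> -
  \<open>l\<close>) removes this error and itself tends to zero.\<close>

lemma ell2_UNIV_iff: "u \<in> ell2 UNIV \<longleftrightarrow> (\<lambda>n. (cmod (u n))\<^sup>2) summable_on UNIV"
  by (simp add: ell2_def)

lemma ell2_imp_UNIV: "u \<in> ell2 S \<Longrightarrow> u \<in> ell2 UNIV"
  by (simp add: ell2_def)

lemma ell2_bound:
  assumes "v \<in> ell2 UNIV" "\<And>n. cmod (u n) \<le> C * cmod (v n)"
  shows "u \<in> ell2 UNIV"
proof -
  have "(\<lambda>n. C\<^sup>2 * (cmod (v n))\<^sup>2) summable_on UNIV"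
    using assms(1) by (intro summable_on_cmult_right) (simp add: ell2_UNIV_iff)
  moreover have "(cmod (u n))\<^sup>2 \<le> C\<^sup>2 * (cmod (v n))\<^sup>2" for n
    using power_mono[OF assms(2)[of n], of 2] by (simp add: power_mult_distrib)
  ultimately show ?thesis
    unfolding ell2_UNIV_iff by (rule summable_on_comparison_test) auto
qed

lemma ell2_add:
  assumes "u \<in> ell2 UNIV" "v \<in> ell2 UNIV"
  shows "(\<lambda>n. u n + v n) \<in> ell2 UNIV"
proof -
  have "(\<lambda>n. 2 * (cmod (u n))\<^sup>2 + 2 * (cmod (v n))\<^sup>2) summable_on UNIV"
    using assms by (intro summable_on_add summable_on_cmult_right) (simp_all add: ell2_UNIV_iff)
  moreover have "(cmod (u n + v n))\<^sup>2 \<le> 2 * (cmod (u n))\<^sup>2 + 2 * (cmod (v n))\<^sup>2" for n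
  proof -
    have "(cmod (u n + v n))\<^sup>2 \<le> (cmod (u n) + cmod (v n))\<^sup>2"
      by (intro power_mono norm_triangle_ineq) auto
    also have "\<dots> \<le> 2 * (cmod (u n))\<^sup>2 + 2 * (cmod (v n))\<^sup>2"
      using sum_squares_bound[of "cmod (u n)" "cmod (v n)"] by (simp add: power2_sum)
    finally show ?thesis .
  qed
  ultimately show ?thesis
    unfolding ell2_UNIV_iff by (rule summable_on_comparison_test) auto
qed

lemma ell2_cmult: "u \<in> ell2 UNIV \<Longrightarrow> (\<lambda>n. c * u n) \<in> ell2 UNIV"
  by (rule ell2_bound[where C = "cmod c" and v = u]) (auto simp: norm_mult)

lemma ell2_zero: "(\<lambda>n. 0) \<in> ell2 S"
  by (simp add: ell2_def)

text \<open>All sites of the index type are kept, so that operators on different \<open>S\<close>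
  act in one space and the spaces for the various \<open>S\<close> become closed subspaces of
  it.\<close>

typedef 'i l2 = "ell2 UNIV :: ('i \<Rightarrow> complex) set"
  by (rule exI[of _ "\<lambda>n. 0"]) (rule ell2_zero)

setup_lifting type_definition_l2

lift_definition coord :: "'i l2 \<Rightarrow> 'i \<Rightarrow> complex" (infixl "$$" 90) is "\<lambda>u. u" .

text \<open>The type carries the structure of a real vector space only, so complex multiples get an
  operation of their own.\<close>

lift_definition cs :: "complex \<Rightarrow> 'i l2 \<Rightarrow> 'i l2" is "\<lambda>c u n. c * u n"
  by (rule ell2_cmult)

lemma l2_eqI: "(\<And>n. u $$ n = v $$ n) \<Longrightarrow> u = v"
  by transfer auto

lemma coord_in_ell2: "coord u \<in> ell2 UNIV"
  by transfer

lemma coord_Abs: "u \<in> ell2 UNIV \<Longrightarrow> Abs_l2 u $$ n = u n"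
  by (simp add: coord_def Abs_l2_inverse)

lemma coord_cs [simp]: "cs c u $$ n = c * u $$ n"
  by transfer simp

instantiation l2 :: (type) real_vector
begin
lift_definition zero_l2 :: "'a l2" is "\<lambda>n. 0" by (rule ell2_zero)
lift_definition plus_l2 :: "'a l2 \<Rightarrow> 'a l2 \<Rightarrow> 'a l2" is "\<lambda>u v n. u n + v n" by (rule ell2_add)
lift_definition uminus_l2 :: "'a l2 \<Rightarrow> 'a l2" is "\<lambda>u n. - u n"
  using ell2_cmult[where c = "-1"] by simp
definition minus_l2 :: "'a l2 \<Rightarrow> 'a l2 \<Rightarrow> 'a l2" where "minus_l2 u v = u + (- v)"
lift_definition scaleR_l2 :: "real \<Rightarrow> 'a l2 \<Rightarrow> 'a l2" is "\<lambda>r u n. of_real r * u n"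
  by (rule ell2_cmult)
instance
proof
  fix a b c :: "'a l2" and x y :: real
  show "a + b + c = a + (b + c)" by transfer (simp add: add.assoc)
  show "a + b = b + a" by transfer (simp add: add.commute)
  show "0 + a = a" by transfer simp
  show "- a + a = 0" by transfer simp
  show "a - b = a + - b" by (fact minus_l2_def)
  show "x *\<^sub>R (a + b) = x *\<^sub>R a + x *\<^sub>R b" by transfer (simp add: distrib_left)
  show "(x + y) *\<^sub>R a = x *\<^sub>R a + y *\<^sub>R a" by transfer (simp add: distrib_right)
  show "x *\<^sub>R y *\<^sub>R a = (x * y) *\<^sub>R a" by transfer (simp add: mult.assoc)
  show "1 *\<^sub>R a = a" by transfer simp
qed
end

lemma coord_zero [simp]: "0 $$ n = 0" by (simp add: coord.rep_eq zero_l2.rep_eq)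
lemma coord_add [simp]: "(u + v) $$ n = u $$ n + v $$ n" by (simp add: coord.rep_eq plus_l2.rep_eq)
lemma coord_uminus [simp]: "(- u) $$ n = - (u $$ n)" by (simp add: coord.rep_eq uminus_l2.rep_eq)
lemma coord_diff [simp]: "(u - v) $$ n = u $$ n - v $$ n" by (simp only: minus_l2_def coord_add coord_uminus) simp
lemma coord_scaleR [simp]: "(r *\<^sub>R u) $$ n = of_real r * u $$ n" by (simp add: coord.rep_eq scaleR_l2.rep_eq)

lemma summable_coord_sq: "(\<lambda>n. (cmod (u $$ n))\<^sup>2) summable_on UNIV"
  using coord_in_ell2[of u] unfolding ell2_UNIV_iff .

lemma summable_inner_coord: "(\<lambda>n. inner (u $$ n) (v $$ n)) summable_on UNIV"
proof -
  have *: "\<bar>inner x y\<bar> \<le> (cmod x)\<^sup>2 + (cmod y)\<^sup>2" for x y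
  proof -
    have "0 \<le> cmod x * cmod y" by simp
    then show ?thesis
      using Cauchy_Schwarz_ineq2[of x y] sum_squares_bound[of "cmod x" "cmod y"] by linarith
  qed
  have "(\<lambda>n. norm (inner (u $$ n) (v $$ n))) summable_on UNIV"
    by (rule Infinite_Sum.abs_summable_on_comparison_test'[OF summable_on_add[OF summable_coord_sq summable_coord_sq]])
      (unfold real_norm_def, rule *)
  then show ?thesis
    by (rule abs_summable_summable)
qed

text \<open>This is the real part of the Hermitian product. It induces the same norm, and for
  operators that commute with \<open>cs \<i>\<close> symmetry means the same for both
  products.\<close>

instantiation l2 :: (type) real_inner
begin
definition inner_l2 :: "'a l2 \<Rightarrow> 'a l2 \<Rightarrow> real" where
  "inner_l2 u v = (\<Sum>\<^sub>\<infinity>n. inner (u $$ n) (v $$ n))"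
definition norm_l2 :: "'a l2 \<Rightarrow> real" where "norm_l2 u = sqrt (inner u u)"
definition sgn_l2 :: "'a l2 \<Rightarrow> 'a l2" where "sgn_l2 u = u /\<^sub>R norm u"
definition dist_l2 :: "'a l2 \<Rightarrow> 'a l2 \<Rightarrow> real" where "dist_l2 u v = norm (u - v)"
definition uniformity_l2 :: "('a l2 \<times> 'a l2) filter" where
  "uniformity_l2 = (INF e\<in>{0<..}. principal {(x, y). dist x y < e})"
definition open_l2 :: "'a l2 set \<Rightarrow> bool" where
  "open_l2 U \<longleftrightarrow> (\<forall>x\<in>U. eventually (\<lambda>(x', y). x' = x \<longrightarrow> y \<in> U) uniformity)"
instance
proof
  fix x y z :: "'a l2" and r :: real and U :: "'a l2 set"
  show "dist x y = norm (x - y)" by (fact dist_l2_def)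
  show "sgn x = x /\<^sub>R norm x" by (fact sgn_l2_def)
  show "(uniformity :: ('a l2 \<times> 'a l2) filter) = (INF e\<in>{0<..}. principal {(x, y). dist x y < e})"
    by (fact uniformity_l2_def)
  show "open U = (\<forall>x\<in>U. eventually (\<lambda>(x', y). x' = x \<longrightarrow> y \<in> U) uniformity)"
    by (fact open_l2_def)
  show "inner x y = inner y x" by (simp only: inner_l2_def inner_commute)
  show "inner (x + y) z = inner x z + inner y z"
    unfolding inner_l2_def coord_add inner_add_left
    by (intro infsum_add summable_inner_coord)
  have "inner (of_real r * x $$ n) (y $$ n) = r * inner (x $$ n) (y $$ n)" for n
    by (simp add: inner_complex_def algebra_simps)
  then show "inner (r *\<^sub>R x) y = r * inner x y"
    unfolding inner_l2_def coord_scaleR by (simp add: infsum_cmult_right')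
  show "0 \<le> inner x x"
    unfolding inner_l2_def by (intro infsum_nonneg) simp
  show "inner x x = 0 \<longleftrightarrow> x = 0"
  proof
    assume *: "inner x x = 0"
    have "inner (x $$ n) (x $$ n) = 0" for n
      by (rule nonneg_infsum_le_0D[where A = UNIV and f = "\<lambda>n. inner (x $$ n) (x $$ n)"])
        (simp_all add: *[unfolded inner_l2_def] summable_inner_coord)
    then show "x = 0" by (intro l2_eqI) simp
  qed (simp add: inner_l2_def)
  show "norm x = sqrt (inner x x)" by (fact norm_l2_def)
qed
end

lemma norm_l2_eq: "norm u = ell2_norm (coord u)"
  by (simp add: norm_l2_def inner_l2_def ell2_norm_def power2_norm_eq_inner)

lemma norm_l2_sq: "(norm u)\<^sup>2 = (\<Sum>\<^sub>\<infinity>n. (cmod (u $$ n))\<^sup>2)"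
  by (simp add: power2_norm_eq_inner inner_l2_def)

lemma sum_coord_le: "finite F \<Longrightarrow> (\<Sum>n\<in>F. (cmod (u $$ n))\<^sup>2) \<le> (norm u)\<^sup>2"
  unfolding norm_l2_sq by (rule finite_sum_le_infsum) (auto simp: summable_coord_sq)

lemma coord_le: "cmod (u $$ n) \<le> norm u"
  by (rule power2_le_imp_le) (use sum_coord_le[of "{n}" u] in simp_all)

lemma norm_l2_mono:
  assumes "\<And>n. cmod (u $$ n) \<le> C * cmod (v $$ n)" "0 \<le> C"
  shows "norm u \<le> C * norm v"
proof -
  have "(norm u)\<^sup>2 \<le> (\<Sum>\<^sub>\<infinity>n. C\<^sup>2 * (cmod (v $$ n))\<^sup>2)"
    unfolding norm_l2_sq
    by (intro infsum_mono summable_on_cmult_right summable_coord_sq)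
      (metis assms(1) norm_ge_zero power_mono power_mult_distrib)
  also have "\<dots> = (C * norm v)\<^sup>2"
    by (simp add: infsum_cmult_right' norm_l2_sq power_mult_distrib)
  finally show ?thesis
    by (rule power2_le_imp_le) (simp add: assms)
qed

text \<open>Finite partial sums pass to the limit, and their supremum decides both summability and
  the norm.\<close>

lemma ell2_norm_Fatou:
  assumes conv: "\<And>n. (\<lambda>k. X k n) \<longlonglongrightarrow> u n"
    and bound: "\<And>F k. finite F \<Longrightarrow> (\<Sum>n\<in>F. (cmod (X k n))\<^sup>2) \<le> C\<^sup>2" and "0 \<le> C"
  shows "u \<in> ell2 UNIV" "ell2_norm u \<le> C"
proof -
  have fin: "(\<Sum>n\<in>F. (cmod (u n))\<^sup>2) \<le> C\<^sup>2" if "finite F" for F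
  proof (rule LIMSEQ_le_const2)
    show "(\<lambda>k. \<Sum>n\<in>F. (cmod (X k n))\<^sup>2) \<longlonglongrightarrow> (\<Sum>n\<in>F. (cmod (u n))\<^sup>2)"
      by (intro tendsto_intros conv)
  qed (use bound that in auto)
  then show "u \<in> ell2 UNIV"
    unfolding ell2_UNIV_iff by (intro nonneg_bdd_above_summable_on) (auto intro!: bdd_aboveI)
  then have "(\<Sum>\<^sub>\<infinity>n. (cmod (u n))\<^sup>2) \<le> C\<^sup>2"
    unfolding ell2_UNIV_iff by (intro infsum_le_finite_sums) (auto simp: fin)
  then show "ell2_norm u \<le> C"
    unfolding ell2_norm_def using \<open>0 \<le> C\<close> by (simp add: real_le_lsqrt)
qed

lemma l2_Fatou:
  assumes conv: "\<And>n. (\<lambda>k. X k $$ n) \<longlonglongrightarrow> u n" and bound: "\<And>k. norm (X k) \<le> C"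
  shows "u \<in> ell2 UNIV" "norm (Abs_l2 u) \<le> C"
proof -
  have C: "0 \<le> C" using bound[of 0] by (meson norm_ge_zero order_trans)
  have *: "(\<Sum>n\<in>F. (cmod (X k $$ n))\<^sup>2) \<le> C\<^sup>2" if "finite F" for F k
    using sum_coord_le[OF that, of "X k"] power_mono[OF bound[of k], of 2] by simp
  note F = ell2_norm_Fatou[of "\<lambda>k n. X k $$ n", OF conv * C]
  show "u \<in> ell2 UNIV" by (rule F)
  then have "coord (Abs_l2 u) = u" by (intro ext) (rule coord_Abs)
  then show "norm (Abs_l2 u) \<le> C" using F(2) by (simp add: norm_l2_eq)
qed

text \<open>The coordinatewise limit \<open>u\<close> is also the norm limit: Fatou applied to
  \<open>X m - X (k + M)\<close>, with \<open>k\<close> tending to infinity, shows that the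
  difference of \<open>X m\<close> and \<open>u\<close> is square summable and of norm at most
  \<open>e\<close>.\<close>

instance l2 :: (type) banach
proof
  fix X :: "nat \<Rightarrow> 'a l2"
  assume X: "Cauchy X"
  have "Cauchy (\<lambda>k. X k $$ n)" for n
  proof (rule metric_CauchyI)
    fix e :: real assume "0 < e"
    then obtain M where "\<forall>m\<ge>M. \<forall>k\<ge>M. dist (X m) (X k) < e"
      using X by (meson metric_CauchyD)
    then show "\<exists>M. \<forall>m\<ge>M. \<forall>k\<ge>M. dist (X m $$ n) (X k $$ n) < e"
      by (metis coord_diff coord_le dist_norm order_le_less_trans)
  qed
  then have "\<exists>l. (\<lambda>k. X k $$ n) \<longlonglongrightarrow> l" for n
    using Cauchy_convergent convergent_def by blast
  then obtain u where u: "\<And>n. (\<lambda>k. X k $$ n) \<longlonglongrightarrow> u n" by metis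
  have est: "\<exists>M. \<forall>m\<ge>M. u \<in> ell2 UNIV \<and> norm (X m - Abs_l2 u) \<le> e" if e: "0 < e" for e
  proof -
    obtain M where M: "\<And>m k. m \<ge> M \<Longrightarrow> k \<ge> M \<Longrightarrow> dist (X m) (X k) < e"
      using X e by (meson metric_CauchyD)
    have "u \<in> ell2 UNIV \<and> norm (X m - Abs_l2 u) \<le> e" if m: "m \<ge> M" for m
    proof -
      have 1: "(\<lambda>k. (X m - X (k + M)) $$ n) \<longlonglongrightarrow> X m $$ n - u n" for n
        unfolding coord_diff using LIMSEQ_ignore_initial_segment[OF u] by (intro tendsto_intros)
      have 2: "norm (X m - X (k + M)) \<le> e" for k
        using M[OF m, of "k + M"] by (simp add: dist_norm)
      note F = l2_Fatou[of "\<lambda>k. X m - X (k + M)", OF 1 2]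
      have "(\<lambda>n. X m $$ n + (-1) * (X m $$ n - u n)) \<in> ell2 UNIV"
        by (intro ell2_add ell2_cmult F coord_in_ell2)
      then have U: "u \<in> ell2 UNIV" by simp
      have "X m - Abs_l2 u = Abs_l2 (\<lambda>n. X m $$ n - u n)"
        by (rule l2_eqI) (simp add: coord_Abs[OF U] coord_Abs[OF F(1)])
      then show ?thesis using U F(2) by simp
    qed
    then show ?thesis by blast
  qed
  have "X \<longlonglongrightarrow> Abs_l2 u"
  proof (rule metric_LIMSEQ_I)
    fix r :: real assume r: "0 < r"
    then obtain M where "\<forall>m\<ge>M. norm (X m - Abs_l2 u) \<le> r / 2"
      using est[of "r/2"] by auto
    then have "\<forall>n\<ge>M. dist (X n) (Abs_l2 u) < r"
      using r by (force simp: dist_norm)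
    then show "\<exists>no. \<forall>n\<ge>no. dist (X n) (Abs_l2 u) < r" ..
  qed
  then show "convergent X" by (rule convergentI)
qed

lemma norm_cs [simp]: "norm (cs c u) = cmod c * norm u"
proof -
  have "(norm (cs c u))\<^sup>2 = (cmod c * norm u)\<^sup>2"
    by (simp add: norm_l2_sq norm_mult power_mult_distrib infsum_cmult_right')
  then show ?thesis by (simp add: power2_eq_iff_nonneg)
qed

lemma cs_of_real: "cs (of_real r) u = r *\<^sub>R u"
  by (rule l2_eqI) simp

text \<open>Multiplication by \<i> is skew for the real product; this separates the real and
  imaginary parts of a spectral shift.\<close>

lemma inner_cs_imaginary_unit: "inner u (cs \<i> v) = - inner (cs \<i> u) v"
proof -
  have "inner (u $$ n) (\<i> * v $$ n) = - inner (\<i> * u $$ n) (v $$ n)" for n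
    by (simp add: inner_complex_def)
  then show ?thesis
    by (simp add: inner_l2_def infsum_uminus)
qed

lemma bounded_linear_coord: "bounded_linear (\<lambda>u. u $$ n)"
  by (rule bounded_linear_intro[where K = 1]) (auto simp: scaleR_conv_of_real coord_le)

lemmas tendsto_coord = bounded_linear.tendsto[OF bounded_linear_coord]

section \<open>Approximate eigenvalues of selfadjoint operators\<close>

text \<open>
  The assumption \<open>surj\<close> is the part of selfadjointness that goes beyond symmetry: a real point at
  which the operator is bounded below belongs to the resolvent set.
\<close>

locale selfadjoint =
  fixes H D :: "'a::{real_inner, banach} set" and T :: "'a \<Rightarrow> 'a"
  assumes closed_H: "closed H" and subspace_H: "subspace H"
    and subspace_D: "subspace D" and D_subset: "D \<subseteq> H"
    and T_H: "\<And>u. u \<in> D \<Longrightarrow> T u \<in> H"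
    and T_add: "\<And>u v. u \<in> D \<Longrightarrow> v \<in> D \<Longrightarrow> T (u + v) = T u + T v"
    and T_scale: "\<And>c u. u \<in> D \<Longrightarrow> T (c *\<^sub>R u) = c *\<^sub>R T u"
    and T_sym: "\<And>u v. u \<in> D \<Longrightarrow> v \<in> D \<Longrightarrow> inner (T u) v = inner u (T v)"
    and surj: "\<And>\<mu> c f. 0 < c \<Longrightarrow> (\<And>u. u \<in> D \<Longrightarrow> c * norm u \<le> norm (T u - \<mu> *\<^sub>R u)) \<Longrightarrow> f \<in> H
      \<Longrightarrow> \<exists>u\<in>D. T u - \<mu> *\<^sub>R u = f"
begin

text \<open>The strict inequality excludes \<open>u = 0\<close>, which saves a
  normalization.\<close>

definition approx_eigenvalue :: "real \<Rightarrow> bool" where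
  "approx_eigenvalue \<mu> \<longleftrightarrow> (\<forall>\<epsilon>>0. \<exists>u\<in>D. norm (T u - \<mu> *\<^sub>R u) < \<epsilon> * norm u)"

lemma not_approx_eigenvalue:
  "\<not> approx_eigenvalue \<mu> \<longleftrightarrow> (\<exists>c>0. \<forall>u\<in>D. c * norm u \<le> norm (T u - \<mu> *\<^sub>R u))"
  unfolding approx_eigenvalue_def by (meson linorder_not_less)

lemma D_closed:
  "0 \<in> D" "u \<in> D \<Longrightarrow> v \<in> D \<Longrightarrow> u + v \<in> D" "u \<in> D \<Longrightarrow> c *\<^sub>R u \<in> D" "u \<in> D \<Longrightarrow> v \<in> D \<Longrightarrow> u - v \<in> D"
  using subspace_D by (auto simp: subspace_0 subspace_add subspace_scale subspace_diff)

lemma H_closed: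
  "0 \<in> H" "u \<in> H \<Longrightarrow> v \<in> H \<Longrightarrow> u + v \<in> H" "u \<in> H \<Longrightarrow> c *\<^sub>R u \<in> H" "u \<in> H \<Longrightarrow> v \<in> H \<Longrightarrow> u - v \<in> H"
  using subspace_H by (auto simp: subspace_0 subspace_add subspace_scale subspace_diff)

lemma T_diff: "u \<in> D \<Longrightarrow> v \<in> D \<Longrightarrow> T (u - v) = T u - T v"
  using T_add[of u "(-1) *\<^sub>R v"] T_scale[of v "-1"] D_closed(3)[of v "-1"] by simp

lemma T_zero: "T 0 = 0"
  using T_scale[OF D_closed(1), of 0] by simp

lemma approx_eigenvalue_closed:
  assumes "\<And>e. 0 < e \<Longrightarrow> \<exists>\<nu>. approx_eigenvalue \<nu> \<and> \<bar>\<nu> - l\<bar> < e"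
  shows "approx_eigenvalue l"
  unfolding approx_eigenvalue_def
proof (intro allI impI)
  fix \<epsilon> :: real assume "0 < \<epsilon>"
  then obtain \<nu> where \<nu>: "approx_eigenvalue \<nu>" "\<bar>\<nu> - l\<bar> < \<epsilon>/2" using assms[of "\<epsilon>/2"] by auto
  then obtain u where u: "u \<in> D" "norm (T u - \<nu> *\<^sub>R u) < \<epsilon>/2 * norm u"
    unfolding approx_eigenvalue_def using \<open>0 < \<epsilon>\<close> by (meson half_gt_zero)
  have "norm (T u - l *\<^sub>R u) = norm ((T u - \<nu> *\<^sub>R u) + (\<nu> - l) *\<^sub>R u)"
    by (simp add: algebra_simps)
  also have "\<dots> \<le> norm (T u - \<nu> *\<^sub>R u) + \<bar>\<nu> - l\<bar> * norm u"
    by (metis norm_scaleR norm_triangle_ineq)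
  also have "\<bar>\<nu> - l\<bar> * norm u \<le> \<epsilon>/2 * norm u"
    using \<nu> by (intro mult_right_mono) auto
  finally have "norm (T u - l *\<^sub>R u) < \<epsilon> * norm u" using u(2) by (simp add: field_simps)
  then show "\<exists>u\<in>D. norm (T u - l *\<^sub>R u) < \<epsilon> * norm u" using u(1) by blast
qed

text \<open>
  Let \<open>m\<close> be the infimum of \<open>norm (T u - \<mu> u)\<close> over unit vectors. For a minimizing sequence \<open>u\<close>
  with images \<open>f = T u - \<mu> u\<close> and \<open>v\<close> the preimage of \<open>u\<close>, the vector \<open>f - m\<^sup>2 v\<close> tends to \<open>0\<close>, and
  it is the image of \<open>u \<plusminus> m v\<close> under \<open>T - (\<mu> \<plusminus> m)\<close>; one of these two vectors stays away from \<open>0\<close>.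
\<close>

lemma approx_eigenvalue_near:
  assumes u0: "u0 \<in> D" "norm (T u0 - \<mu> *\<^sub>R u0) < r * norm u0"
  shows "\<exists>\<nu>. \<bar>\<nu> - \<mu>\<bar> < r \<and> approx_eigenvalue \<nu>"
proof (rule ccontr)
  assume "\<not> ?thesis"
  then have no: "\<And>\<nu>. \<bar>\<nu> - \<mu>\<bar> < r \<Longrightarrow> \<not> approx_eigenvalue \<nu>" by blast
  have u0_nz: "0 < norm u0" using u0 by (metis mult_zero_right norm_ge_zero norm_zero order_less_le_trans zero_less_norm_iff order_less_irrefl)
  have r: "0 < r" using u0(2) u0_nz by (meson norm_ge_zero order_le_less_trans zero_less_mult_pos2)
  obtain c where c: "0 < c" "\<And>u. u \<in> D \<Longrightarrow> c * norm u \<le> norm (T u - \<mu> *\<^sub>R u)"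
    using no[of \<mu>] r unfolding not_approx_eigenvalue by auto
  define N where "N = {norm (T u - \<mu> *\<^sub>R u) | u. u \<in> D \<and> norm u = 1}"
  have unit: "norm (T u - \<mu> *\<^sub>R u) / norm u \<in> N" if "u \<in> D" "u \<noteq> 0" for u
  proof -
    have "T ((1 / norm u) *\<^sub>R u) - \<mu> *\<^sub>R ((1 / norm u) *\<^sub>R u) = (1 / norm u) *\<^sub>R (T u - \<mu> *\<^sub>R u)"
      using that by (simp add: T_scale algebra_simps)
    then have "norm (T ((1 / norm u) *\<^sub>R u) - \<mu> *\<^sub>R ((1 / norm u) *\<^sub>R u)) = norm (T u - \<mu> *\<^sub>R u) / norm u"
      by simp
    moreover have "(1 / norm u) *\<^sub>R u \<in> D" "norm ((1 / norm u) *\<^sub>R u) = 1"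
      using that by (auto simp: D_closed)
    ultimately show ?thesis unfolding N_def by (intro CollectI exI[of _ "(1 / norm u) *\<^sub>R u"]) simp
  qed
  have bb: "bdd_below N" and cN: "\<And>x. x \<in> N \<Longrightarrow> c \<le> x"
    using c(2) by (force simp: N_def bdd_below_def)+
  define m where "m = Inf N"
  have "c \<le> m" unfolding m_def using unit[OF u0(1)] u0_nz cN by (intro cInf_greatest) auto
  then have m: "0 < m" using c by simp
  have "m \<le> norm (T u0 - \<mu> *\<^sub>R u0) / norm u0"
    unfolding m_def using unit[OF u0(1)] u0_nz by (intro cInf_lower bb) auto
  also have "\<dots> < r" using u0(2) u0_nz by (simp add: field_simps)
  finally have mr: "m < r" .
  have lower: "m * norm u \<le> norm (T u - \<mu> *\<^sub>R u)" if "u \<in> D" for u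
  proof (cases "u = 0")
    case False
    then have "m \<le> norm (T u - \<mu> *\<^sub>R u) / norm u"
      unfolding m_def using unit[OF that] by (intro cInf_lower bb) auto
    then show ?thesis using False by (simp add: field_simps)
  qed simp
  obtain c1 where c1: "0 < c1" "\<And>u. u \<in> D \<Longrightarrow> c1 * norm u \<le> norm (T u - (\<mu> + m) *\<^sub>R u)"
    using no[of "\<mu> + m"] m mr unfolding not_approx_eigenvalue by auto
  obtain c2 where c2: "0 < c2" "\<And>u. u \<in> D \<Longrightarrow> c2 * norm u \<le> norm (T u - (\<mu> - m) *\<^sub>R u)"
    using no[of "\<mu> - m"] m mr unfolding not_approx_eigenvalue by auto
  define d where "d = min c1 c2"
  have d: "0 < d" "d \<le> c1" "d \<le> c2" using c1 c2 by (auto simp: d_def)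
  \<comment> \<open>The excess d^2/2 over m^2 keeps the squared norm of
    \<open>f - m\<^sup>2 *\<^sub>R v\<close>, which is at most
    \<open>(norm f)\<^sup>2 - m\<^sup>2\<close>, below d^2.\<close>
  define x where "x = sqrt (m\<^sup>2 + d\<^sup>2 / 2)"
  have "m < x" unfolding x_def using m d by (intro real_less_rsqrt) auto
  then have "\<exists>y\<in>N. y < x" unfolding m_def using unit[OF u0(1)] u0_nz bb by (intro cInf_lessD) auto
  then obtain u where u: "u \<in> D" "norm u = 1" "norm (T u - \<mu> *\<^sub>R u) < x" by (auto simp: N_def)
  define f where "f = T u - \<mu> *\<^sub>R u"
  have fx: "(norm f)\<^sup>2 < m\<^sup>2 + d\<^sup>2 / 2"
  proof -
    have "(norm f)\<^sup>2 < x\<^sup>2" using u(3) unfolding f_def by (intro power_strict_mono) auto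
    then show ?thesis by (simp add: x_def)
  qed
  obtain v where v: "v \<in> D" "T v - \<mu> *\<^sub>R v = u"
    using surj[OF c(1) c(2), of u] u(1) D_subset by blast
  \<comment> \<open>By symmetry the operator moves from \<open>u\<close> to \<open>v\<close>, whose
    image is the unit vector \<open>u\<close>.\<close>
  have vf: "inner v f = 1"
  proof -
    have "inner v f = inner (T v - \<mu> *\<^sub>R v) u"
      using T_sym[OF v(1) u(1)] by (simp add: f_def inner_diff_left inner_diff_right)
    then show ?thesis using v(2) u(2) by (simp add: norm_eq_1)
  qed
  have nv: "m * norm v \<le> 1" using lower[OF v(1)] v(2) u(2) by simp
  have "(norm (f - m\<^sup>2 *\<^sub>R v))\<^sup>2 = (norm f)\<^sup>2 - 2 * m\<^sup>2 + m\<^sup>2 * (m * norm v)\<^sup>2"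
    using vf unfolding power2_norm_eq_inner power_mult_distrib
    by (simp add: inner_diff_left inner_diff_right inner_commute power2_eq_square algebra_simps)
  also have "\<dots> \<le> (norm f)\<^sup>2 - 2 * m\<^sup>2 + m\<^sup>2 * 1"
    using nv m by (intro add_left_mono mult_left_mono) (auto simp: power_le_one)
  also have "\<dots> < d\<^sup>2" using fx zero_less_power[OF d(1), of 2] by linarith
  finally have small: "norm (f - m\<^sup>2 *\<^sub>R v) < d"
    using d(1) by (meson less_eq_real_def power_less_imp_less_base)
  have e1: "T (u + m *\<^sub>R v) - (\<mu> + m) *\<^sub>R (u + m *\<^sub>R v) = f - m\<^sup>2 *\<^sub>R v"
  proof -
    have "T (u + m *\<^sub>R v) = (f + \<mu> *\<^sub>R u) + m *\<^sub>R (u + \<mu> *\<^sub>R v)"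
      using v f_def u(1) by (simp add: T_add T_scale D_closed flip: v(2))
    then show ?thesis by (simp add: algebra_simps power2_eq_square)
  qed
  have e2: "T (u - m *\<^sub>R v) - (\<mu> - m) *\<^sub>R (u - m *\<^sub>R v) = f - m\<^sup>2 *\<^sub>R v"
  proof -
    have "T (u - m *\<^sub>R v) = (f + \<mu> *\<^sub>R u) - m *\<^sub>R (u + \<mu> *\<^sub>R v)"
      using v f_def u(1) by (simp add: T_diff T_scale D_closed flip: v(2))
    then show ?thesis by (simp add: algebra_simps power2_eq_square)
  qed
  have b1: "d * norm (u + m *\<^sub>R v) < d"
    using c1(2)[of "u + m *\<^sub>R v"] small d v(1) u(1) unfolding e1
    by (meson D_closed mult_right_mono norm_ge_zero order_le_less_trans)
  have b2: "d * norm (u - m *\<^sub>R v) < d"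
    using c2(2)[of "u - m *\<^sub>R v"] small d v(1) u(1) unfolding e2
    by (meson D_closed mult_right_mono norm_ge_zero order_le_less_trans)
  \<comment> \<open>Both vectors would have norm below 1, yet their sum is twice the unit vector
    \<open>u\<close>.\<close>
  have "2 = norm ((u + m *\<^sub>R v) + (u - m *\<^sub>R v))"
    using u(2) by (simp flip: scaleR_2)
  also have "\<dots> \<le> norm (u + m *\<^sub>R v) + norm (u - m *\<^sub>R v)" by (rule norm_triangle_ineq)
  also have "\<dots> < 2" using b1 b2 d(1) by simp
  finally show False by simp
qed

text \<open>
  With \<open>A = T - l\<close> and \<open>C = A (A - t)\<^sup>-\<^sup>1\<close>, the gap on both sides of \<open>l\<close> yields
  \<open>C\<^sup>2 \<le> 2 C \<le> 3 C\<^sup>2\<close>. Hence \<open>1 - C/2\<close> is a contraction on the range of \<open>C\<close>, and its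
  iterates starting at \<open>f\<close> converge geometrically to an element of the kernel of \<open>C\<close> whose distance to \<open>f\<close>
  is of order \<open>norm (C f)\<close>.
\<close>

lemma distance_to_kernel:
  assumes \<delta>: "0 < \<delta>" and gap: "\<And>\<nu>. \<nu> \<noteq> l \<Longrightarrow> \<bar>\<nu> - l\<bar> < \<delta> \<Longrightarrow> \<not> approx_eigenvalue \<nu>"
  shows "\<exists>K>0. \<forall>u\<in>D. \<exists>w\<in>D. T w = l *\<^sub>R w \<and> norm (u - w) \<le> K * norm (T u - l *\<^sub>R u)"
proof -
  define A where "A u = T u - l *\<^sub>R u" for u
  define t where "t = \<delta> / 2"
  have t: "0 < t" using \<delta> by (simp add: t_def)
  have A_H: "A u \<in> H" if "u \<in> D" for u
    unfolding A_def using that D_subset by (auto intro!: H_closed T_H)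
  have A_add: "A (u + v) = A u + A v" and A_diff: "A (u - v) = A u - A v" if "u \<in> D" "v \<in> D" for u v
    using that by (simp_all add: A_def T_add T_diff algebra_simps)
  have A_scale: "A (c *\<^sub>R u) = c *\<^sub>R A u" if "u \<in> D" for c u
    using that by (simp add: A_def T_scale algebra_simps)
  have A_sym: "inner (A u) v = inner u (A v)" if "u \<in> D" "v \<in> D" for u v
    using that T_sym by (simp add: A_def inner_diff_left inner_diff_right)
  \<comment> \<open>At distance t = \<delta>/2 from \<open>l\<close>, a smaller residual would put
    spectrum strictly between \<open>l\<close> and \<open>l + \<delta>\<close>.\<close>
  have above: "t * norm u \<le> norm (A u - t *\<^sub>R u)" if "u \<in> D" for u
  proof (rule ccontr)
    assume "\<not> ?thesis"
    then have "norm (T u - (l + t) *\<^sub>R u) < t * norm u" by (simp add: A_def algebra_simps)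
    from approx_eigenvalue_near[OF that this] obtain \<nu> where "\<bar>\<nu> - (l + t)\<bar> < t" "approx_eigenvalue \<nu>" by blast
    then show False using gap[of \<nu>] by (auto simp: t_def abs_if split: if_splits)
  qed
  have below: "t * norm u \<le> norm (A u + t *\<^sub>R u)" if "u \<in> D" for u
  proof (rule ccontr)
    assume "\<not> ?thesis"
    then have "norm (T u - (l - t) *\<^sub>R u) < t * norm u" by (simp add: A_def algebra_simps)
    from approx_eigenvalue_near[OF that this] obtain \<nu> where "\<bar>\<nu> - (l - t)\<bar> < t" "approx_eigenvalue \<nu>" by blast
    then show False using gap[of \<nu>] by (auto simp: t_def abs_if split: if_splits)
  qed
  \<comment> \<open>Squaring the bound gives the form inequality 2 t A \<le> A^2; the bound on the
    other side of \<open>l\<close> gives -2 t A \<le> A^2.\<close>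
  have form1: "2 * t * inner (A u) u \<le> (norm (A u))\<^sup>2" if "u \<in> D" for u
  proof -
    have "(t * norm u)\<^sup>2 \<le> (norm (A u - t *\<^sub>R u))\<^sup>2"
      using above[OF that] t by (intro power_mono) auto
    then show ?thesis
      unfolding power_mult_distrib power2_norm_eq_inner
      by (simp add: inner_diff_left inner_diff_right inner_commute power2_eq_square algebra_simps)
  qed
  have form2: "- 2 * t * inner (A u) u \<le> (norm (A u))\<^sup>2" if "u \<in> D" for u
  proof -
    have "(t * norm u)\<^sup>2 \<le> (norm (A u + t *\<^sub>R u))\<^sup>2"
      using below[OF that] t by (intro power_mono) auto
    then show ?thesis
      unfolding power_mult_distrib power2_norm_eq_inner
      by (simp add: inner_add_left inner_add_right inner_commute power2_eq_square algebra_simps)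
  qed
  have "\<exists>u\<in>D. A u - t *\<^sub>R u = f" if "f \<in> H" for f
    using surj[of t "l + t" f] t above that by (simp add: A_def algebra_simps)
  then obtain R where R: "\<And>f. f \<in> H \<Longrightarrow> R f \<in> D" "\<And>f. f \<in> H \<Longrightarrow> A (R f) - t *\<^sub>R R f = f"
    by metis
  have R_unique: "u = R f" if "u \<in> D" "f \<in> H" "A u - t *\<^sub>R u = f" for u f
  proof -
    have "A (u - R f) - t *\<^sub>R (u - R f) = 0"
      using that R[of f] by (simp add: A_diff algebra_simps)
    then have "t * norm (u - R f) \<le> 0" using above[of "u - R f"] R[of f] that D_closed by simp
    then show ?thesis using t by (simp add: mult_le_0_iff)
  qed
  define C where "C f = A (R f)" for f
  have C_H: "C f \<in> H" if "f \<in> H" for f using that R by (simp add: C_def A_H)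
  have tR: "t *\<^sub>R R f = C f - f" if "f \<in> H" for f
    using R(2)[OF that] by (simp add: C_def algebra_simps)
  have R_lin: "R (f - s *\<^sub>R g) = R f - s *\<^sub>R R g" if "f \<in> H" "g \<in> H" for f g s
    by (rule R_unique[symmetric])
      (use that R[of f] R[of g] in \<open>auto simp: A_diff A_scale D_closed H_closed algebra_simps\<close>)
  have C_lin: "C (f - s *\<^sub>R g) = C f - s *\<^sub>R C g" if "f \<in> H" "g \<in> H" for f g s
    using that R by (simp add: C_def R_lin A_diff A_scale D_closed)
  \<comment> \<open>Since \<open>C f - f\<close> equals \<open>t *\<^sub>R R f\<close>, symmetry of
    \<open>A\<close> on the domain turns into symmetry of \<open>C\<close> on all of
    \<open>H\<close>.\<close>
  have C_sym: "inner (C f) g = inner f (C g)" if "f \<in> H" "g \<in> H" for f g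
  proof -
    have "inner (C f) (C g - g) = inner (C f - f) (C g)"
      using A_sym[OF R(1) R(1), OF that] by (simp add: C_def[symmetric] tR[symmetric] that)
    then show ?thesis by (simp add: inner_diff_left inner_diff_right)
  qed
  \<comment> \<open>Both bounds on \<open>C\<close> are the form inequalities evaluated at
    \<open>R f\<close>, where \<open>t *\<^sub>R R f\<close> is replaced by
    \<open>C f - f\<close>.\<close>
  have C1: "(norm (C f))\<^sup>2 \<le> 2 * inner (C f) f" if "f \<in> H" for f
  proof -
    have "2 * inner (C f) (t *\<^sub>R R f) \<le> (norm (C f))\<^sup>2"
      using form1[OF R(1)[OF that]] by (simp add: C_def)
    then show ?thesis
      by (simp add: tR that inner_diff_right power2_norm_eq_inner)
  qed
  have C2: "2 * inner (C f) f \<le> 3 * (norm (C f))\<^sup>2" if "f \<in> H" for f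
  proof -
    have "- 2 * inner (C f) (t *\<^sub>R R f) \<le> (norm (C f))\<^sup>2"
      using form2[OF R(1)[OF that]] by (simp add: C_def)
    then show ?thesis
      by (simp add: tR that inner_diff_right power2_norm_eq_inner)
  qed
  have C_bound: "norm (C f) \<le> 2 * norm f" if "f \<in> H" for f
  proof (cases "C f = 0")
    case False
    have "norm (C f) * norm (C f) \<le> norm (C f) * (2 * norm f)"
      using C1[OF that] norm_cauchy_schwarz[of "C f" f] by (simp add: power2_eq_square)
    then show ?thesis using False by simp
  qed simp
  \<comment> \<open>Positivity of the form of \<open>C\<close> at
    \<open>f - (3/2) *\<^sub>R C f\<close> yields C \<ge> 2/3 on the range of \<open>C\<close>; the
    factor 3/2 gives the best constant.\<close>
  have range_pos: "2 * (norm (C f))\<^sup>2 \<le> 3 * inner (C (C f)) (C f)" if "f \<in> H" for f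
  proof -
    define g where "g = f - (3/2) *\<^sub>R C f"
    have g: "g \<in> H" using that C_H by (simp add: g_def H_closed)
    have "0 \<le> inner (C g) g" using C1[OF g] by (smt (verit) zero_le_power2)
    also have "\<dots> = inner (C f) f - 3 * (norm (C f))\<^sup>2 + (9/4) * inner (C (C f)) (C f)"
      using C_sym[OF C_H[OF that] that] that C_H
      by (simp add: g_def C_lin inner_diff_left inner_diff_right power2_norm_eq_inner inner_commute)
    finally show ?thesis using C2[OF that] by simp
  qed
  \<comment> \<open>In the expanded squared norm of \<open>C (step f)\<close> the quadratic term is
    at most half of \<open>inner (C (C f)) (C f)\<close>, and the remaining half is at least a third
    of \<open>(norm (C f))\<^sup>2\<close>; this leaves 1 - 1/3.\<close>
  define q :: real where "q = sqrt (2/3)"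
  have q: "0 < q" "q < 1" "q\<^sup>2 = 2/3" by (auto simp: q_def)
  define step where "step f = f - (1/2) *\<^sub>R C f" for f
  have step_H: "step f \<in> H" if "f \<in> H" for f using that C_H by (simp add: step_def H_closed)
  have C_step: "norm (C (step f)) \<le> q * norm (C f)" if "f \<in> H" for f
  proof -
    have "(norm (C (step f)))\<^sup>2 = (norm (C f))\<^sup>2 - inner (C (C f)) (C f) + (norm (C (C f)))\<^sup>2 / 4"
      using that C_H
      by (simp add: step_def C_lin inner_diff_left inner_diff_right power2_norm_eq_inner inner_commute)
    also have "\<dots> \<le> (2/3) * (norm (C f))\<^sup>2"
      using C1[OF C_H[OF that]] range_pos[OF that] by simp
    finally have "(norm (C (step f)))\<^sup>2 \<le> (q * norm (C f))\<^sup>2" by (simp add: power_mult_distrib q)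
    then show ?thesis by (rule power2_le_imp_le) (use q in simp)
  qed
  \<comment> \<open>The geometric series bounds \<open>norm (f - w)\<close>, and passing back
    through \<open>R\<close> costs a factor 1/t.\<close>
  define K where "K = (1/2) / (1 - q) / t"
  have K: "0 < K" using q t by (simp add: K_def)
  have "\<exists>w\<in>D. A w = 0 \<and> norm (u - w) \<le> K * norm (A u)" if u: "u \<in> D" for u
  proof -
    define f where "f = A u - t *\<^sub>R u"
    have f: "f \<in> H" unfolding f_def using u A_H D_subset by (auto intro!: H_closed)
    have uR: "u = R f" using R_unique[OF u f] by (simp add: f_def)
    define F where "F n = (step ^^ n) f" for n
    have F_H: "F n \<in> H" for n by (induction n) (simp_all add: F_def f step_H)
    have CF: "norm (C (F n)) \<le> q ^ n * norm (C f)" for n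
    proof (induction n)
      case (Suc n)
      have "norm (C (F (Suc n))) \<le> q * norm (C (F n))" using C_step[OF F_H] by (simp add: F_def)
      also have "\<dots> \<le> q * (q ^ n * norm (C f))" using Suc q by (intro mult_left_mono) auto
      finally show ?case by simp
    qed (simp add: F_def)
    have diff: "F n - F (Suc n) = (1/2) *\<^sub>R C (F n)" for n by (simp add: F_def step_def)
    have tele: "f - F n = (\<Sum>i<n. F i - F (Suc i))" for n
      using sum_lessThan_telescope'[of F n] by (simp add: F_def[of 0])
    have nd: "norm (F n - F (Suc n)) \<le> (1/2) * norm (C f) * q ^ n" for n
      using CF[of n] by (simp add: diff mult.commute)
    have sg: "summable (\<lambda>n. (1/2) * norm (C f) * q ^ n)"
      using q by (intro summable_mult summable_geometric) auto
    have sn: "summable (\<lambda>n. norm (F n - F (Suc n)))"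
      using nd by (intro summable_comparison_test'[OF sg, of 0]) auto
    define w where "w = f - (\<Sum>n. F n - F (Suc n))"
    have "(\<lambda>n. f - (\<Sum>i<n. F i - F (Suc i))) \<longlonglongrightarrow> w"
      unfolding w_def by (intro tendsto_intros summable_LIMSEQ summable_norm_cancel[OF sn])
    then have Fw: "F \<longlonglongrightarrow> w" by (simp flip: tele)
    then have w: "w \<in> H" using closed_H F_H by (rule closed_sequentially[rotated 2])
    have fw: "norm (f - w) \<le> (1/2) / (1 - q) * norm (C f)"
    proof -
      have "norm (f - w) \<le> (\<Sum>n. norm (F n - F (Suc n)))"
        by (simp add: w_def summable_norm[OF sn])
      also have "\<dots> \<le> (\<Sum>n. (1/2) * norm (C f) * q ^ n)"
        using nd by (intro suminf_le sn sg) auto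
      also have "\<dots> = (1/2) / (1 - q) * norm (C f)"
        using q suminf_mult[of "\<lambda>n. q ^ n" "(1/2) * norm (C f)"] suminf_geometric[of q]
        by (simp add: summable_geometric mult.commute)
      finally show ?thesis .
    qed
    have "(\<lambda>n. C (F n)) \<longlonglongrightarrow> C w"
    proof (rule Lim_null[THEN iffD2], rule Lim_null_comparison)
      show "\<forall>\<^sub>F n in sequentially. norm (C (F n) - C w) \<le> 2 * norm (F n - w)"
        using C_lin[OF F_H w, of _ 1] C_bound[OF H_closed(4)[OF F_H w]] by simp
      show "(\<lambda>n. 2 * norm (F n - w)) \<longlonglongrightarrow> 0"
        using Fw by (auto intro!: tendsto_eq_intros simp: LIM_zero_iff tendsto_norm_zero_iff)
    qed
    moreover have "(\<lambda>n. C (F n)) \<longlonglongrightarrow> 0"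
    proof (rule Lim_null_comparison)
      show "\<forall>\<^sub>F n in sequentially. norm (C (F n)) \<le> q ^ n * norm (C f)" using CF by simp
      show "(\<lambda>n. q ^ n * norm (C f)) \<longlonglongrightarrow> 0"
        using q by (intro tendsto_mult_left_zero LIMSEQ_power_zero) auto
    qed
    ultimately have Cw: "C w = 0" by (rule LIMSEQ_unique)
    have "u - R w = R (f - w)" using R_lin[OF f w, of 1] uR by simp
    then have "t * norm (u - R w) \<le> norm (f - w)"
      using above[of "R (f - w)"] R[of "f - w"] H_closed(4)[OF f w] by simp
    also note fw
    finally have "norm (u - R w) \<le> (1/2) / (1 - q) * norm (C f) / t"
      using t by (subst pos_le_divide_eq) (simp_all only: mult.commute)
    then have "norm (u - R w) \<le> K * norm (C f)" by (simp only: K_def times_divide_eq_left)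
    then show ?thesis using Cw R(1)[OF w] uR by (auto simp: C_def)
  qed
  then show ?thesis using K by (auto simp: A_def)
qed

end

section \<open>Selfadjointness of Jacobi operators\<close>

lemma bij_add_int: "bij_betw (\<lambda>n. n + k) UNIV (UNIV :: int set)"
  by (rule bij_betwI[where g = "\<lambda>n. n - k"]) auto

lemma ell2_shift: "u \<in> ell2 UNIV \<Longrightarrow> (\<lambda>n. u (n + k)) \<in> ell2 (UNIV :: int set)"
  using summable_on_reindex_bij_betw[OF bij_add_int[of k], of "\<lambda>n. (cmod (u n))\<^sup>2"]
  by (simp add: ell2_UNIV_iff)

lift_definition shift :: "int \<Rightarrow> int l2 \<Rightarrow> int l2" is "\<lambda>k u n. u (n + k)"
  by (rule ell2_shift)

lemma coord_shift [simp]: "shift k u $$ n = u $$ (n + k)"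
  by (simp add: coord.rep_eq shift.rep_eq)

lemma norm_shift [simp]: "norm (shift k u) = norm u"
  using infsum_reindex_bij_betw[OF bij_add_int[of k], of "\<lambda>n. (cmod (u $$ n))\<^sup>2"]
  by (simp add: norm_l2_eq ell2_norm_def)

definition l2_on :: "int set \<Rightarrow> int l2 set" where
  "l2_on S = {u. \<forall>n. n \<notin> S \<longrightarrow> u $$ n = 0}"

definition l2_dom :: "int set \<Rightarrow> (int \<Rightarrow> real) \<Rightarrow> int l2 set" where
  "l2_dom S b = {u \<in> l2_on S. (\<lambda>n. complex_of_real (b n) * u $$ n) \<in> ell2 UNIV}"

definition l2_jacobi :: "int set \<Rightarrow> (int \<Rightarrow> real) \<Rightarrow> (int \<Rightarrow> real) \<Rightarrow> int l2 \<Rightarrow> int l2" where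
  "l2_jacobi S a b u = Abs_l2 (jacobi_op S a b (coord u))"

lemma closed_l2_on: "closed (l2_on S)"
proof -
  have "l2_on S = (\<Inter>n\<in>-S. {u. u $$ n = 0})" by (auto simp: l2_on_def)
  then show ?thesis
    by (simp add: closed_INT closed_Collect_eq bounded_linear.continuous_on[OF bounded_linear_coord])
qed

lemma subspace_l2_on: "subspace (l2_on S)"
  by (auto simp: subspace_def l2_on_def)

lemma cs_l2_on: "u \<in> l2_on S \<Longrightarrow> cs c u \<in> l2_on S"
  by (auto simp: l2_on_def)

lemma coord_image_l2_on: "coord ` l2_on S = ell2 S"
proof (intro equalityI subsetI)
  fix u assume "u \<in> ell2 S"
  then have c: "Abs_l2 u $$ n = u n" for n by (intro coord_Abs) (rule ell2_imp_UNIV)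
  then have "coord (Abs_l2 u) = u" "Abs_l2 u \<in> l2_on S"
    using \<open>u \<in> ell2 S\<close> by (auto simp: l2_on_def ell2_def)
  then show "u \<in> coord ` l2_on S" by (metis image_eqI)
qed (use coord_in_ell2 in \<open>force simp: l2_on_def ell2_def\<close>)

lemma coord_in_ell2_iff: "coord u \<in> ell2 S \<longleftrightarrow> u \<in> l2_on S"
  using coord_in_ell2[of u] by (auto simp: l2_on_def ell2_def)

lemma coord_in_jacobi_domain: "coord u \<in> jacobi_domain S b \<longleftrightarrow> u \<in> l2_dom S b"
  by (auto simp: jacobi_domain_def l2_dom_def coord_in_ell2_iff) (auto simp: l2_on_def ell2_def)

lemma coord_image_l2_dom: "coord ` l2_dom S b = jacobi_domain S b"
proof (intro equalityI subsetI)
  fix u assume u: "u \<in> jacobi_domain S b"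
  then have "u \<in> coord ` l2_on S" by (simp add: coord_image_l2_on jacobi_domain_def)
  then show "u \<in> coord ` l2_dom S b" using u coord_in_jacobi_domain by blast
qed (auto simp: coord_in_jacobi_domain)

lemma subspace_l2_dom: "subspace (l2_dom S b)"
proof -
  have "(\<lambda>n. complex_of_real (b n) * (u $$ n + v $$ n)) \<in> ell2 UNIV"
    if "(\<lambda>n. complex_of_real (b n) * u $$ n) \<in> ell2 UNIV" "(\<lambda>n. complex_of_real (b n) * v $$ n) \<in> ell2 UNIV" for u v :: "int l2"
    using ell2_add[OF that] by (simp add: algebra_simps)
  moreover have "(\<lambda>n. complex_of_real (b n) * (complex_of_real c * u $$ n)) \<in> ell2 UNIV"
    if "(\<lambda>n. complex_of_real (b n) * u $$ n) \<in> ell2 UNIV" for u :: "int l2" and c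
    using ell2_cmult[OF that, of c] by (simp add: algebra_simps)
  ultimately show ?thesis
    using subspace_l2_on[of S] by (auto simp: subspace_def l2_dom_def ell2_zero)
qed

lemma cs_l2_dom: "u \<in> l2_dom S b \<Longrightarrow> cs c u \<in> l2_dom S b"
  using ell2_cmult[where u = "\<lambda>n. complex_of_real (b n) * u $$ n" and c = c]
  by (simp add: l2_dom_def cs_l2_on algebra_simps)

lemma pythagoras: "inner w v = 0 \<Longrightarrow> (norm (w - v))\<^sup>2 = (norm w)\<^sup>2 + (norm v)\<^sup>2"
  for v w :: "'b::real_inner"
  by (simp add: power2_norm_eq_inner inner_diff_left inner_diff_right inner_commute)

text \<open>The set \<open>S\<close> is the half line for \<open>J\<close> and the set of finite
  sites for a right limit, so one development serves both.\<close>

locale jacobi =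
  fixes S :: "int set" and a b :: "int \<Rightarrow> real" and M :: real
  assumes a_bound: "\<And>n. \<bar>a n\<bar> \<le> M"
begin

lemma M_nonneg: "0 \<le> M"
  using a_bound[of 0] by linarith

abbreviation "H \<equiv> l2_on S"
abbreviation "D \<equiv> l2_dom S b"
abbreviation "J \<equiv> l2_jacobi S a b"

text \<open>\<open>K\<close> is split so that each half is dominated, coordinate by coordinate, by
  \<open>M\<close> times a shifted copy of \<open>u\<close>.\<close>

definition K1 :: "int l2 \<Rightarrow> int l2" where
  "K1 u = Abs_l2 (\<lambda>n. if n \<in> S then complex_of_real (a (n - 1)) * u $$ (n - 1) else 0)"

definition K2 :: "int l2 \<Rightarrow> int l2" where
  "K2 u = Abs_l2 (\<lambda>n. if n \<in> S then complex_of_real (a n) * u $$ (n + 1) else 0)"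

definition K :: "int l2 \<Rightarrow> int l2" where "K u = K1 u + K2 u"

lemma K1_le: "cmod (if n \<in> S then complex_of_real (a (n - 1)) * u $$ (n - 1) else 0) \<le> M * cmod (shift (-1) u $$ n)"
  using a_bound[of "n - 1"] M_nonneg by (auto simp: norm_mult intro!: mult_right_mono)

lemma K2_le: "cmod (if n \<in> S then complex_of_real (a n) * u $$ (n + 1) else 0) \<le> M * cmod (shift 1 u $$ n)"
  using a_bound[of n] M_nonneg by (auto simp: norm_mult intro!: mult_right_mono)

lemma coord_K1: "K1 u $$ n = (if n \<in> S then complex_of_real (a (n - 1)) * u $$ (n - 1) else 0)"
  unfolding K1_def by (rule coord_Abs, rule ell2_bound[OF coord_in_ell2 K1_le])

lemma coord_K2: "K2 u $$ n = (if n \<in> S then complex_of_real (a n) * u $$ (n + 1) else 0)"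
  unfolding K2_def by (rule coord_Abs, rule ell2_bound[OF coord_in_ell2 K2_le])

lemma coord_K:
  "K u $$ n = (if n \<in> S then complex_of_real (a (n - 1)) * u $$ (n - 1) + complex_of_real (a n) * u $$ (n + 1) else 0)"
  by (simp add: K_def coord_K1 coord_K2)

lemma norm_K: "norm (K u) \<le> 2 * M * norm u"
proof -
  have "norm (K1 u) \<le> M * norm (shift (-1) u)"
    by (rule norm_l2_mono[OF _ M_nonneg]) (unfold coord_K1, rule K1_le)
  moreover have "norm (K2 u) \<le> M * norm (shift 1 u)"
    by (rule norm_l2_mono[OF _ M_nonneg]) (unfold coord_K2, rule K2_le)
  ultimately show ?thesis
    using norm_triangle_ineq[of "K1 u" "K2 u"] by (simp add: K_def)
qed

lemma K_diff: "K (u - v) = K u - K v"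
  by (rule l2_eqI) (simp add: coord_K algebra_simps)

lemma K_in_H: "K u \<in> H"
  by (simp add: l2_on_def coord_K)

lemma K_sym:
  assumes "u \<in> H" "v \<in> H"
  shows "inner (K u) v = inner u (K v)"
proof -
  have *: "inner (K1 u) v = inner u (K2 v)" if u: "u \<in> H" and v: "v \<in> H" for u v
  proof -
    have "inner (K1 u) v = (\<Sum>\<^sub>\<infinity>n. a (n - 1) * inner (u $$ (n - 1)) (v $$ n))"
      unfolding inner_l2_def
      by (intro infsum_cong) (use v in \<open>auto simp: coord_K1 l2_on_def inner_complex_def algebra_simps\<close>)
    also have "\<dots> = (\<Sum>\<^sub>\<infinity>n. a n * inner (u $$ n) (v $$ (n + 1)))"
      using infsum_reindex_bij_betw[OF bij_add_int[of "-1"], of "\<lambda>n. a n * inner (u $$ n) (v $$ (n + 1))"]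
      by simp
    also have "\<dots> = inner u (K2 v)"
      unfolding inner_l2_def
      by (intro infsum_cong) (use u in \<open>auto simp: coord_K2 l2_on_def inner_complex_def algebra_simps\<close>)
    finally show ?thesis .
  qed
  show ?thesis
    using *[OF assms] *[OF assms(2,1)]
    by (simp add: K_def inner_add_left inner_add_right inner_commute)
qed

lemma D_sub_H: "u \<in> D \<Longrightarrow> u \<in> H"
  by (simp add: l2_dom_def)

lemma jacobi_op_eq: "u \<in> H \<Longrightarrow> jacobi_op S a b (coord u) = (\<lambda>n. K u $$ n + complex_of_real (b n) * u $$ n)"
  by (auto simp: jacobi_op_def coord_K l2_on_def)

lemma coord_J: "u \<in> D \<Longrightarrow> coord (J u) = jacobi_op S a b (coord u)"
proof -
  assume u: "u \<in> D"
  have "jacobi_op S a b (coord u) \<in> ell2 UNIV"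
    unfolding jacobi_op_eq[OF D_sub_H[OF u]]
    using u by (intro ell2_add[OF coord_in_ell2]) (simp add: l2_dom_def)
  then show "coord (J u) = jacobi_op S a b (coord u)"
    unfolding l2_jacobi_def by (intro ext coord_Abs)
qed

lemma coord_J': "u \<in> D \<Longrightarrow> J u $$ n = K u $$ n + complex_of_real (b n) * u $$ n"
  by (simp add: coord_J jacobi_op_eq D_sub_H)

lemma J_H: "u \<in> D \<Longrightarrow> J u \<in> H"
  by (simp add: l2_on_def coord_J jacobi_op_def)

lemma D_closed_add: "u \<in> D \<Longrightarrow> v \<in> D \<Longrightarrow> u + v \<in> D" "u \<in> D \<Longrightarrow> v \<in> D \<Longrightarrow> u - v \<in> D" "u \<in> D \<Longrightarrow> r *\<^sub>R u \<in> D"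
  using subspace_l2_dom[of S b] by (auto simp: subspace_add subspace_diff subspace_scale)

lemma J_add: "u \<in> D \<Longrightarrow> v \<in> D \<Longrightarrow> J (u + v) = J u + J v"
  by (rule l2_eqI) (simp add: coord_J' D_closed_add coord_K algebra_simps)

lemma J_diff: "u \<in> D \<Longrightarrow> v \<in> D \<Longrightarrow> J (u - v) = J u - J v"
  by (rule l2_eqI) (simp add: coord_J' D_closed_add coord_K algebra_simps)

lemma J_cs: "u \<in> D \<Longrightarrow> J (cs c u) = cs c (J u)"
  by (rule l2_eqI) (simp add: coord_J' cs_l2_dom coord_K algebra_simps)

lemma J_sym:
  assumes "u \<in> D" "v \<in> D"
  shows "inner (J u) v = inner u (J v)"
proof -
  have B: "inner (J u - K u) v = inner u (J v - K v)"
    unfolding inner_l2_def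
    by (intro infsum_cong) (simp add: assms coord_J' inner_complex_def algebra_simps)
  then show ?thesis
    using K_sym[OF assms[THEN D_sub_H]] by (simp add: inner_diff_left inner_diff_right)
qed

text \<open>The imaginary part contributes \<open>y *\<^sub>R cs \<i> u\<close>, which is orthogonal
  to the residual at \<open>x\<close>: both \<open>inner (J u) (cs \<i> u)\<close> and
  \<open>inner u (cs \<i> u)\<close> vanish.\<close>

lemma norm_J_shifted_complex:
  assumes u: "u \<in> D"
  shows "(norm (J u - cs (Complex x y) u))\<^sup>2 = (norm (J u - x *\<^sub>R u))\<^sup>2 + y\<^sup>2 * (norm u)\<^sup>2"
proof -
  have split: "J u - cs (Complex x y) u = (J u - x *\<^sub>R u) - y *\<^sub>R cs \<i> u"
    by (rule l2_eqI) (simp add: complex_eq_iff)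
  have "inner (J u) (cs \<i> u) = inner u (cs \<i> (J u))"
    using J_sym[OF u cs_l2_dom[OF u]] by (simp add: J_cs u)
  then have "inner (J u) (cs \<i> u) = 0"
    by (simp add: inner_cs_imaginary_unit inner_commute)
  moreover have "inner u (cs \<i> u) = 0"
    using inner_cs_imaginary_unit[of u u] by (simp add: inner_commute)
  ultimately have orth: "inner (J u - x *\<^sub>R u) (cs \<i> u) = 0" by (simp add: inner_diff_left)
  have "(norm (J u - cs (Complex x y) u))\<^sup>2 = (norm (J u - x *\<^sub>R u))\<^sup>2 + (norm (y *\<^sub>R cs \<i> u))\<^sup>2"
    unfolding split by (rule pythagoras) (simp add: orth)
  then show ?thesis by (simp add: power_mult_distrib)
qed

section \<open>Surjectivity of shifted Jacobi operators\<close>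

definition surjective_at :: "complex \<Rightarrow> bool" where
  "surjective_at z \<longleftrightarrow> (\<forall>f\<in>H. \<exists>u\<in>D. J u - cs z u = f)"

lemma fixpoint_in_H:
  assumes c: "0 \<le> c" "c < 1" and "\<And>g. g \<in> H \<Longrightarrow> \<Phi> g \<in> H"
    and "\<And>g h. g \<in> H \<Longrightarrow> h \<in> H \<Longrightarrow> norm (\<Phi> g - \<Phi> h) \<le> c * norm (g - h)"
  shows "\<exists>g\<in>H. \<Phi> g = g"
proof -
  have "H \<noteq> {}" using subspace_0[OF subspace_l2_on[of S]] by blast
  then have "\<exists>!g. g \<in> H \<and> \<Phi> g = g"
    using assms closed_l2_on[of S]
    by (intro Banach_fix[of H c]) (auto simp: dist_norm complete_eq_closed)
  then show ?thesis by blast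
qed

lemma H_closed_add: "u \<in> H \<Longrightarrow> v \<in> H \<Longrightarrow> u + v \<in> H" "u \<in> H \<Longrightarrow> v \<in> H \<Longrightarrow> u - v \<in> H"
  using subspace_l2_on[of S] by (auto simp: subspace_add subspace_diff)

text \<open>Far from the real axis \<open>K\<close> is a small perturbation: the resolvent of the
  diagonal has norm at most 1/\<bar>Im z\<bar>, so the equation for g = (b - z) u is the fixed point
  problem of a contraction with factor 2M/\<bar>Im z\<bar>.\<close>

lemma surjective_at_far:
  assumes z: "2 * M < \<bar>Im z\<bar>"
  shows "surjective_at z"
  unfolding surjective_at_def
proof
  fix f assume f: "f \<in> H"
  define y where "y = \<bar>Im z\<bar>"
  have y: "0 < y" "2 * M < y" using z M_nonneg by (auto simp: y_def)
  have yb: "y \<le> cmod (complex_of_real (b n) - z)" for n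
    using abs_Im_le_cmod[of "complex_of_real (b n) - z"] by (simp add: y_def)
  have nz: "complex_of_real (b n) - z \<noteq> 0" for n using yb[of n] y by auto
  define R where "R g = Abs_l2 (\<lambda>n. g $$ n / (complex_of_real (b n) - z))" for g
  have le: "cmod (g $$ n / (complex_of_real (b n) - z)) \<le> (1 / y) * cmod (g $$ n)" for g n
    using yb[of n] y nz[of n] by (simp add: norm_divide frac_le)
  have R: "R g $$ n = g $$ n / (complex_of_real (b n) - z)" for g n
    unfolding R_def by (rule coord_Abs, rule ell2_bound[OF coord_in_ell2 le])
  have R_norm: "norm (R g) \<le> (1 / y) * norm g" for g
    by (rule norm_l2_mono) (unfold R, rule le, use y in simp)
  have R_diff: "R (g - h) = R g - R h" for g h
    by (rule l2_eqI) (simp add: R diff_divide_distrib)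
  have bR: "complex_of_real (b n) * R g $$ n = g $$ n + z * R g $$ n" for g n
    using nz[of n] by (simp add: R divide_simps) (simp add: algebra_simps)
  have R_D: "R g \<in> D" if "g \<in> H" for g
  proof -
    have "(\<lambda>n. complex_of_real (b n) * R g $$ n) \<in> ell2 UNIV"
      unfolding bR by (intro ell2_add ell2_cmult coord_in_ell2)
    then show ?thesis using that by (simp add: l2_dom_def l2_on_def R)
  qed
  have "\<exists>g\<in>H. f - K (R g) = g"
  proof (rule fixpoint_in_H)
    show "0 \<le> 2 * M * (1 / y)" "2 * M * (1 / y) < 1" using y M_nonneg by auto
    show "f - K (R g) \<in> H" if "g \<in> H" for g using f K_in_H by (intro H_closed_add)
    fix g h
    have "norm ((f - K (R g)) - (f - K (R h))) = norm (K (R (h - g)))"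
      by (simp add: R_diff K_diff)
    also have "\<dots> \<le> 2 * M * norm (R (h - g))" by (rule norm_K)
    also have "\<dots> \<le> 2 * M * ((1 / y) * norm (h - g))"
      using M_nonneg by (intro mult_left_mono R_norm) auto
    finally show "norm ((f - K (R g)) - (f - K (R h))) \<le> 2 * M * (1 / y) * norm (g - h)"
      by (simp add: norm_minus_commute)
  qed
  then obtain g where g: "g \<in> H" "f - K (R g) = g" by blast
  have "J (R g) - cs z (R g) = f"
  proof (rule l2_eqI)
    fix n
    have "(J (R g) - cs z (R g)) $$ n = K (R g) $$ n + g $$ n"
      by (simp add: coord_J' R_D g(1) bR)
    also have "\<dots> = f $$ n" using arg_cong[OF g(2), of "\<lambda>w. w $$ n"] by (simp add: algebra_simps)
    finally show "(J (R g) - cs z (R g)) $$ n = f $$ n" .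
  qed
  then show "\<exists>u\<in>D. J u - cs z u = f" using R_D[OF g(1)] by blast
qed

lemma cs_diff_right: "cs z (u - v) = cs z u - cs z v"
  by (rule l2_eqI) (simp add: algebra_simps)

text \<open>The lower bound makes the inverse at \<open>z\<close> Lipschitz with constant 1/c;
  rewriting the equation at \<open>z'\<close> for the image under \<open>J - z\<close> gives a
  contraction with factor \<open>cmod (z' - z) / c\<close>.\<close>

lemma surjective_at_perturb:
  assumes s: "surjective_at z" and c: "0 < c" and low: "\<And>u. u \<in> D \<Longrightarrow> c * norm u \<le> norm (J u - cs z u)"
    and near: "cmod (z' - z) < c"
  shows "surjective_at z'"
  unfolding surjective_at_def
proof
  fix f assume f: "f \<in> H"
  obtain R where R: "\<And>g. g \<in> H \<Longrightarrow> R g \<in> D" "\<And>g. g \<in> H \<Longrightarrow> J (R g) - cs z (R g) = g"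
    using s unfolding surjective_at_def by metis
  have "\<exists>g\<in>H. f + cs (z' - z) (R g) = g"
  proof (rule fixpoint_in_H)
    show "0 \<le> cmod (z' - z) / c" "cmod (z' - z) / c < 1" using near c by auto
    show "f + cs (z' - z) (R g) \<in> H" if "g \<in> H" for g
      using f cs_l2_on[OF D_sub_H[OF R(1)[OF that]]] by (rule H_closed_add(1))
    fix g h assume gh: "g \<in> H" "h \<in> H"
    have "J (R g - R h) - cs z (R g - R h) = (J (R g) - cs z (R g)) - (J (R h) - cs z (R h))"
      using R(1) gh by (simp add: J_diff cs_diff_right)
    then have "c * norm (R g - R h) \<le> norm (g - h)"
      using low[of "R g - R h"] R gh by (simp add: D_closed_add)
    then have "norm (R g - R h) \<le> norm (g - h) / c" using c by (simp add: field_simps)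
    then have "cmod (z' - z) * norm (R g - R h) \<le> cmod (z' - z) * (norm (g - h) / c)"
      by (intro mult_left_mono) auto
    moreover have "(f + cs (z' - z) (R g)) - (f + cs (z' - z) (R h)) = cs (z' - z) (R g - R h)"
      by (simp add: cs_diff_right)
    ultimately show "norm ((f + cs (z' - z) (R g)) - (f + cs (z' - z) (R h))) \<le> cmod (z' - z) / c * norm (g - h)"
      by simp
  qed
  then obtain g where g: "g \<in> H" "f + cs (z' - z) (R g) = g" by blast
  have "J (R g) - cs z' (R g) = (J (R g) - cs z (R g)) - cs (z' - z) (R g)"
    by (rule l2_eqI) (simp add: algebra_simps)
  also have "\<dots> = f" using g R(2)[OF g(1)] by (metis add_diff_cancel_right')
  finally show "\<exists>u\<in>D. J u - cs z' u = f" using R(1)[OF g(1)] by blast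
qed

text \<open>Continuity method along a vertical ray, starting far from the real axis.\<close>

lemma surjective_at_ray:
  assumes e: "e = 1 \<or> e = (-1::real)" and c: "0 < c"
    and low: "\<And>u t. u \<in> D \<Longrightarrow> 0 \<le> t \<Longrightarrow> c * norm u \<le> norm (J u - cs (Complex x (y + e * t)) u)"
  shows "surjective_at (Complex x y)"
proof -
  \<comment> \<open>Induction on the number of steps of length c/2 that lead from
    \<open>y + e * t\<close> into the region of \<open>surjective_at_far\<close>; such a step is
    shorter than the admissible distance \<open>c\<close>.\<close>
  have *: "surjective_at (Complex x (y + e * t))" if "0 \<le> t" "2 * M + \<bar>y\<bar> < t + real k * (c / 2)" for t k
    using that
  proof (induction k arbitrary: t)
    case 0
    then have "2 * M < \<bar>y + e * t\<bar>" using e by auto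
    then show ?case by (intro surjective_at_far) simp
  next
    case (Suc k)
    have "surjective_at (Complex x (y + e * (t + c / 2)))"
      using Suc.prems c by (intro Suc.IH) (auto simp: algebra_simps add_divide_distrib)
    moreover have "cmod (Complex x (y + e * t) - Complex x (y + e * (t + c / 2))) = c / 2"
      using e c by (auto simp: cmod_def)
    moreover have "c * norm u \<le> norm (J u - cs (Complex x (y + e * (t + c / 2))) u)" if "u \<in> D" for u
      using low[OF that, of "t + c / 2"] c Suc.prems(1) by simp
    ultimately show ?case
      using surjective_at_perturb[OF _ c] c by simp
  qed
  obtain k where "(2 * M + \<bar>y\<bar>) / (c / 2) < real k" using reals_Archimedean2 by blast
  then have "2 * M + \<bar>y\<bar> < 0 + real k * (c / 2)" using c by (simp add: field_simps)
  from *[OF order_refl this] show ?thesis by simp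
qed

lemma low_nonreal:
  assumes "u \<in> D"
  shows "\<bar>Im z\<bar> * norm u \<le> norm (J u - cs z u)"
proof -
  have "(\<bar>Im z\<bar> * norm u)\<^sup>2 \<le> (norm (J u - cs z u))\<^sup>2"
    using norm_J_shifted_complex[OF assms, of "Re z" "Im z"] by (simp add: power_mult_distrib)
  then show ?thesis by (rule power2_le_imp_le) simp
qed

lemma surjective_at_nonreal:
  assumes "Im z \<noteq> 0"
  shows "surjective_at z"
proof -
  \<comment> \<open>The ray leads away from the real axis, so \<open>\<bar>Im z\<bar>\<close> stays
    a valid lower bound along it.\<close>
  define e where "e = sgn (Im z)"
  have e: "e = 1 \<or> e = -1" using assms by (auto simp: e_def sgn_if)
  have "surjective_at (Complex (Re z) (Im z))"
  proof (rule surjective_at_ray[OF e, of "\<bar>Im z\<bar>"])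
    fix u and t :: real assume u: "u \<in> D" "0 \<le> t"
    have "\<bar>Im z\<bar> \<le> \<bar>Im z + e * t\<bar>" using u by (auto simp: e_def sgn_if)
    then have "\<bar>Im z\<bar> * norm u \<le> \<bar>Im z + e * t\<bar> * norm u" by (intro mult_right_mono) auto
    also have "\<dots> \<le> norm (J u - cs (Complex (Re z) (Im z + e * t)) u)"
      using low_nonreal[OF u(1), of "Complex (Re z) (Im z + e * t)"] by simp
    finally show "\<bar>Im z\<bar> * norm u \<le> norm (J u - cs (Complex (Re z) (Im z + e * t)) u)" .
  qed (use assms in simp)
  then show ?thesis by simp
qed

text \<open>An imaginary shift only increases the residual of a real one, so the constant
  \<open>c\<close> persists along the whole ray above \<open>x\<close>. This provides the property
  \<open>surj\<close> of the locale \<open>selfadjoint\<close>.\<close>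

lemma surjective_at_real:
  assumes c: "0 < c" and low: "\<And>u. u \<in> D \<Longrightarrow> c * norm u \<le> norm (J u - x *\<^sub>R u)"
  shows "surjective_at (complex_of_real x)"
proof -
  have "surjective_at (Complex x 0)"
  proof (rule surjective_at_ray[of 1 c])
    fix u and t :: real assume u: "u \<in> D"
    have "(norm (J u - x *\<^sub>R u))\<^sup>2 \<le> (norm (J u - cs (Complex x (0 + 1 * t)) u))\<^sup>2"
      using norm_J_shifted_complex[OF u, of x t] by simp
    then have "norm (J u - x *\<^sub>R u) \<le> norm (J u - cs (Complex x (0 + 1 * t)) u)"
      by (rule power2_le_imp_le) simp
    then show "c * norm u \<le> norm (J u - cs (Complex x (0 + 1 * t)) u)"
      using low[OF u] by linarith
  qed (use c in auto)
  then show ?thesis by (simp add: complex_of_real_def)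
qed

sublocale selfadjoint H D J
proof
  show "closed H" "subspace H" "subspace D"
    by (fact closed_l2_on subspace_l2_on subspace_l2_dom)+
  show "D \<subseteq> H" using D_sub_H by blast
  show "J (c *\<^sub>R u) = c *\<^sub>R J u" if "u \<in> D" for c u
    using J_cs[OF that, of "of_real c"] by (simp add: cs_of_real)
  show "\<exists>u\<in>D. J u - \<mu> *\<^sub>R u = f"
    if "0 < c" "\<And>u. u \<in> D \<Longrightarrow> c * norm u \<le> norm (J u - \<mu> *\<^sub>R u)" "f \<in> H" for \<mu> c f
    using surjective_at_real[OF that(1,2)] that(3) by (auto simp: surjective_at_def cs_of_real)
qed (auto simp: J_H J_add J_sym)

section \<open>Resolvent set and spectrum of a Jacobi operator\<close>

lemma shifted_op_coord: "u \<in> D \<Longrightarrow> shifted_op (jacobi_op S a b) z (coord u) = coord (J u - cs z u)"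
  by (simp add: shifted_op_def coord_J fun_eq_iff)

text \<open>A lower bound alone decides: it gives injectivity, and surjectivity comes from the
  continuation argument, at real \<open>z\<close> by virtue of the bound and at nonreal
  \<open>z\<close> in any case.\<close>

lemma resolvent_set_iff:
  "z \<in> resolvent_set (ell2 S) (jacobi_domain S b) (jacobi_op S a b) \<longleftrightarrow>
    (\<exists>c>0. \<forall>u\<in>D. c * norm u \<le> norm (J u - cs z u))"
proof
  assume "z \<in> resolvent_set (ell2 S) (jacobi_domain S b) (jacobi_op S a b)"
  then obtain C where C: "\<And>v. v \<in> jacobi_domain S b \<Longrightarrow>
      ell2_norm v \<le> C * ell2_norm (shifted_op (jacobi_op S a b) z v)"
    by (auto simp: resolvent_set_def)
  \<comment> \<open>The constant \<open>C\<close> may be zero or negative;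
    \<open>\<bar>C\<bar> + 1\<close> is positive and above it.\<close>
  have "inverse (\<bar>C\<bar> + 1) * norm u \<le> norm (J u - cs z u)" if u: "u \<in> D" for u
  proof -
    have "norm u \<le> C * norm (J u - cs z u)"
      using C[of "coord u"] u by (simp add: coord_in_jacobi_domain shifted_op_coord norm_l2_eq)
    also have "\<dots> \<le> (\<bar>C\<bar> + 1) * norm (J u - cs z u)" by (intro mult_right_mono) auto
    finally have "inverse (\<bar>C\<bar> + 1) * norm u \<le> inverse (\<bar>C\<bar> + 1) * ((\<bar>C\<bar> + 1) * norm (J u - cs z u))"
      by (intro mult_left_mono) auto
    then show ?thesis by (simp add: mult.assoc[symmetric])
  qed
  then show "\<exists>c>0. \<forall>u\<in>D. c * norm u \<le> norm (J u - cs z u)"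
    by (intro exI[of _ "inverse (\<bar>C\<bar> + 1)"]) auto
next
  assume "\<exists>c>0. \<forall>u\<in>D. c * norm u \<le> norm (J u - cs z u)"
  then obtain c where c: "0 < c" "\<And>u. u \<in> D \<Longrightarrow> c * norm u \<le> norm (J u - cs z u)" by blast
  have surj: "surjective_at z"
  proof (cases "Im z = 0")
    case True
    then have z: "z = complex_of_real (Re z)" by (simp add: complex_eq_iff)
    have "surjective_at (complex_of_real (Re z))"
      using c(2) by (intro surjective_at_real[OF c(1)]) (metis cs_of_real z)
    then show ?thesis using z by simp
  qed (rule surjective_at_nonreal)
  have inj: "u = v" if "u \<in> D" "v \<in> D" "J u - cs z u = J v - cs z v" for u v
  proof -
    have "J (u - v) - cs z (u - v) = (J u - cs z u) - (J v - cs z v)"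
      using that(1,2) by (simp add: J_diff cs_diff_right)
    also have "\<dots> = 0" using that(3) by simp
    finally have "c * norm (u - v) \<le> 0" using c(2)[of "u - v"] that by (simp add: D_closed_add)
    then show ?thesis using c(1) by (simp add: mult_le_0_iff)
  qed
  have "bij_betw (shifted_op (jacobi_op S a b) z) (coord ` D) (coord ` H)"
    unfolding bij_betw_def
  proof
    show "inj_on (shifted_op (jacobi_op S a b) z) (coord ` D)"
    proof (rule inj_onI, elim imageE)
      fix v w u1 u2
      assume *: "shifted_op (jacobi_op S a b) z v = shifted_op (jacobi_op S a b) z w"
        "v = coord u1" "u1 \<in> D" "w = coord u2" "u2 \<in> D"
      then have "coord (J u1 - cs z u1) = coord (J u2 - cs z u2)" by (simp add: shifted_op_coord)
      then have "J u1 - cs z u1 = J u2 - cs z u2" by (intro l2_eqI) (rule fun_cong)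
      then show "v = w" using inj * by blast
    qed
    have "shifted_op (jacobi_op S a b) z ` coord ` D = coord ` (\<lambda>u. J u - cs z u) ` D"
      by (simp add: image_image shifted_op_coord cong: image_cong)
    also have "(\<lambda>u. J u - cs z u) ` D = H"
    proof
      show "(\<lambda>u. J u - cs z u) ` D \<subseteq> H"
        using J_H D_sub_H by (auto intro!: H_closed_add cs_l2_on)
      show "H \<subseteq> (\<lambda>u. J u - cs z u) ` D"
      proof
        fix f assume "f \<in> H"
        then obtain u where "u \<in> D" "J u - cs z u = f" using surj unfolding surjective_at_def by blast
        then show "f \<in> (\<lambda>u. J u - cs z u) ` D" by blast
      qed
    qed
    finally show "shifted_op (jacobi_op S a b) z ` coord ` D = coord ` H" .
  qed
  moreover have "ell2_norm v \<le> inverse c * ell2_norm (shifted_op (jacobi_op S a b) z v)"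
    if "v \<in> jacobi_domain S b" for v
  proof -
    obtain u where u: "u \<in> D" "v = coord u" using \<open>v \<in> jacobi_domain S b\<close> by (auto simp flip: coord_image_l2_dom)
    have "norm u \<le> inverse c * norm (J u - cs z u)" using c(1) c(2)[OF u(1)] by (simp add: field_simps)
    then show ?thesis using u by (simp add: shifted_op_coord norm_l2_eq)
  qed
  ultimately show "z \<in> resolvent_set (ell2 S) (jacobi_domain S b) (jacobi_op S a b)"
    by (auto simp: resolvent_set_def coord_image_l2_on coord_image_l2_dom)
qed

theorem spectrum_eq:
  "spectrum (ell2 S) (jacobi_domain S b) (jacobi_op S a b) = complex_of_real ` {\<mu>. approx_eigenvalue \<mu>}"
proof (intro set_eqI)
  fix z
  show "z \<in> spectrum (ell2 S) (jacobi_domain S b) (jacobi_op S a b) \<longleftrightarrow> z \<in> complex_of_real ` {\<mu>. approx_eigenvalue \<mu>}"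
  proof (cases "Im z = 0")
    case True
    then have z: "z = complex_of_real (Re z)" by (simp add: complex_eq_iff)
    have "z \<in> resolvent_set (ell2 S) (jacobi_domain S b) (jacobi_op S a b) \<longleftrightarrow> \<not> approx_eigenvalue (Re z)"
      unfolding resolvent_set_iff not_approx_eigenvalue using z cs_of_real by metis
    moreover have "z \<in> complex_of_real ` {\<mu>. approx_eigenvalue \<mu>} \<longleftrightarrow> approx_eigenvalue (Re z)"
      using z by (metis (mono_tags, lifting) Re_complex_of_real image_iff mem_Collect_eq)
    ultimately show ?thesis by (simp add: spectrum_def)
  next
    case False
    then have "z \<in> resolvent_set (ell2 S) (jacobi_domain S b) (jacobi_op S a b)"
      unfolding resolvent_set_iff using low_nonreal by (intro exI[of _ "\<bar>Im z\<bar>"]) auto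
    moreover have "z \<notin> complex_of_real ` {\<mu>. approx_eigenvalue \<mu>}" using False by auto
    ultimately show ?thesis by (simp add: spectrum_def)
  qed
qed

end

section \<open>Finitely supported vectors and windows\<close>

lemma finite_support_in_ell2:
  assumes "finite F" "\<And>n. n \<notin> F \<Longrightarrow> u n = 0"
  shows "u \<in> ell2 UNIV"
proof -
  have "(\<lambda>n. (cmod (u n))\<^sup>2) summable_on F" using assms(1) by simp
  also have "?this \<longleftrightarrow> (\<lambda>n. (cmod (u n))\<^sup>2) summable_on UNIV"
    by (rule summable_on_cong_neutral) (use assms(2) in auto)
  finally show ?thesis unfolding ell2_UNIV_iff .
qed

lemma norm_l2_sq_finite:
  assumes "finite F" "\<And>n. n \<notin> F \<Longrightarrow> u $$ n = 0"
  shows "(norm u)\<^sup>2 = (\<Sum>n\<in>F. (cmod (u $$ n))\<^sup>2)"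
proof -
  have "(norm u)\<^sup>2 = infsum (\<lambda>n. (cmod (u $$ n))\<^sup>2) F"
    unfolding norm_l2_sq by (rule infsum_cong_neutral) (use assms in auto)
  then show ?thesis using assms(1) by simp
qed

definition trunc :: "'i set \<Rightarrow> 'i l2 \<Rightarrow> 'i l2" where
  "trunc F u = Abs_l2 (\<lambda>n. if n \<in> F then u $$ n else 0)"

lemma coord_trunc [simp]: "trunc F u $$ n = (if n \<in> F then u $$ n else 0)"
  unfolding trunc_def
  by (rule coord_Abs, rule ell2_bound[OF coord_in_ell2[of u], of _ 1]) simp

text \<open>The truncation is orthogonal to the remainder, so the squared error is a tail of the
  convergent series for the squared norm.\<close>

lemma trunc_tendsto: "((\<lambda>F. trunc F u) \<longlongrightarrow> u) (finite_subsets_at_top UNIV)"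
proof -
  have orth: "(norm (u - trunc F u))\<^sup>2 = (norm u)\<^sup>2 - (norm (trunc F u))\<^sup>2" for F
  proof -
    have "inner (u - trunc F u) (trunc F u) = 0"
      unfolding inner_l2_def by (rule infsum_0) simp
    then have "inner u (trunc F u) = inner (trunc F u) (trunc F u)" by (simp add: inner_diff_left)
    then show ?thesis
      by (simp add: power2_norm_eq_inner inner_diff_left inner_diff_right inner_commute)
  qed
  have eq: "(norm (u - trunc F u))\<^sup>2 = (norm u)\<^sup>2 - (\<Sum>n\<in>F. (cmod (u $$ n))\<^sup>2)" if "finite F" for F
    unfolding orth using norm_l2_sq_finite[OF that, of "trunc F u"] by simp
  have "((\<lambda>F. (norm u)\<^sup>2 - (\<Sum>n\<in>F. (cmod (u $$ n))\<^sup>2)) \<longlongrightarrow> (norm u)\<^sup>2 - (norm u)\<^sup>2) (finite_subsets_at_top UNIV)"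
    unfolding norm_l2_sq by (intro tendsto_intros infsum_tendsto summable_coord_sq)
  then have "((\<lambda>F. (norm (u - trunc F u))\<^sup>2) \<longlongrightarrow> 0) (finite_subsets_at_top UNIV)"
    by (rule Lim_transform_eventually[THEN tendsto_eq_rhs])
      (auto intro!: eventually_finite_subsets_at_top_weakI simp: eq)
  then have "((\<lambda>F. sqrt ((norm (u - trunc F u))\<^sup>2)) \<longlongrightarrow> sqrt 0) (finite_subsets_at_top UNIV)"
    by (rule tendsto_real_sqrt)
  then have "((\<lambda>F. norm (trunc F u - u)) \<longlongrightarrow> 0) (finite_subsets_at_top UNIV)"
    by (simp add: norm_minus_commute)
  then show ?thesis by (rule LIM_zero_cancel[OF tendsto_norm_zero_cancel])
qed

definition supp :: "'i l2 \<Rightarrow> 'i set" where "supp u = {n. u $$ n \<noteq> 0}"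

context jacobi
begin

lemma finite_supp_in_D: "finite (supp u) \<Longrightarrow> supp u \<subseteq> S \<Longrightarrow> u \<in> D"
  unfolding l2_dom_def l2_on_def supp_def
  by (auto intro!: finite_support_in_ell2[where F = "{n. u $$ n \<noteq> 0}"])

lemma trunc_in_D: 
  assumes "u \<in> D"
  shows "trunc F u \<in> D"
proof -
  have "(\<lambda>n. complex_of_real (b n) * trunc F u $$ n) \<in> ell2 UNIV"
    by (rule ell2_bound[of "\<lambda>n. complex_of_real (b n) * u $$ n" _ 1])
      (use assms in \<open>auto simp: l2_dom_def\<close>)
  then show ?thesis using assms by (auto simp: l2_dom_def l2_on_def)
qed

text \<open>Finitely supported vectors form a core: the diagonal part commutes with truncation, and
  \<open>K\<close> is bounded.\<close>

lemma J_trunc_tendsto: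
  assumes u: "u \<in> D"
  shows "((\<lambda>F. J (trunc F u)) \<longlongrightarrow> J u) (finite_subsets_at_top UNIV)"
proof -
  define Bu where "Bu = J u - K u"
  have "J (trunc F u) = K (trunc F u) + trunc F Bu" for F
    by (rule l2_eqI) (simp add: coord_J' trunc_in_D u Bu_def)
  moreover have "((\<lambda>F. K (trunc F u)) \<longlongrightarrow> K u) (finite_subsets_at_top UNIV)"
  proof (rule Lim_null[THEN iffD2], rule Lim_null_comparison)
    show "\<forall>\<^sub>F F in finite_subsets_at_top UNIV. norm (K (trunc F u) - K u) \<le> 2 * M * norm (trunc F u - u)"
      using norm_K by (simp flip: K_diff)
    show "((\<lambda>F. 2 * M * norm (trunc F u - u)) \<longlongrightarrow> 0) (finite_subsets_at_top UNIV)"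
      using trunc_tendsto[of u] by (intro tendsto_mult_right_zero) (simp add: LIM_zero tendsto_norm_zero)
  qed
  ultimately have "((\<lambda>F. J (trunc F u)) \<longlongrightarrow> K u + Bu) (finite_subsets_at_top UNIV)"
    by (simp add: tendsto_add trunc_tendsto)
  then show ?thesis by (simp add: Bu_def)
qed

text \<open>A strict inequality between limits already holds for large truncations. The inclusion of
  supports preserves any set of sites that \<open>u\<close> avoids.\<close>

lemma finite_supp_approx:
  assumes u: "u \<in> D" and less: "norm (J u - \<mu> *\<^sub>R u) < \<epsilon> * norm u"
  obtains v where "finite (supp v)" "supp v \<subseteq> supp u" "v \<in> D" "norm (J v - \<mu> *\<^sub>R v) < \<epsilon> * norm v"
proof -
  have "((\<lambda>F. \<epsilon> * norm (trunc F u) - norm (J (trunc F u) - \<mu> *\<^sub>R trunc F u)) \<longlongrightarrow>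
      \<epsilon> * norm u - norm (J u - \<mu> *\<^sub>R u)) (finite_subsets_at_top UNIV)"
    by (intro tendsto_intros trunc_tendsto J_trunc_tendsto u)
  then have "\<forall>\<^sub>F F in finite_subsets_at_top UNIV. 0 < \<epsilon> * norm (trunc F u) - norm (J (trunc F u) - \<mu> *\<^sub>R trunc F u)"
    using less by (intro order_tendstoD) auto
  moreover have "\<forall>\<^sub>F F in finite_subsets_at_top UNIV. finite (F :: int set)"
    by (rule eventually_finite_subsets_at_top_weakI)
  ultimately have "\<forall>\<^sub>F F in finite_subsets_at_top UNIV. finite (F :: int set) \<and>
      norm (J (trunc F u) - \<mu> *\<^sub>R trunc F u) < \<epsilon> * norm (trunc F u)"
    by eventually_elim auto
  then obtain F where F: "finite F" "norm (J (trunc F u) - \<mu> *\<^sub>R trunc F u) < \<epsilon> * norm (trunc F u)"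
    by (metis (mono_tags, lifting) eventually_happens' finite_subsets_at_top_neq_bot)
  have "supp (trunc F u) \<subseteq> F \<inter> supp u" by (auto simp: supp_def split: if_splits)
  then show ?thesis using that[of "trunc F u"] F trunc_in_D[OF u] by (auto intro: finite_subset)
qed

section \<open>Comparison of the spectrum with the diagonal\<close>

lemma norm_diagonal_bound:
  assumes u: "u \<in> D" and b: "\<And>n. n \<in> supp u \<Longrightarrow> \<bar>b n - \<mu>\<bar> \<le> \<beta>" and \<beta>: "0 \<le> \<beta>"
  shows "norm (J u - \<mu> *\<^sub>R u) \<le> (2 * M + \<beta>) * norm u"
proof -
  have "norm (J u - \<mu> *\<^sub>R u - K u) \<le> \<beta> * norm u"
  proof (rule norm_l2_mono[OF _ \<beta>])
    fix n
    have "(J u - \<mu> *\<^sub>R u - K u) $$ n = complex_of_real (b n - \<mu>) * u $$ n"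
      by (simp add: coord_J' u algebra_simps)
    also have "cmod \<dots> \<le> \<beta> * cmod (u $$ n)"
      using b[of n] unfolding norm_mult norm_of_real by (cases "u $$ n = 0") (auto simp: supp_def intro!: mult_right_mono)
    finally show "cmod ((J u - \<mu> *\<^sub>R u - K u) $$ n) \<le> \<beta> * cmod (u $$ n)" .
  qed
  then show ?thesis
    using norm_K[of u] norm_triangle_ineq[of "J u - \<mu> *\<^sub>R u - K u" "K u"] by (simp add: algebra_simps)
qed

text \<open>The unit vector at \<open>n\<close> has residual at most 2M; the extra 1 makes the
  inequality strict. With the converse below, spectrum and diagonal are unbounded in the same
  directions.\<close>

lemma approx_eigenvalue_near_diagonal:
  assumes n: "n \<in> S"
  shows "\<exists>\<nu>. \<bar>\<nu> - b n\<bar> < 2 * M + 1 \<and> approx_eigenvalue \<nu>"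
proof -
  define e where "e = Abs_l2 (\<lambda>k. if k = n then 1 else 0)"
  have ce: "e $$ k = (if k = n then 1 else 0)" for k
    unfolding e_def by (rule coord_Abs, rule finite_support_in_ell2[of "{n}"]) auto
  have supp_e: "supp e = {n}" by (auto simp: supp_def ce)
  have e: "e \<in> D" using n by (intro finite_supp_in_D) (simp_all add: supp_e)
  have "(norm e)\<^sup>2 = 1" by (subst norm_l2_sq_finite[of "{n}"]) (auto simp: ce)
  then have "norm e = 1" by (simp add: power2_eq_1_iff) (metis norm_ge_zero not_one_le_zero neg_0_le_iff_le)
  moreover have "norm (J e - b n *\<^sub>R e) \<le> (2 * M + 0) * norm e"
    by (rule norm_diagonal_bound[OF e]) (auto simp: supp_e)
  ultimately show ?thesis
    using approx_eigenvalue_near[OF e, of "b n" "2 * M + 1"] by auto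
qed

text \<open>If every diagonal entry were farther away, the diagonal part would exceed the bound for
  \<open>K\<close> by at least \<open>norm u\<close>, more than the residual of an approximate
  eigenvector with relative error below 1.\<close>

lemma diagonal_near_approx_eigenvalue:
  assumes "approx_eigenvalue \<nu>"
  shows "\<exists>n\<in>S. \<bar>\<nu> - b n\<bar> \<le> 2 * M + 1"
proof (rule ccontr)
  assume "\<not> ?thesis"
  then have far: "\<And>n. n \<in> S \<Longrightarrow> 2 * M + 1 \<le> \<bar>b n - \<nu>\<bar>" by (force simp: abs_minus_commute)
  obtain u where u: "u \<in> D" "norm (J u - \<nu> *\<^sub>R u) < 1 * norm u"
    using assms unfolding approx_eigenvalue_def by (meson zero_less_one)
  have M1: "0 < 2 * M + 1" using M_nonneg by simp
  have "norm u \<le> (1 / (2 * M + 1)) * norm (J u - \<nu> *\<^sub>R u - K u)"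
  proof (rule norm_l2_mono)
    fix n
    have "(J u - \<nu> *\<^sub>R u - K u) $$ n = complex_of_real (b n - \<nu>) * u $$ n"
      by (simp add: coord_J' u algebra_simps)
    moreover have "(2 * M + 1) * cmod (u $$ n) \<le> \<bar>b n - \<nu>\<bar> * cmod (u $$ n)"
      using far[of n] D_sub_H[OF u(1)] by (cases "n \<in> S") (auto simp: l2_on_def intro!: mult_right_mono)
    ultimately have "(2 * M + 1) * cmod (u $$ n) \<le> cmod ((J u - \<nu> *\<^sub>R u - K u) $$ n)"
      by (simp only: norm_mult norm_of_real)
    then show "cmod (u $$ n) \<le> (1 / (2 * M + 1)) * cmod ((J u - \<nu> *\<^sub>R u - K u) $$ n)"
      using M1 by (simp add: pos_le_divide_eq mult.commute)
  qed (use M1 in simp)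
  then have "(2 * M + 1) * norm u \<le> norm (J u - \<nu> *\<^sub>R u - K u)"
    using M1 by (simp add: pos_le_divide_eq mult.commute)
  also have "\<dots> \<le> norm (J u - \<nu> *\<^sub>R u) + 2 * M * norm u"
    using norm_triangle_ineq4[of "J u - \<nu> *\<^sub>R u" "K u"] norm_K[of u] by linarith
  finally show False using u(2) by (simp add: algebra_simps)
qed

text \<open>
  Averaging the sharp cutoffs to all windows of length \<open>L\<close>: the cut vectors carry mass \<open>L \<parallel>u\<parallel>\<^sup>2\<close> in
  total, whereas each site is a boundary point of only two windows, so the cutting errors sum up to
  a multiple of \<open>\<parallel>u\<parallel>\<^sup>2\<close> that does not depend on \<open>L\<close>.
\<close>

lemma exists_good_window:
  fixes L :: nat
  assumes u: "u \<in> D" "finite (supp u)" "norm (J u - l *\<^sub>R u) < \<epsilon> / 2 * norm u"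
    and \<epsilon>: "0 < \<epsilon>" and L: "32 * M\<^sup>2 / \<epsilon>\<^sup>2 < real L"
  shows "\<exists>m. norm (J (trunc {m..<m + int L} u) - l *\<^sub>R trunc {m..<m + int L} u) < \<epsilon> * norm (trunc {m..<m + int L} u)"
proof (rule ccontr)
  define w where "w m = trunc {m..<m + int L} u" for m
  define f where "f = J u - l *\<^sub>R u"
  define g where "g m = J (w m) - l *\<^sub>R w m" for m
  assume "\<not> ?thesis"
  then have no: "\<epsilon> * norm (w m) \<le> norm (g m)" for m
    by (auto simp: w_def g_def not_less)
  define ch where "ch m n = (if n \<in> {m..<m + int L} then 1 else 0 :: real)" for m n :: int
  have w_D: "w m \<in> D" for m by (simp add: w_def trunc_in_D u)
  have w_coord: "w m $$ n = complex_of_real (ch m n) * u $$ n" for m n by (simp add: w_def ch_def)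
  obtain p q where pq: "supp u \<subseteq> {p..q}"
  proof -
    have "bdd_below (supp u)" "bdd_above (supp u)" using u(2) by auto
    then show ?thesis using that by (metis atLeastAtMost_iff bdd_above_def bdd_below_def subsetI)
  qed
  \<comment> \<open>\<open>I\<close> contains every position of a window that meets the support of
    \<open>u\<close>; \<open>E\<close> contains that support and its neighbours, where the residuals
    live.\<close>
  define I where "I = {p - int L..q + 1}"
  define E where "E = {p - 1..q + 1}"
  have u0: "u $$ n = 0" if "n \<notin> {p..q}" for n using pq that by (auto simp: supp_def)
  have norm_E: "(norm x)\<^sup>2 = (\<Sum>n\<in>E. (cmod (x $$ n))\<^sup>2)" if "\<And>n. n \<notin> E \<Longrightarrow> x $$ n = 0" for x :: "int l2"
    using that by (intro norm_l2_sq_finite) (auto simp: E_def)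
  have g0: "g m $$ n = 0" if "n \<notin> E" for m n
    using that by (auto simp: g_def coord_J' w_D coord_K w_coord E_def u0)
  have f0: "f $$ n = 0" if "n \<notin> E" for n
    using that by (auto simp: f_def coord_J' u coord_K E_def u0)
  \<comment> \<open>The jump of the cutoff between \<open>n - 1\<close> and \<open>n\<close>; it can
    be nonzero only for the two windows that start at \<open>n\<close> or end just before
    \<open>n\<close>.\<close>
  define \<kappa> where "\<kappa> m n = \<bar>ch m (n - 1) - ch m n\<bar>" for m n
  have ch01: "ch m n = 0 \<or> ch m n = 1" for m n by (simp add: ch_def)
  have \<kappa>_sq: "(\<kappa> m n)\<^sup>2 = \<kappa> m n" for m n
    using ch01[of m n] ch01[of m "n - 1"] by (auto simp: \<kappa>_def)
  have ch_sq: "(ch m n)\<^sup>2 = ch m n" for m n using ch01[of m n] by auto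
  \<comment> \<open>The residual of the cut vector is the cut residual plus the commutator of
    \<open>K\<close> with the cutoff, whose entries carry the jumps. The factors 2 and 4 come from
    applying \<open>sq2\<close> twice.\<close>
  have g_est: "(cmod (g m $$ n))\<^sup>2 \<le> 2 * ch m n * (cmod (f $$ n))\<^sup>2
      + 4 * M\<^sup>2 * (\<kappa> m n * (cmod (u $$ (n - 1)))\<^sup>2 + \<kappa> m (n + 1) * (cmod (u $$ (n + 1)))\<^sup>2)" for m n
  proof -
    define c1 where "c1 = (if n \<in> S then complex_of_real (a (n - 1) * (ch m (n - 1) - ch m n)) * u $$ (n - 1) else 0)"
    define c2 where "c2 = (if n \<in> S then complex_of_real (a n * (ch m (n + 1) - ch m n)) * u $$ (n + 1) else 0)"
    have sq2: "(x + y)\<^sup>2 \<le> 2 * x\<^sup>2 + 2 * y\<^sup>2" for x y :: real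
      using sum_squares_bound[of x y] by (simp add: power2_sum)
    have "g m $$ n = complex_of_real (ch m n) * f $$ n + (c1 + c2)"
      by (simp add: g_def f_def c1_def c2_def coord_J' w_D u coord_K w_coord algebra_simps)
    then have "cmod (g m $$ n) \<le> ch m n * cmod (f $$ n) + (cmod c1 + cmod c2)"
      using norm_triangle_ineq[of "complex_of_real (ch m n) * f $$ n" "c1 + c2"] norm_triangle_ineq[of c1 c2] ch01[of m n]
      by (auto simp: norm_mult)
    then have "(cmod (g m $$ n))\<^sup>2 \<le> (ch m n * cmod (f $$ n) + (cmod c1 + cmod c2))\<^sup>2"
      by (intro power_mono) auto
    also have "\<dots> \<le> 2 * (ch m n * cmod (f $$ n))\<^sup>2 + 2 * (cmod c1 + cmod c2)\<^sup>2" by (rule sq2)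
    also have "\<dots> \<le> 2 * (ch m n * cmod (f $$ n))\<^sup>2 + 2 * (2 * (cmod c1)\<^sup>2 + 2 * (cmod c2)\<^sup>2)"
      by (intro add_left_mono mult_left_mono sq2) auto
    finally have est: "(cmod (g m $$ n))\<^sup>2 \<le> 2 * ch m n * (cmod (f $$ n))\<^sup>2 + 4 * (cmod c1)\<^sup>2 + 4 * (cmod c2)\<^sup>2"
      by (simp add: power_mult_distrib ch_sq)
    have a2: "(a k)\<^sup>2 \<le> M\<^sup>2" for k using a_bound[of k] by (metis abs_ge_zero power2_abs power_mono)
    have "(cmod c1)\<^sup>2 \<le> (a (n - 1))\<^sup>2 * ((\<kappa> m n)\<^sup>2 * (cmod (u $$ (n - 1)))\<^sup>2)"
      by (simp add: c1_def \<kappa>_def norm_mult power_mult_distrib flip: of_real_diff)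
    also have "\<dots> \<le> M\<^sup>2 * ((\<kappa> m n)\<^sup>2 * (cmod (u $$ (n - 1)))\<^sup>2)" by (intro mult_right_mono a2) auto
    finally have e1: "(cmod c1)\<^sup>2 \<le> M\<^sup>2 * (\<kappa> m n * (cmod (u $$ (n - 1)))\<^sup>2)" by (simp add: \<kappa>_sq)
    have "(cmod c2)\<^sup>2 \<le> (a n)\<^sup>2 * ((\<kappa> m (n + 1))\<^sup>2 * (cmod (u $$ (n + 1)))\<^sup>2)"
      by (simp add: c2_def \<kappa>_def norm_mult power_mult_distrib power2_commute flip: of_real_diff)
    also have "\<dots> \<le> M\<^sup>2 * ((\<kappa> m (n + 1))\<^sup>2 * (cmod (u $$ (n + 1)))\<^sup>2)" by (intro mult_right_mono a2) auto
    finally have e2: "(cmod c2)\<^sup>2 \<le> M\<^sup>2 * (\<kappa> m (n + 1) * (cmod (u $$ (n + 1)))\<^sup>2)" by (simp add: \<kappa>_sq)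
    show ?thesis using est e1 e2 by (simp add: algebra_simps)
  qed
  have sum_ch: "(\<Sum>m\<in>I. ch m n) = real (card (I \<inter> {n - int L<..n}))" for n
  proof -
    have "(\<Sum>m\<in>I. ch m n) = (\<Sum>m\<in>I. if m \<in> {n - int L<..n} then 1 else 0)"
      by (intro sum.cong) (auto simp: ch_def)
    also have "\<dots> = (\<Sum>m\<in>I \<inter> {n - int L<..n}. 1)" by (rule sum.inter_restrict[symmetric]) (simp add: I_def)
    finally show ?thesis by simp
  qed
  have ch_le: "(\<Sum>m\<in>I. ch m n) \<le> real L" for n
    using card_mono[of "{n - int L<..n}" "I \<inter> {n - int L<..n}"] by (simp add: sum_ch)
  have ch_eq: "(\<Sum>m\<in>I. ch m n) = real L" if "n \<in> {p..q}" for n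
  proof -
    have "I \<inter> {n - int L<..n} = {n - int L<..n}" using that by (auto simp: I_def)
    then show ?thesis by (simp add: sum_ch)
  qed
  have \<kappa>_le: "(\<Sum>m\<in>I. \<kappa> m n) \<le> 2" for n
  proof -
    have "(\<Sum>m\<in>I. \<kappa> m n) \<le> (\<Sum>m\<in>I. if m \<in> {n, n - int L} then 1 else 0)"
      by (intro sum_mono) (auto simp: \<kappa>_def ch_def)
    also have "\<dots> = (\<Sum>m\<in>I \<inter> {n, n - int L}. 1)" by (rule sum.inter_restrict[symmetric]) (simp add: I_def)
    also have "\<dots> \<le> real (card {n, n - int L})" by (simp add: card_mono)
    also have "\<dots> \<le> 2" by (simp add: card_insert_if)
    finally show ?thesis .
  qed
  have mass: "(\<Sum>m\<in>I. (norm (w m))\<^sup>2) = real L * (norm u)\<^sup>2"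
  proof -
    have "(\<Sum>m\<in>I. (norm (w m))\<^sup>2) = (\<Sum>m\<in>I. \<Sum>n\<in>E. ch m n * (cmod (u $$ n))\<^sup>2)"
      by (intro sum.cong refl, subst norm_E)
        (auto simp: w_coord norm_mult power_mult_distrib ch_sq E_def u0)
    also have "\<dots> = (\<Sum>n\<in>E. (\<Sum>m\<in>I. ch m n) * (cmod (u $$ n))\<^sup>2)"
      by (subst sum.swap) (simp add: sum_distrib_right)
    also have "\<dots> = (\<Sum>n\<in>E. real L * (cmod (u $$ n))\<^sup>2)"
    proof (intro sum.cong refl)
      fix n show "(\<Sum>m\<in>I. ch m n) * (cmod (u $$ n))\<^sup>2 = real L * (cmod (u $$ n))\<^sup>2"
        using ch_eq[of n] u0[of n] by (cases "n \<in> {p..q}") auto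
    qed
    also have "\<dots> = real L * (norm u)\<^sup>2"
      by (subst norm_E) (auto simp: sum_distrib_left E_def u0)
    finally show ?thesis .
  qed
  have shifted_mass: "(\<Sum>n\<in>E. (cmod (u $$ (n + k)))\<^sup>2) \<le> (norm u)\<^sup>2" for k
    using sum_coord_le[of E "shift k u"] by (simp add: E_def)
  have "\<epsilon>\<^sup>2 * (real L * (norm u)\<^sup>2) = (\<Sum>m\<in>I. (\<epsilon> * norm (w m))\<^sup>2)"
    by (simp add: mass[symmetric] sum_distrib_left power_mult_distrib)
  also have "\<dots> \<le> (\<Sum>m\<in>I. (norm (g m))\<^sup>2)"
    using no \<epsilon> by (intro sum_mono power_mono) auto
  also have "\<dots> = (\<Sum>m\<in>I. \<Sum>n\<in>E. (cmod (g m $$ n))\<^sup>2)"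
    by (intro sum.cong refl norm_E g0)
  also have "\<dots> \<le> (\<Sum>m\<in>I. \<Sum>n\<in>E. 2 * ch m n * (cmod (f $$ n))\<^sup>2
      + 4 * M\<^sup>2 * (\<kappa> m n * (cmod (u $$ (n - 1)))\<^sup>2 + \<kappa> m (n + 1) * (cmod (u $$ (n + 1)))\<^sup>2))"
    by (intro sum_mono g_est)
  also have "\<dots> = (\<Sum>n\<in>E. 2 * ((\<Sum>m\<in>I. ch m n) * (cmod (f $$ n))\<^sup>2)
      + 4 * M\<^sup>2 * ((\<Sum>m\<in>I. \<kappa> m n) * (cmod (u $$ (n - 1)))\<^sup>2 + (\<Sum>m\<in>I. \<kappa> m (n + 1)) * (cmod (u $$ (n + 1)))\<^sup>2))"
    by (subst sum.swap) (simp add: sum.distrib sum_distrib_left sum_distrib_right algebra_simps)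
  also have "\<dots> \<le> (\<Sum>n\<in>E. 2 * (real L * (cmod (f $$ n))\<^sup>2)
      + 4 * M\<^sup>2 * (2 * (cmod (u $$ (n - 1)))\<^sup>2 + 2 * (cmod (u $$ (n + 1)))\<^sup>2))"
    by (intro sum_mono add_mono mult_left_mono mult_right_mono ch_le \<kappa>_le) auto
  also have "\<dots> = 2 * real L * (\<Sum>n\<in>E. (cmod (f $$ n))\<^sup>2)
      + 8 * M\<^sup>2 * ((\<Sum>n\<in>E. (cmod (u $$ (n + (-1))))\<^sup>2) + (\<Sum>n\<in>E. (cmod (u $$ (n + 1)))\<^sup>2))"
    by (simp add: sum.distrib sum_distrib_left algebra_simps)
  also have "\<dots> \<le> 2 * real L * (norm f)\<^sup>2 + 8 * M\<^sup>2 * ((norm u)\<^sup>2 + (norm u)\<^sup>2)"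
    using sum_coord_le[of E f] by (intro mult_left_mono add_mono shifted_mass) (auto simp: E_def)
  \<comment> \<open>As the residual of \<open>u\<close> is below \<epsilon>/2, the first term on the
    right is at most half of the left side; what remains bounds \<open>L\<close> by 32
    M^2/\<epsilon>^2, the threshold in the assumption.\<close>
  finally have main: "\<epsilon>\<^sup>2 * (real L * (norm u)\<^sup>2) \<le> 2 * real L * (norm f)\<^sup>2 + 16 * M\<^sup>2 * (norm u)\<^sup>2" by simp
  have nu: "0 < norm u" using u(3) \<epsilon> by (metis mult_zero_right norm_ge_zero not_less zero_less_norm_iff norm_zero)
  have "(norm f)\<^sup>2 \<le> (\<epsilon> / 2 * norm u)\<^sup>2"
    using u(3) unfolding f_def by (intro power_mono) auto
  then have "2 * real L * (norm f)\<^sup>2 \<le> 2 * real L * (\<epsilon> / 2 * norm u)\<^sup>2" by (intro mult_left_mono) auto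
  with main have "(\<epsilon>\<^sup>2 * real L / 2) * (norm u)\<^sup>2 \<le> (16 * M\<^sup>2) * (norm u)\<^sup>2"
    by (simp add: power_mult_distrib power_divide algebra_simps)
  then have "\<epsilon>\<^sup>2 * real L / 2 \<le> 16 * M\<^sup>2"
    using nu by (simp add: mult_le_cancel_right)
  then show False using L \<epsilon> by (simp add: field_simps)
qed

end

section \<open>Limit points of the spectrum\<close>

text \<open>Tychonoff's theorem; countability of the index type makes the function space first
  countable, so that compactness gives convergent subsequences.\<close>

lemma coordinatewise_convergent_subsequence:
  fixes X :: "nat \<Rightarrow> 'i::countable \<Rightarrow> 'b::first_countable_topology"
  assumes C: "\<And>n. compact (C n)" and X: "\<And>k n. X k n \<in> C n"
  obtains r x where "strict_mono r" "\<And>n. x n \<in> C n" "\<And>n. (\<lambda>k. X (r k) n) \<longlonglongrightarrow> x n"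
proof -
  have "compact (PiE UNIV C)"
    using compactin_PiE[of "\<lambda>i. euclidean :: 'b topology" UNIV C] C
    unfolding euclidean_product_topology by simp
  moreover have "\<forall>k. X k \<in> PiE UNIV C" using X by auto
  ultimately obtain x r where *: "x \<in> PiE UNIV C" "strict_mono r" "(X \<circ> r) \<longlonglongrightarrow> x"
    using seq_compactE[OF compact_imp_seq_compact] by metis
  have "(\<lambda>k. X (r k) n) \<longlonglongrightarrow> x n" for n
    using continuous_on_tendsto_compose[OF continuous_on_product_coordinates[of n] *(3)] by simp
  then show ?thesis using that[of r x] * by auto
qed

text \<open>Against a truncation of \<open>v\<close> only finitely many coordinates matter, and the
  error of truncating \<open>v\<close> is uniform because the norms are bounded.\<close>

lemma weak_convergence:
  fixes X :: "nat \<Rightarrow> 'i l2"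
  assumes conv: "\<And>n. (\<lambda>k. X k $$ n) \<longlonglongrightarrow> x $$ n" and bound: "\<And>k. norm (X k) \<le> 1"
  shows "(\<lambda>k. inner (X k) v) \<longlonglongrightarrow> inner x v"
proof (rule LIMSEQ_I)
  fix e :: real assume e: "0 < e"
  have "coord x \<in> ell2 UNIV" "norm (Abs_l2 (coord x)) \<le> 1"
    by (rule l2_Fatou[of X, OF conv bound])+
  moreover have "Abs_l2 (coord x) = x" by (rule l2_eqI) (rule coord_Abs[OF coord_in_ell2])
  ultimately have nx: "norm x \<le> 1" by simp
  have "\<forall>\<^sub>F F in finite_subsets_at_top UNIV. dist (trunc F v) v < e / 4"
    using tendstoD[OF trunc_tendsto[of v], of "e / 4"] e by simp
  moreover have "\<forall>\<^sub>F F in finite_subsets_at_top UNIV. finite (F :: 'i set)"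
    by (rule eventually_finite_subsets_at_top_weakI)
  ultimately have "\<forall>\<^sub>F F in finite_subsets_at_top UNIV. finite (F :: 'i set) \<and> dist (trunc F v) v < e / 4"
    by eventually_elim auto
  then obtain F where F: "finite F" "norm (v - trunc F v) < e / 4"
    by (metis (mono_tags, lifting) eventually_happens' finite_subsets_at_top_neq_bot dist_commute dist_norm)
  have fin: "inner y (trunc F v) = (\<Sum>n\<in>F. inner (y $$ n) (v $$ n))" for y
  proof -
    have "inner y (trunc F v) = infsum (\<lambda>n. inner (y $$ n) (v $$ n)) F"
      unfolding inner_l2_def by (rule infsum_cong_neutral) auto
    then show ?thesis using F(1) by simp
  qed
  have "(\<lambda>k. inner (X k) (trunc F v)) \<longlonglongrightarrow> inner x (trunc F v)"
    unfolding fin by (intro tendsto_intros conv)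
  then obtain no where no: "\<And>k. k \<ge> no \<Longrightarrow> norm (inner (X k) (trunc F v) - inner x (trunc F v)) < e / 2"
    using LIMSEQ_D[of _ _ "e / 2"] e by (metis half_gt_zero)
  have "norm (inner (X k) v - inner x v) < e" if "k \<ge> no" for k
  proof -
    have "inner (X k) v - inner x v
        = (inner (X k) (trunc F v) - inner x (trunc F v)) + inner (X k - x) (v - trunc F v)"
      by (simp add: inner_diff_left inner_diff_right)
    moreover have "\<bar>inner (X k - x) (v - trunc F v)\<bar> \<le> norm (X k - x) * norm (v - trunc F v)"
      by (rule Cauchy_Schwarz_ineq2)
    moreover have "norm (X k - x) * norm (v - trunc F v) \<le> 2 * (e / 4)"
      using norm_triangle_ineq4[of "X k" x] bound[of k] nx F by (intro mult_mono) auto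
    ultimately show ?thesis using no[OF that] unfolding real_norm_def by linarith
  qed
  then show "\<exists>no. \<forall>k\<ge>no. norm (inner (X k) v - inner x v) < e" by blast
qed

context jacobi
begin

lemma normalize:
  assumes u: "u \<in> D" and less: "norm (J u - \<mu> *\<^sub>R u) < d * norm u"
  obtains v where "v \<in> D" "norm v = 1" "supp v \<subseteq> supp u" "norm (J v - \<mu> *\<^sub>R v) < d"
proof -
  have nz: "u \<noteq> 0" using less by (auto simp: T_zero)
  define v where "v = (1 / norm u) *\<^sub>R u"
  have v: "v \<in> D" "norm v = 1" "supp v \<subseteq> supp u" using u nz by (auto simp: v_def D_closed_add supp_def)
  have "J v - \<mu> *\<^sub>R v = (1 / norm u) *\<^sub>R (J u - \<mu> *\<^sub>R u)"
    using u by (simp add: v_def T_scale algebra_simps)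
  then have "norm (J v - \<mu> *\<^sub>R v) = norm (J u - \<mu> *\<^sub>R u) / norm u" by simp
  also have "\<dots> < d" using less nz by (subst pos_divide_less_eq) auto
  finally show ?thesis using v that by blast
qed

definition spectral_limit_point :: "real \<Rightarrow> bool" where
  "spectral_limit_point l \<longleftrightarrow> (\<forall>e>0. \<exists>\<nu>. \<nu> \<noteq> l \<and> \<bar>\<nu> - l\<bar> < e \<and> approx_eigenvalue \<nu>)"

text \<open>
  Approximate eigenvectors \<open>u\<^sub>k\<close> for \<open>\<nu>\<^sub>k \<rightarrow> l\<close>, \<open>\<nu>\<^sub>k \<noteq> l\<close>, whose errors are small compared with
  \<open>\<bar>\<nu>\<^sub>k - l\<bar>\<close>, become orthogonal to every eigenvector for \<open>l\<close>, in particular to their own weak limit,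
  which is therefore \<open>0\<close>.
\<close>

lemma weakly_null_approx_eigenvectors:
  assumes l: "spectral_limit_point l"
  obtains u where "\<And>k::nat. u k \<in> D" "\<And>k. norm (u k) = 1" "\<And>n. (\<lambda>k. u k $$ n) \<longlonglongrightarrow> 0"
    "(\<lambda>k. J (u k) - l *\<^sub>R u k) \<longlonglongrightarrow> 0"
proof -
  have "\<exists>\<nu> u. \<nu> \<noteq> l \<and> \<bar>\<nu> - l\<bar> < 1 / real (Suc k) \<and> u \<in> D \<and> norm u = 1 \<and>
      norm (J u - \<nu> *\<^sub>R u) < \<bar>\<nu> - l\<bar> / real (Suc k)" for k
  proof -
    obtain \<nu> where \<nu>: "\<nu> \<noteq> l" "\<bar>\<nu> - l\<bar> < 1 / real (Suc k)" "approx_eigenvalue \<nu>"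
      using l unfolding spectral_limit_point_def by (metis of_nat_0_less_iff zero_less_Suc zero_less_divide_1_iff)
    define d where "d = \<bar>\<nu> - l\<bar> / real (Suc k)"
    have "0 < d" using \<nu>(1) by (simp add: d_def)
    then obtain u where u: "u \<in> D" "norm (J u - \<nu> *\<^sub>R u) < d * norm u"
      using \<nu>(3) unfolding approx_eigenvalue_def by blast
    from normalize[OF this] obtain v where v: "v \<in> D" "norm v = 1" "norm (J v - \<nu> *\<^sub>R v) < d" by blast
    then show ?thesis using \<nu> v by (auto simp: d_def)
  qed
  then obtain \<nu> u where \<nu>: "\<And>k. \<nu> k \<noteq> l" "\<And>k. \<bar>\<nu> k - l\<bar> < 1 / real (Suc k)"
    and u: "\<And>k. u k \<in> D" "\<And>k. norm (u k) = 1"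
    and err: "\<And>k. norm (J (u k) - \<nu> k *\<^sub>R u k) < \<bar>\<nu> k - l\<bar> / real (Suc k)"
    by metis
  have null: "(\<lambda>k. 2 * (1 / real (Suc k))) \<longlonglongrightarrow> 0"
    using LIMSEQ_inverse_real_of_nat by (intro tendsto_mult_right_zero) (simp add: inverse_eq_divide)
  have res: "(\<lambda>k. J (u k) - l *\<^sub>R u k) \<longlonglongrightarrow> 0"
  proof (rule Lim_null_comparison[OF _ null], intro always_eventually allI)
    fix k
    have eq: "J (u k) - l *\<^sub>R u k = (J (u k) - \<nu> k *\<^sub>R u k) + (\<nu> k - l) *\<^sub>R u k" by (simp add: algebra_simps)
    have "norm (J (u k) - l *\<^sub>R u k) \<le> norm (J (u k) - \<nu> k *\<^sub>R u k) + \<bar>\<nu> k - l\<bar>"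
      unfolding eq by (rule order_trans[OF norm_triangle_ineq]) (simp add: u)
    also have "\<bar>\<nu> k - l\<bar> / real (Suc k) \<le> \<bar>\<nu> k - l\<bar>" by (simp add: divide_le_eq mult_le_cancel_left1)
    then have "norm (J (u k) - \<nu> k *\<^sub>R u k) + \<bar>\<nu> k - l\<bar> \<le> 2 * (1 / real (Suc k))"
      using err[of k] \<nu>(2)[of k] by linarith
    finally show "norm (J (u k) - l *\<^sub>R u k) \<le> 2 * (1 / real (Suc k))" .
  qed
  have "u k $$ n \<in> cball 0 1" for k n using coord_le[of "u k" n] u(2) by simp
  then obtain r x where r: "strict_mono r" and x: "\<And>n. (\<lambda>k. u (r k) $$ n) \<longlonglongrightarrow> x n"
    using coordinatewise_convergent_subsequence[of "\<lambda>_. cball 0 1" "\<lambda>k n. u k $$ n"] compact_cball by metis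
  define X where "X = Abs_l2 x"
  have "x \<in> ell2 UNIV" using u(2) by (intro l2_Fatou(1)[of "\<lambda>k. u (r k)", OF x, of 1]) simp
  then have X: "X $$ n = x n" for n unfolding X_def by (rule coord_Abs)
  have conv: "(\<lambda>k. u (r k) $$ n) \<longlonglongrightarrow> X $$ n" for n unfolding X by (rule x)
  have res_r: "(\<lambda>k. J (u (r k)) - l *\<^sub>R u (r k)) \<longlonglongrightarrow> 0"
    using LIMSEQ_subseq_LIMSEQ[OF res r] by (simp add: o_def)
  have off: "X $$ n = 0" if "n \<notin> S" for n
  proof -
    have "u (r k) $$ n = 0" for k using D_sub_H[OF u(1)] that by (auto simp: l2_on_def)
    then show ?thesis using conv[of n] by (simp add: LIMSEQ_const_iff)
  qed
  \<comment> \<open>Each row of the eigenvalue equation involves three coordinates, so it passes to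
    the limit. Solved for the diagonal term, it also shows that \<open>X\<close> lies in the
    domain.\<close>
  have eq: "complex_of_real (b n) * X $$ n = complex_of_real l * X $$ n - K X $$ n" for n
  proof (cases "n \<in> S")
    case True
    have "(\<lambda>k. (J (u (r k)) - l *\<^sub>R u (r k)) $$ n) \<longlonglongrightarrow> K X $$ n + complex_of_real (b n) * X $$ n - complex_of_real l * X $$ n"
      using True unfolding coord_diff coord_J'[OF u(1)] coord_scaleR coord_K
      by (simp only: if_True) (intro tendsto_intros conv)
    moreover have "(\<lambda>k. (J (u (r k)) - l *\<^sub>R u (r k)) $$ n) \<longlonglongrightarrow> 0"
      using tendsto_coord[OF res_r, of n] by simp
    ultimately have "K X $$ n + complex_of_real (b n) * X $$ n - complex_of_real l * X $$ n = 0"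
      by (rule LIMSEQ_unique)
    then show ?thesis by (simp add: algebra_simps)
  qed (simp add: off coord_K)
  have "(\<lambda>n. complex_of_real (b n) * X $$ n) = coord (l *\<^sub>R X - K X)"
    using eq by (simp add: fun_eq_iff)
  then have XD: "X \<in> D" using off coord_in_ell2 by (auto simp: l2_dom_def l2_on_def)
  have JX: "J X = l *\<^sub>R X" by (rule l2_eqI) (simp add: coord_J' XD eq)
  \<comment> \<open>By symmetry the inner product acquires the factor \<open>l - \<nu> k\<close>,
    while the residual is smaller than its modulus by the factor 1/(k+1); dividing leaves a null
    sequence.\<close>
  have orth: "\<bar>inner (u k) X\<bar> \<le> norm X * (1 / real (Suc k))" for k
  proof -
    have "inner (J (u k) - \<nu> k *\<^sub>R u k) X = (l - \<nu> k) * inner (u k) X"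
      using J_sym[OF u(1) XD] by (simp add: JX inner_diff_left algebra_simps)
    then have "\<bar>l - \<nu> k\<bar> * \<bar>inner (u k) X\<bar> \<le> norm (J (u k) - \<nu> k *\<^sub>R u k) * norm X"
      by (metis Cauchy_Schwarz_ineq2 abs_mult)
    also have "\<dots> \<le> \<bar>\<nu> k - l\<bar> / real (Suc k) * norm X"
      using err[of k] by (intro mult_right_mono) auto
    finally have "\<bar>\<nu> k - l\<bar> * \<bar>inner (u k) X\<bar> \<le> \<bar>\<nu> k - l\<bar> * (norm X * (1 / real (Suc k)))"
      by (simp add: abs_minus_commute mult.commute)
    then show ?thesis by (rule mult_left_le_imp_le) (use \<nu>(1)[of k] in simp)
  qed
  have "(\<lambda>k. inner (u (r k)) X) \<longlonglongrightarrow> 0"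
  proof -
    have "(\<lambda>k. norm X * (1 / real (Suc k))) \<longlonglongrightarrow> 0"
      using LIMSEQ_inverse_real_of_nat by (intro tendsto_mult_right_zero) (simp add: inverse_eq_divide)
    then have "(\<lambda>k. inner (u k) X) \<longlonglongrightarrow> 0"
      by (rule Lim_null_comparison[rotated]) (use orth in simp)
    then show ?thesis using LIMSEQ_subseq_LIMSEQ[OF _ r] by (auto simp: o_def)
  qed
  moreover have "(\<lambda>k. inner (u (r k)) X) \<longlonglongrightarrow> inner X X"
    using u(2) by (intro weak_convergence conv) simp
  ultimately have "inner X X = 0" by (rule LIMSEQ_unique[symmetric])
  then have "X = 0" by simp
  with conv have "(\<lambda>k. u (r k) $$ n) \<longlonglongrightarrow> 0" for n by simp
  then show ?thesis using that[of "\<lambda>k. u (r k)"] u res_r by simp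
qed

text \<open>Weak convergence to zero is norm convergence on the finite set \<open>F\<close>, and
  \<open>J - l\<close> is bounded on vectors supported there; so cutting out \<open>F\<close>
  changes the vector and its residual by null sequences.\<close>

lemma approx_eigenvector_off_finite_set:
  assumes l: "spectral_limit_point l" and F: "finite F" and \<eta>: "0 < \<eta>"
  obtains u where "u \<in> D" "finite (supp u)" "supp u \<inter> F = {}" "norm (J u - l *\<^sub>R u) < \<eta> * norm u"
proof -
  obtain u where u: "\<And>k::nat. u k \<in> D" "\<And>k. norm (u k) = 1" "\<And>n. (\<lambda>k. u k $$ n) \<longlonglongrightarrow> 0"
    and res: "(\<lambda>k. J (u k) - l *\<^sub>R u k) \<longlonglongrightarrow> 0"
    using weakly_null_approx_eigenvectors[OF l] by blast
  define t where "t k = trunc F (u k)" for k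
  have tD: "t k \<in> D" for k by (simp add: t_def trunc_in_D u)
  have "(\<lambda>k. (norm (t k))\<^sup>2) = (\<lambda>k. \<Sum>n\<in>F. (cmod (u k $$ n))\<^sup>2)"
    by (subst norm_l2_sq_finite[OF F]) (auto simp: t_def)
  moreover have "(\<lambda>k. \<Sum>n\<in>F. (cmod (u k $$ n))\<^sup>2) \<longlonglongrightarrow> (\<Sum>n\<in>F. (cmod 0)\<^sup>2)"
    by (intro tendsto_intros u(3))
  ultimately have "(\<lambda>k. sqrt ((norm (t k))\<^sup>2)) \<longlonglongrightarrow> sqrt 0" by (intro tendsto_real_sqrt) simp
  then have nt: "(\<lambda>k. norm (t k)) \<longlonglongrightarrow> 0" by simp
  define \<beta> where "\<beta> = (\<Sum>n\<in>F. \<bar>b n - l\<bar>)"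
  have \<beta>: "0 \<le> \<beta>" "\<And>n. n \<in> F \<Longrightarrow> \<bar>b n - l\<bar> \<le> \<beta>"
    unfolding \<beta>_def using F by (auto intro!: sum_nonneg member_le_sum)
  have Jt: "norm (J (t k) - l *\<^sub>R t k) \<le> (2 * M + \<beta>) * norm (t k)" for k
    using \<beta> by (intro norm_diagonal_bound tD) (auto simp: t_def supp_def split: if_splits)
  \<comment> \<open>The last summand pays for the loss of norm: the vector that remains after the
    cut has norm at least \<open>1 - norm (t k)\<close>.\<close>
  have "(\<lambda>k. norm (J (u k) - l *\<^sub>R u k) + (2 * M + \<beta>) * norm (t k) + \<eta> * norm (t k)) \<longlonglongrightarrow> 0 + (2 * M + \<beta>) * 0 + \<eta> * 0"
    by (intro tendsto_intros nt tendsto_norm_zero[OF res])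
  then have "\<forall>\<^sub>F k in sequentially. norm (J (u k) - l *\<^sub>R u k) + (2 * M + \<beta>) * norm (t k) + \<eta> * norm (t k) < \<eta>"
    using \<eta> by (intro order_tendstoD) auto
  then obtain k where k: "norm (J (u k) - l *\<^sub>R u k) + (2 * M + \<beta>) * norm (t k) + \<eta> * norm (t k) < \<eta>"
    by (meson eventually_happens' sequentially_bot)
  define w where "w = u k - t k"
  have wD: "w \<in> D" by (simp add: w_def D_closed_add u tD)
  have "J w - l *\<^sub>R w = (J (u k) - l *\<^sub>R u k) - (J (t k) - l *\<^sub>R t k)"
    by (simp add: w_def J_diff u tD algebra_simps)
  then have "norm (J w - l *\<^sub>R w) \<le> norm (J (u k) - l *\<^sub>R u k) + (2 * M + \<beta>) * norm (t k)"
    using norm_triangle_ineq4[of "J (u k) - l *\<^sub>R u k" "J (t k) - l *\<^sub>R t k"] Jt[of k] by simp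
  also have "\<dots> < \<eta> * (1 - norm (t k))" using k by (simp add: algebra_simps)
  also have "\<dots> \<le> \<eta> * norm w"
    using norm_triangle_ineq2[of "u k" "t k"] u(2)[of k] \<eta> by (intro mult_left_mono) (auto simp: w_def)
  finally have "norm (J w - l *\<^sub>R w) < \<eta> * norm w" .
  from finite_supp_approx[OF wD this] obtain v where v: "finite (supp v)" "supp v \<subseteq> supp w" "v \<in> D"
    "norm (J v - l *\<^sub>R v) < \<eta> * norm v" by blast
  have "supp w \<inter> F = {}" by (auto simp: supp_def w_def t_def)
  then show ?thesis using v that[of v] by blast
qed

end

section \<open>Eigenvectors and isolated spectral points on the half line\<close>

locale one_sided_jacobi = jacobi "{1..}" a b M for a b M +
  assumes a_pos: "\<And>n. 1 \<le> n \<Longrightarrow> 0 < a n"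
begin

text \<open>The three-term recursion: row \<open>n\<close> determines the coordinate at
  \<open>n + 1\<close> from the two before it, since \<open>a n\<close> is nonzero. It starts from
  the coordinates at 0, which is off the half line, and at 1.\<close>

lemma eigenvector_zero:
  assumes u: "u \<in> D" and eig: "J u = cs z u" and u1: "u $$ 1 = 0"
  shows "u = 0"
proof -
  have neg: "u $$ n = 0" if "n < 1" for n using D_sub_H[OF u] that by (auto simp: l2_on_def)
  have "u $$ int k = 0 \<and> u $$ (int k + 1) = 0" for k
  proof (induction k)
    case (Suc k)
    define n where "n = int k + 1"
    have "J u $$ n = z * u $$ n" by (simp add: eig)
    moreover have "u $$ n = 0" "u $$ (n - 1) = 0" using Suc by (simp_all add: n_def)
    ultimately have "complex_of_real (a n) * u $$ (n + 1) = 0"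
      by (simp add: coord_J' u coord_K n_def)
    then have "u $$ (n + 1) = 0" using a_pos[of n] by (simp add: n_def)
    then show ?case using Suc by (simp add: n_def algebra_simps)
  qed (simp add: neg u1)
  then have "\<forall>k. u $$ int k = 0" by blast
  then have "u $$ n = 0" for n
    using neg[of n] spec[of "\<lambda>k. u $$ int k = 0" "nat n"] by (cases "n < 1") auto
  then show ?thesis by (intro l2_eqI) simp
qed

lemma eigenvectors_proportional:
  assumes "u \<in> D" "J u = cs z u" "w \<in> D" "J w = cs z w" "w $$ 1 \<noteq> 0"
  shows "u = cs (u $$ 1 / w $$ 1) w"
proof -
  have "u - cs (u $$ 1 / w $$ 1) w = 0"
  proof (rule eigenvector_zero)
    show "u - cs (u $$ 1 / w $$ 1) w \<in> D" using assms by (simp add: D_closed_add cs_l2_dom)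
    show "J (u - cs (u $$ 1 / w $$ 1) w) = cs z (u - cs (u $$ 1 / w $$ 1) w)"
      by (rule l2_eqI) (simp add: J_diff J_cs assms cs_l2_dom algebra_simps)
  qed (use assms(5) in simp)
  then show ?thesis by simp
qed

lemma finite_multiplicity_jacobi:
  "finite_multiplicity (jacobi_domain {1..} b) (jacobi_op {1..} a b) z"
proof -
  have ker: "\<exists>u\<in>D. v = coord u \<and> J u = cs z u"
    if v: "v \<in> jacobi_domain {1..} b" "shifted_op (jacobi_op {1..} a b) z v = (\<lambda>n. 0)" for v
  proof -
    obtain u where u: "u \<in> D" "v = coord u" using v(1) by (auto simp flip: coord_image_l2_dom)
    have "J u - cs z u = 0"
      by (rule l2_eqI) (use v(2) u in \<open>simp add: shifted_op_coord fun_eq_iff\<close>)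
    then show ?thesis using u by auto
  qed
  show ?thesis
  proof (cases "\<exists>w\<in>D. J w = cs z w \<and> w \<noteq> 0")
    case True
    then obtain w where w: "w \<in> D" "J w = cs z w" "w \<noteq> 0" by blast
    then have w1: "w $$ 1 \<noteq> 0" using eigenvector_zero by blast
    have "\<exists>c. v = (\<lambda>n. \<Sum>v\<in>{coord w}. c v * v n)"
      if v: "v \<in> jacobi_domain {1..} b" "shifted_op (jacobi_op {1..} a b) z v = (\<lambda>n. 0)" for v
    proof -
      obtain u where u: "u \<in> D" "v = coord u" "J u = cs z u" using ker[OF v] by blast
      define c where "c = u $$ 1 / w $$ 1"
      have "u = cs c w" unfolding c_def by (rule eigenvectors_proportional) (use u w w1 in auto)
      then have "v = (\<lambda>n. c * w $$ n)" using u(2) by (simp add: fun_eq_iff)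
      then show ?thesis by (intro exI[of _ "\<lambda>_. c"]) simp
    qed
    then show ?thesis unfolding finite_multiplicity_def by blast
  next
    case False
    then have "v = (\<lambda>n. \<Sum>v\<in>{}. c v * v n)"
      if "v \<in> jacobi_domain {1..} b" "shifted_op (jacobi_op {1..} a b) z v = (\<lambda>n. 0)" for v and c :: "(int \<Rightarrow> complex) \<Rightarrow> complex"
      using ker[OF that] by (auto simp: fun_eq_iff)
    then show ?thesis unfolding finite_multiplicity_def by blast
  qed
qed

text \<open>A kernel element \<open>w\<close> close to \<open>v\<close> satisfies
  \<open>cmod (w $$ 1) \<le> norm (v - w)\<close>, so its norm, and with it that of
  \<open>v\<close>, is at most a multiple of the residual. A point outside the spectrum is covered
  as well, with trivial kernel.\<close>

lemma bounded_below_away_from_boundary: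
  assumes "\<not> spectral_limit_point l"
  obtains c where "0 < c" "\<And>v. v \<in> D \<Longrightarrow> v $$ 1 = 0 \<Longrightarrow> c * norm v \<le> norm (J v - l *\<^sub>R v)"
proof -
  obtain \<delta> where "0 < \<delta>" "\<And>\<nu>. \<nu> \<noteq> l \<Longrightarrow> \<bar>\<nu> - l\<bar> < \<delta> \<Longrightarrow> \<not> approx_eigenvalue \<nu>"
    using assms unfolding spectral_limit_point_def by blast
  then obtain C where C: "0 < C" "\<And>u. u \<in> D \<Longrightarrow> \<exists>w\<in>D. J w = l *\<^sub>R w \<and> norm (u - w) \<le> C * norm (J u - l *\<^sub>R u)"
    using distance_to_kernel[of \<delta> l] by blast
  \<comment> \<open>The kernel is at most one-dimensional, so one ratio serves all its elements;
    \<open>W = 0\<close> works if it is trivial.\<close>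
  have "\<exists>W\<ge>0. \<forall>x\<in>D. J x = l *\<^sub>R x \<longrightarrow> norm x \<le> W * cmod (x $$ 1)"
  proof (cases "\<exists>w\<in>D. J w = l *\<^sub>R w \<and> w \<noteq> 0")
    case True
    then obtain w where w: "w \<in> D" "J w = cs (of_real l) w" "w \<noteq> 0" by (auto simp: cs_of_real)
    then have w1: "w $$ 1 \<noteq> 0" using eigenvector_zero by blast
    have "norm x \<le> (norm w / cmod (w $$ 1)) * cmod (x $$ 1)" if "x \<in> D" "J x = l *\<^sub>R x" for x
    proof -
      have "x = cs (x $$ 1 / w $$ 1) w"
        by (rule eigenvectors_proportional[of x "of_real l" w]) (use that w w1 in \<open>auto simp: cs_of_real\<close>)
      then have "norm x = cmod (x $$ 1 / w $$ 1) * norm w" by (metis norm_cs)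
      then show ?thesis by (simp add: norm_divide mult.commute)
    qed
    then show ?thesis by (intro exI[of _ "norm w / cmod (w $$ 1)"]) auto
  next
    case False
    then show ?thesis by (intro exI[of _ 0]) auto
  qed
  then obtain W where W: "0 \<le> W" "\<And>x. x \<in> D \<Longrightarrow> J x = l *\<^sub>R x \<Longrightarrow> norm x \<le> W * cmod (x $$ 1)" by blast
  define c where "c = 1 / ((W + 1) * C)"
  have "c * norm v \<le> norm (J v - l *\<^sub>R v)" if v: "v \<in> D" "v $$ 1 = 0" for v
  proof -
    obtain w where w: "w \<in> D" "J w = l *\<^sub>R w" "norm (v - w) \<le> C * norm (J v - l *\<^sub>R v)"
      using C(2)[OF v(1)] by blast
    have "cmod (w $$ 1) \<le> norm (v - w)" using coord_le[of "v - w" 1] v(2) by simp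
    then have "norm w \<le> W * norm (v - w)"
      using W(2)[OF w(1,2)] W(1) by (meson mult_left_mono order_trans)
    then have "norm v \<le> (W + 1) * norm (v - w)"
      using norm_triangle_ineq[of "v - w" w] by (simp add: algebra_simps)
    also have "\<dots> \<le> (W + 1) * (C * norm (J v - l *\<^sub>R v))" using w(3) W(1) by (intro mult_left_mono) auto
    finally have "norm v \<le> norm (J v - l *\<^sub>R v) * ((W + 1) * C)" by (simp only: mult_ac)
    then have "norm v / ((W + 1) * C) \<le> norm (J v - l *\<^sub>R v)"
      using W(1) C(1) by (subst pos_divide_le_eq) auto
    then show ?thesis by (simp add: c_def)
  qed
  moreover have "0 < c" using W(1) C(1) by (simp add: c_def)
  ultimately show ?thesis using that by blast
qed

text \<open>The length \<open>L\<close> is chosen before \<open>N\<close>: the windows moving out to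
  infinity must share it.\<close>

lemma good_windows:
  assumes l: "spectral_limit_point l" and \<epsilon>: "0 < \<epsilon>"
  obtains L :: nat where
    "\<And>N::nat. \<exists>m>N. \<exists>w\<in>D. supp w \<subseteq> {int m..<int m + int L} \<and> norm w = 1 \<and> norm (J w - l *\<^sub>R w) < \<epsilon>"
proof -
  obtain L :: nat where L: "32 * M\<^sup>2 / \<epsilon>\<^sup>2 < real L" using reals_Archimedean2 by blast
  have "\<exists>m>N. \<exists>w\<in>D. supp w \<subseteq> {int m..<int m + int L} \<and> norm w = 1 \<and> norm (J w - l *\<^sub>R w) < \<epsilon>" for N :: nat
  proof -
    \<comment> \<open>A window of length \<open>L\<close> that meets the support of
      \<open>u\<close>, which lies beyond \<open>N + L\<close>, starts beyond
      \<open>N\<close>.\<close>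
    obtain u where u: "u \<in> D" "finite (supp u)" "supp u \<inter> {1..int N + int L} = {}"
      "norm (J u - l *\<^sub>R u) < \<epsilon> / 2 * norm u"
      using approx_eigenvector_off_finite_set[OF l, of "{1..int N + int L}" "\<epsilon> / 2"] \<epsilon> by auto
    obtain m where m: "norm (J (trunc {m..<m + int L} u) - l *\<^sub>R trunc {m..<m + int L} u) < \<epsilon> * norm (trunc {m..<m + int L} u)"
      using exists_good_window[OF u(1,2,4) \<epsilon> L] by blast
    define w where "w = trunc {m..<m + int L} u"
    have wD: "w \<in> D" by (simp add: w_def trunc_in_D u)
    have wn: "norm (J w - l *\<^sub>R w) < \<epsilon> * norm w" using m by (simp add: w_def)
    then have nz: "w \<noteq> 0" using \<epsilon> by auto
    then obtain n where n: "w $$ n \<noteq> 0" using l2_eqI[of w 0] by auto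
    then have "n \<in> supp u" "n < m + int L" by (auto simp: w_def supp_def split: if_splits)
    moreover have "supp u \<subseteq> {1..}" using D_sub_H[OF u(1)] by (auto simp: l2_on_def supp_def)
    ultimately have mN: "int N < m" using u(3) by (cases "n \<le> int N + int L") (auto simp: disjoint_iff)
    obtain v where v: "v \<in> D" "norm v = 1" "supp v \<subseteq> supp w" "norm (J v - l *\<^sub>R v) < \<epsilon>"
      using normalize[OF wD wn] by blast
    have "supp v \<subseteq> {m..<m + int L}" using v(3) by (auto simp: supp_def w_def split: if_splits)
    moreover have "int (nat m) = m" "N < nat m" using mN by auto
    ultimately show ?thesis using v(1,2,4) by (intro exI[of _ "nat m"] conjI bexI[of _ v]) auto
  qed
  then show ?thesis by (rule that)
qed

end

section \<open>Right limits\<close>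

text \<open>The filter \<open>at_infinity\<close> forgets the sign, so both infinite limits can be
  treated alike from here on.\<close>

lemma infinite_ereal_limit_at_infinity:
  fixes f :: "nat \<Rightarrow> real"
  assumes lim: "(\<lambda>j. ereal (f j)) \<longlonglongrightarrow> x" and inf: "\<bar>x\<bar> = \<infinity>"
  shows "filterlim (\<lambda>j. f j - l) at_infinity sequentially"
  unfolding filterlim_at_infinity[OF order_refl]
proof (intro allI impI)
  fix r :: real assume "0 < r"
  consider "x = \<infinity>" | "x = -\<infinity>" using inf by (auto elim: abs_ereal.elims)
  then have "\<forall>\<^sub>F j in sequentially. ereal (r + \<bar>l\<bar>) < ereal (f j) \<or> ereal (f j) < ereal (- (r + \<bar>l\<bar>))"
  proof cases
    case 1
    then have "\<forall>\<^sub>F j in sequentially. ereal (r + \<bar>l\<bar>) < ereal (f j)"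
      using lim by (intro order_tendstoD(1)) auto
    then show ?thesis by eventually_elim simp
  next
    case 2
    then have "\<forall>\<^sub>F j in sequentially. ereal (f j) < ereal (- (r + \<bar>l\<bar>))"
      using lim by (intro order_tendstoD(2)) auto
    then show ?thesis by eventually_elim simp
  qed
  then show "\<forall>\<^sub>F j in sequentially. r \<le> norm (f j - l)"
    by eventually_elim auto
qed

locale half_line_jacobi =
  fixes a b :: "nat \<Rightarrow> real" and M :: real
  assumes pos: "\<And>n. 1 \<le> n \<Longrightarrow> 0 < a n" and bound: "\<And>n. \<bar>a n\<bar> \<le> M"
begin

sublocale one_sided_jacobi "\<lambda>n. a (nat n)" "\<lambda>n. b (nat n)" M
  by unfold_locales (auto simp: bound pos)

lemma shifted_coord_J:
  assumes "u \<in> D" "1 \<le> n + int k"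
  shows "(J u - l *\<^sub>R u) $$ (n + int k) =
    complex_of_real (a (nat (int k + (n - 1)))) * u $$ (n - 1 + int k) +
    complex_of_real (a (nat (int k + n))) * u $$ (n + 1 + int k) +
    complex_of_real (b (nat (int k + n)) - l) * u $$ (n + int k)"
  using assms by (simp add: coord_J' coord_K algebra_simps)

lemma eventually_positive_site:
  assumes "strict_mono (k :: nat \<Rightarrow> nat)"
  shows "\<forall>\<^sub>F j in sequentially. N \<le> n + int (k j)"
proof -
  have "\<forall>\<^sub>F j in sequentially. nat (N - n) \<le> j" by (rule eventually_ge_at_top)
  then show ?thesis
  proof eventually_elim
    case (elim j)
    then show ?case using seq_suble[OF assms, of j] by linarith
  qed
qed

lemma right_limits_cases:
  assumes "(ar, br) \<in> right_limits a b"
  obtains k where "strict_mono k" "\<And>n. (\<lambda>j. a (nat (int (k j) + n))) \<longlonglongrightarrow> ar n"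
    "\<And>n. (\<lambda>j. ereal (b (nat (int (k j) + n)))) \<longlonglongrightarrow> br n"
  using assms by (auto simp: right_limits_def)

lemma right_limit_jacobi:
  assumes "(ar, br) \<in> right_limits a b"
  shows "jacobi ar M"
proof
  fix n
  obtain k where k: "\<And>n. (\<lambda>j. a (nat (int (k j) + n))) \<longlonglongrightarrow> ar n"
    using right_limits_cases[OF assms] by metis
  have "(\<lambda>j. \<bar>a (nat (int (k j) + n))\<bar>) \<longlonglongrightarrow> \<bar>ar n\<bar>" by (intro tendsto_intros k)
  then show "\<bar>ar n\<bar> \<le> M" by (rule LIMSEQ_le_const2) (auto simp: bound)
qed

lemma finite_part_tendsto:
  assumes "(\<lambda>j. ereal (f j)) \<longlonglongrightarrow> br n" "n \<in> finite_sites br"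
  shows "f \<longlonglongrightarrow> real_of_ereal (br n)"
proof -
  have "br n = ereal (real_of_ereal (br n))" using assms(2) by (simp add: finite_sites_def ereal_real')
  then have "(\<lambda>j. ereal (f j)) \<longlonglongrightarrow> ereal (real_of_ereal (br n))" using assms(1) by simp
  then show ?thesis by simp
qed

text \<open>
  A finitely supported vector \<open>v\<close> of the right limit is transplanted to the sites around \<open>k j\<close>. At a
  removed site, where the diagonal entry tends to infinity, the transplant takes the small value that makes
  the corresponding row of \<open>(J - l) w\<close> vanish up to a null sequence.
\<close>

lemma right_limit_lower_bound:
  assumes rl: "(ar, br) \<in> right_limits a b" and c: "0 < c"
    and low: "\<And>w. w \<in> D \<Longrightarrow> w $$ 1 = 0 \<Longrightarrow> c * norm w \<le> norm (J w - l *\<^sub>R w)"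
    and v: "finite (supp v)" "supp v \<subseteq> finite_sites br"
  shows "c * norm v \<le>
    norm (l2_jacobi (finite_sites br) ar (\<lambda>n. real_of_ereal (br n)) v - l *\<^sub>R v)"
proof -
  interpret R: jacobi "finite_sites br" ar "\<lambda>n. real_of_ereal (br n)" M
    by (rule right_limit_jacobi[OF rl])
  obtain k where k: "strict_mono k" and ka: "\<And>n. (\<lambda>j. a (nat (int (k j) + n))) \<longlonglongrightarrow> ar n"
    and kb: "\<And>n. (\<lambda>j. ereal (b (nat (int (k j) + n)))) \<longlonglongrightarrow> br n"
    using right_limits_cases[OF rl] by metis
  have vD: "v \<in> R.D" using v by (rule R.finite_supp_in_D)
  obtain r :: int where r: "\<And>n. r < \<bar>n\<bar> \<Longrightarrow> v $$ n = 0"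
  proof -
    have "\<forall>n\<in>supp v. \<bar>n\<bar> \<le> (\<Sum>m\<in>supp v. \<bar>m\<bar>)"
      using v(1) by (auto intro!: member_le_sum[where f = abs])
    then show ?thesis using that[of "\<Sum>m\<in>supp v. \<bar>m\<bar>"] by (force simp: supp_def)
  qed
  define aj where "aj j n = a (nat (int (k j) + n))" for j n
  define bj where "bj j n = b (nat (int (k j) + n))" for j n
  define num where "num j n = complex_of_real (aj j (n - 1)) * v $$ (n - 1) + complex_of_real (aj j n) * v $$ (n + 1)" for j n
  define x where "x j n = (if n \<in> finite_sites br then v $$ n
      else - (num j n) * complex_of_real (1 / (bj j n - l)))" for j n
  \<comment> \<open>\<open>v\<close> lives on the sites with \<bar>n\<bar> \<le> r, its corrections
    reach one site further, and the rows of \<open>J\<close> another one.\<close>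
  define E where "E = {-r-2..r+2}"
  have v_off: "v $$ n = 0" if "n \<notin> finite_sites br" for n using v(2) that by (auto simp: supp_def)
  have x0: "x j n = 0" if "r + 1 < \<bar>n\<bar>" for j n
    using that r[of n] r[of "n - 1"] r[of "n + 1"] by (auto simp: x_def num_def)
  have "x j \<in> ell2 UNIV" for j
    by (rule finite_support_in_ell2[of "{-r-1..r+1}"]) (auto intro!: x0)
  then have X: "Abs_l2 (x j) $$ n = x j n" for j n by (rule coord_Abs)
  define w where "w j = shift (- int (k j)) (Abs_l2 (x j))" for j
  have w: "w j $$ (n + int (k j)) = x j n" for j n by (simp add: w_def X)
  have inv0: "(\<lambda>j. 1 / (bj j n - l)) \<longlonglongrightarrow> 0" and ne: "\<forall>\<^sub>F j in sequentially. bj j n - l \<noteq> 0"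
    if "n \<notin> finite_sites br" for n
  proof -
    have *: "filterlim (\<lambda>j. bj j n - l) at_infinity sequentially"
      using infinite_ereal_limit_at_infinity[OF kb[of n], of l] that by (auto simp: finite_sites_def bj_def)
    show "(\<lambda>j. 1 / (bj j n - l)) \<longlonglongrightarrow> 0" by (rule tendsto_divide_0[OF tendsto_const *])
    show "\<forall>\<^sub>F j in sequentially. bj j n - l \<noteq> 0" by (rule filterlim_at_infinity_imp_eventually_ne[OF *])
  qed
  have ajc: "(\<lambda>j. aj j n) \<longlonglongrightarrow> ar n" for n
    unfolding aj_def by (rule ka)
  have xc: "(\<lambda>j. x j n) \<longlonglongrightarrow> v $$ n" for n
  proof (cases "n \<in> finite_sites br")
    case False
    have "(\<lambda>j. - (num j n) * complex_of_real (1 / (bj j n - l)))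
        \<longlonglongrightarrow> - (complex_of_real (ar (n - 1)) * v $$ (n - 1) + complex_of_real (ar n) * v $$ (n + 1)) * complex_of_real 0"
      unfolding num_def by (intro tendsto_intros ajc inv0[OF False])
    then show ?thesis using False by (simp add: x_def v_off)
  qed (simp add: x_def)
  define y where "y j n = complex_of_real (aj j (n - 1)) * x j (n - 1) + complex_of_real (aj j n) * x j (n + 1)
      + complex_of_real (bj j n - l) * x j n" for j n
  have yc: "(\<lambda>j. y j n) \<longlonglongrightarrow> (R.J v - l *\<^sub>R v) $$ n" for n
  proof (cases "n \<in> finite_sites br")
    case True
    have bjc: "(\<lambda>j. bj j n) \<longlonglongrightarrow> real_of_ereal (br n)"
      using finite_part_tendsto[OF kb True] unfolding bj_def .
    have "(\<lambda>j. y j n) \<longlonglongrightarrow> complex_of_real (ar (n - 1)) * v $$ (n - 1) + complex_of_real (ar n) * v $$ (n + 1)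
      + (complex_of_real (real_of_ereal (br n)) - complex_of_real l) * v $$ n"
      unfolding y_def of_real_diff by (intro tendsto_intros ajc xc bjc)
    then show ?thesis using True by (simp add: R.coord_J' vD R.coord_K algebra_simps)
  next
    case False
    \<comment> \<open>The correction cancels the contribution of \<open>v\<close> at the neighbours;
      what remains comes from corrections there, which are null sequences. The default value 1/0 = 0
      occurs for finitely many \<open>j\<close> only, which \<open>ne\<close> removes.\<close>
    have "\<forall>\<^sub>F j in sequentially. complex_of_real (aj j (n - 1)) * (x j (n - 1) - v $$ (n - 1))
        + complex_of_real (aj j n) * (x j (n + 1) - v $$ (n + 1)) = y j n"
      using ne[OF False]
    proof eventually_elim
      case (elim j)
      have "complex_of_real (bj j n - l) * complex_of_real (1 / (bj j n - l)) = 1"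
        unfolding of_real_mult[symmetric] using elim by simp
      then have "complex_of_real (bj j n - l) * x j n = - num j n"
        using False by (simp only: x_def if_False) (metis mult.commute mult.left_commute mult.right_neutral)
      then show ?case unfolding y_def num_def by (simp add: algebra_simps)
    qed
    moreover have "(\<lambda>j. complex_of_real (aj j (n - 1)) * (x j (n - 1) - v $$ (n - 1))
        + complex_of_real (aj j n) * (x j (n + 1) - v $$ (n + 1)))
        \<longlonglongrightarrow> complex_of_real (ar (n - 1)) * (v $$ (n - 1) - v $$ (n - 1)) + complex_of_real (ar n) * (v $$ (n + 1) - v $$ (n + 1))"
      by (intro tendsto_intros ajc xc)
    ultimately have "(\<lambda>j. y j n) \<longlonglongrightarrow> 0"
      by (auto intro: Lim_transform_eventually)
    then show ?thesis using False by (simp add: R.coord_J' vD R.coord_K v_off)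
  qed
  have wE: "(norm (w j))\<^sup>2 = (\<Sum>n\<in>E. (cmod (x j n))\<^sup>2)" for j
  proof -
    have "(norm (w j))\<^sup>2 = (norm (Abs_l2 (x j)))\<^sup>2" by (simp add: w_def)
    also have "\<dots> = (\<Sum>n\<in>E. (cmod (x j n))\<^sup>2)"
      by (subst norm_l2_sq_finite[of E]) (auto simp: E_def X intro!: x0)
    finally show ?thesis .
  qed
  \<comment> \<open>Eventually all of \<open>E\<close> is moved to sites \<ge> 2, so the transplants
    lie in the half line and vanish at 1.\<close>
  have ineq: "\<forall>\<^sub>F j in sequentially. c\<^sup>2 * (\<Sum>n\<in>E. (cmod (x j n))\<^sup>2) \<le> (\<Sum>n\<in>E. (cmod (y j n))\<^sup>2)"
    using eventually_positive_site[OF k, of 2 "-r-2"]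
  proof eventually_elim
    case (elim j)
    have supp_w: "w j $$ m = 0" if "m < 2" for m
      using w[of j "m - int (k j)"] x0[of "m - int (k j)" j] elim that by simp
    have "supp (w j) \<subseteq> (\<lambda>n. n + int (k j)) ` E"
    proof
      fix m assume "m \<in> supp (w j)"
      then have "x j (m - int (k j)) \<noteq> 0" using w[of j "m - int (k j)"] by (simp add: supp_def)
      then have "m - int (k j) \<in> E" using x0[of "m - int (k j)" j] by (force simp: E_def)
      then show "m \<in> (\<lambda>n. n + int (k j)) ` E" by (intro image_eqI[of _ _ "m - int (k j)"]) auto
    qed
    then have "finite (supp (w j))" by (rule finite_subset) (simp add: E_def)
    moreover have "supp (w j) \<subseteq> {1..}" using supp_w by (force simp: supp_def)
    ultimately have wD: "w j \<in> D" by (rule finite_supp_in_D)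
    define s where "s = shift (int (k j)) (J (w j) - l *\<^sub>R w j)"
    have s_pos: "s $$ n = y j n" if "1 \<le> n + int (k j)" for n
      unfolding s_def coord_shift shifted_coord_J[OF wD that] w y_def aj_def bj_def by simp
    have "s $$ n = 0" if "n \<notin> E" for n
    proof (cases "1 \<le> n + int (k j)")
      case True
      then show ?thesis using that x0[of n j] x0[of "n - 1" j] x0[of "n + 1" j]
        unfolding s_pos[OF True] y_def E_def by (auto simp: abs_if split: if_splits)
    next
      case False
      have "J (w j) - l *\<^sub>R w j \<in> H" using wD J_H D_sub_H by (auto simp: l2_on_def)
      then show ?thesis using False by (simp add: s_def l2_on_def del: coord_diff coord_scaleR)
    qed
    then have "(norm s)\<^sup>2 = (\<Sum>n\<in>E. (cmod (s $$ n))\<^sup>2)"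
      by (intro norm_l2_sq_finite) (auto simp: E_def)
    also have "\<dots> = (\<Sum>n\<in>E. (cmod (y j n))\<^sup>2)"
      using elim by (intro sum.cong refl) (subst s_pos, auto simp: E_def)
    finally have "(norm (J (w j) - l *\<^sub>R w j))\<^sup>2 = (\<Sum>n\<in>E. (cmod (y j n))\<^sup>2)" by (simp add: s_def)
    moreover have "(c * norm (w j))\<^sup>2 \<le> (norm (J (w j) - l *\<^sub>R w j))\<^sup>2"
      using low[OF wD supp_w] c by (intro power_mono) auto
    ultimately show ?case by (simp add: power_mult_distrib wE)
  qed
  have "c\<^sup>2 * (\<Sum>n\<in>E. (cmod (v $$ n))\<^sup>2) \<le> (\<Sum>n\<in>E. (cmod ((R.J v - l *\<^sub>R v) $$ n))\<^sup>2)"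
    by (rule tendsto_le[OF sequentially_bot _ _ ineq]) (intro tendsto_intros xc yc)+
  also have "\<dots> \<le> (norm (R.J v - l *\<^sub>R v))\<^sup>2" by (rule sum_coord_le) (simp add: E_def)
  finally have "(c * norm v)\<^sup>2 \<le> (norm (R.J v - l *\<^sub>R v))\<^sup>2"
    by (subst (asm) norm_l2_sq_finite[of E v, symmetric]) (auto simp: E_def power_mult_distrib intro!: r)
  then show ?thesis by (rule power2_le_imp_le) simp
qed

text \<open>A finitely supported approximate eigenvector of the right limit would violate the lower
  bound that \<open>J\<close> hands down to it.\<close>

lemma spectral_limit_point_of_right_limit:
  assumes rl: "(ar, br) \<in> right_limits a b"
    and ap: "selfadjoint.approx_eigenvalue (l2_dom (finite_sites br) (\<lambda>n. real_of_ereal (br n)))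
      (l2_jacobi (finite_sites br) ar (\<lambda>n. real_of_ereal (br n))) l"
  shows "spectral_limit_point l"
proof (rule ccontr)
  assume "\<not> spectral_limit_point l"
  then obtain c where c: "0 < c" "\<And>v. v \<in> D \<Longrightarrow> v $$ 1 = 0 \<Longrightarrow> c * norm v \<le> norm (J v - l *\<^sub>R v)"
    using bounded_below_away_from_boundary by blast
  interpret R: jacobi "finite_sites br" ar "\<lambda>n. real_of_ereal (br n)" M
    by (rule right_limit_jacobi[OF rl])
  obtain u where "u \<in> R.D" "norm (R.J u - l *\<^sub>R u) < c * norm u"
    using ap c(1) unfolding R.approx_eigenvalue_def by blast
  then obtain v where v: "finite (supp v)" "v \<in> R.D" "norm (R.J v - l *\<^sub>R v) < c * norm v"
    by (rule R.finite_supp_approx) blast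
  have "supp v \<subseteq> finite_sites br" using R.D_sub_H[OF v(2)] by (auto simp: l2_on_def supp_def)
  from right_limit_lower_bound[OF rl c v(1) this] v(3) show False by simp
qed

text \<open>Three extractions in succession. Allowing infinite values makes the range of
  \<open>b\<close> compact, so every sequence of sites going to infinity has a subsequence that
  defines a right limit.\<close>

lemma right_limit_subsequence:
  fixes X :: "nat \<Rightarrow> int \<Rightarrow> complex"
  assumes k: "strict_mono k" and X: "\<And>j n. cmod (X j n) \<le> 1"
  obtains r ar br x where "strict_mono r" "(ar, br) \<in> right_limits a b"
    "\<And>n. (\<lambda>j. a (nat (int (k (r j)) + n))) \<longlonglongrightarrow> ar n"
    "\<And>n. (\<lambda>j. ereal (b (nat (int (k (r j)) + n)))) \<longlonglongrightarrow> br n"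
    "\<And>n. (\<lambda>j. X (r j) n) \<longlonglongrightarrow> x n"
proof -
  have "a (nat (int (k j) + n)) \<in> cball 0 M" for j n using bound by simp
  then obtain r1 ar where r1: "strict_mono r1" "\<And>n. (\<lambda>j. a (nat (int (k (r1 j)) + n))) \<longlonglongrightarrow> ar n"
    using coordinatewise_convergent_subsequence[of "\<lambda>_. cball 0 M" "\<lambda>j n. a (nat (int (k j) + n))"] compact_cball
    by metis
  obtain r2 br where r2: "strict_mono r2" "\<And>n. (\<lambda>j. ereal (b (nat (int (k (r1 (r2 j))) + n)))) \<longlonglongrightarrow> br n"
    using coordinatewise_convergent_subsequence[of "\<lambda>_. UNIV" "\<lambda>j n. ereal (b (nat (int (k (r1 j)) + n)))"]
      compact_UNIV by (metis UNIV_I)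
  have "X (r1 (r2 j)) n \<in> cball 0 1" for j n using X by simp
  then obtain r3 x where r3: "strict_mono r3" "\<And>n. (\<lambda>j. X (r1 (r2 (r3 j))) n) \<longlonglongrightarrow> x n"
    using coordinatewise_convergent_subsequence[of "\<lambda>_. cball 0 1" "\<lambda>j n. X (r1 (r2 j)) n"] compact_cball
    by metis
  define r where "r = r1 \<circ> (r2 \<circ> r3)"
  have r: "strict_mono r" unfolding r_def using r1 r2 r3 by (intro strict_mono_o)
  have ra: "(\<lambda>j. a (nat (int (k (r j)) + n))) \<longlonglongrightarrow> ar n" for n
    using LIMSEQ_subseq_LIMSEQ[OF r1(2)[of n] strict_mono_o[OF r2(1) r3(1)]] by (simp add: r_def o_def)
  have rb: "(\<lambda>j. ereal (b (nat (int (k (r j)) + n)))) \<longlonglongrightarrow> br n" for n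
    using LIMSEQ_subseq_LIMSEQ[OF r2(2)[of n] r3(1)] by (simp add: r_def o_def)
  have kr: "strict_mono (\<lambda>j. k (r j))" using strict_mono_o[OF k r] by (simp add: o_def)
  have "0 \<le> ar n" for n
  proof (rule tendsto_lowerbound[OF ra[of n]])
    show "\<forall>\<^sub>F j in sequentially. 0 \<le> a (nat (int (k (r j)) + n))"
      using eventually_positive_site[OF kr, of 2 n] by eventually_elim (auto intro!: less_imp_le pos)
  qed simp
  then have "(ar, br) \<in> right_limits a b"
    unfolding right_limits_def using kr ra rb by blast
  then show ?thesis using r ra rb r3(2) that[of r ar br x] by (simp add: r_def)
qed

lemma right_limit_near_spectral_limit_point:
  assumes l: "spectral_limit_point l" and \<epsilon>: "0 < \<epsilon>"
  obtains ar br \<nu> where "(ar, br) \<in> right_limits a b" "\<bar>\<nu> - l\<bar> < \<epsilon>"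
    "selfadjoint.approx_eigenvalue (l2_dom (finite_sites br) (\<lambda>n. real_of_ereal (br n)))
      (l2_jacobi (finite_sites br) ar (\<lambda>n. real_of_ereal (br n))) \<nu>"
proof -
  \<comment> \<open>Fatou's lemma yields only a weak inequality; halving \<epsilon> restores a
    strict one.\<close>
  define \<eta> where "\<eta> = \<epsilon> / 2"
  have \<eta>: "0 < \<eta>" "\<eta> < \<epsilon>" using \<epsilon> by (auto simp: \<eta>_def)
  obtain L :: nat where L: "\<And>N::nat. \<exists>m>N. \<exists>w\<in>D. supp w \<subseteq> {int m..<int m + int L} \<and> norm w = 1 \<and> norm (J w - l *\<^sub>R w) < \<eta>"
    using good_windows[OF l \<eta>(1)] by metis
  define Ms where "Ms = {m::nat. \<exists>w\<in>D. supp w \<subseteq> {int m..<int m + int L} \<and> norm w = 1 \<and> norm (J w - l *\<^sub>R w) < \<eta>}"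
  have "infinite Ms" unfolding infinite_nat_iff_unbounded Ms_def using L by blast
  define k where "k = enumerate Ms"
  have k: "strict_mono k" "\<And>j. k j \<in> Ms"
    using \<open>infinite Ms\<close> by (auto simp: k_def strict_mono_enumerate enumerate_in_set)
  then have "\<exists>w. \<forall>j. w j \<in> D \<and> supp (w j) \<subseteq> {int (k j)..<int (k j) + int L} \<and> norm (w j) = 1 \<and> norm (J (w j) - l *\<^sub>R w j) < \<eta>"
    by (intro choice) (auto simp: Ms_def)
  then obtain w where w: "\<And>j. w j \<in> D" "\<And>j. supp (w j) \<subseteq> {int (k j)..<int (k j) + int L}" "\<And>j. norm (w j) = 1"
    "\<And>j. norm (J (w j) - l *\<^sub>R w j) < \<eta>" by blast
  define V where "V j = shift (int (k j)) (w j)" for j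
  have nV: "norm (V j) = 1" for j by (simp add: V_def w)
  have V0: "V j $$ n = 0" if "n \<notin> {0..<int L}" for j n
    using w(2)[of j] that by (auto simp: V_def supp_def)
  have "cmod (V j $$ n) \<le> 1" for j n using coord_le[of "V j" n] by (simp add: nV)
  then obtain r ar br x where r: "strict_mono r" and rl: "(ar, br) \<in> right_limits a b"
    and ra: "\<And>n. (\<lambda>j. a (nat (int (k (r j)) + n))) \<longlonglongrightarrow> ar n"
    and rb: "\<And>n. (\<lambda>j. ereal (b (nat (int (k (r j)) + n)))) \<longlonglongrightarrow> br n"
    and rx: "\<And>n. (\<lambda>j. V (r j) $$ n) \<longlonglongrightarrow> x n"
    using right_limit_subsequence[OF k(1), of "\<lambda>j n. V j $$ n"] by metis
  have kr: "strict_mono (\<lambda>j. k (r j))" using strict_mono_o[OF k(1) r] by (simp add: o_def)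
  interpret R: jacobi "finite_sites br" ar "\<lambda>n. real_of_ereal (br n)" M
    by (rule right_limit_jacobi[OF rl])
  have x0: "x n = 0" if "n \<notin> {0..<int L}" for n
    using rx[of n] V0[OF that] by (simp add: LIMSEQ_const_iff)
  have "x \<in> ell2 UNIV" by (rule finite_support_in_ell2[of "{0..<int L}"]) (auto intro: x0)
  define v where "v = Abs_l2 x"
  have v: "v $$ n = x n" for n unfolding v_def by (rule coord_Abs) fact
  \<comment> \<open>Row \<open>n\<close> bounds the product of the shifted diagonal entry with the
    coordinate uniformly in \<open>j\<close>, so a diverging entry forces the coordinate to
    zero.\<close>
  have x_off: "x n = 0" if n: "n \<notin> finite_sites br" for n
  proof -
    define \<beta> where "\<beta> j = b (nat (int (k (r j)) + n)) - l" for j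
    have inf: "filterlim \<beta> at_infinity sequentially"
      using infinite_ereal_limit_at_infinity[OF rb[of n], of l] n unfolding \<beta>_def by (auto simp: finite_sites_def)
    have est: "\<bar>\<beta> j\<bar> * cmod (V (r j) $$ n) \<le> \<eta> + 2 * M" for j
    proof -
      define m where "m = n + int (k (r j))"
      have "complex_of_real (\<beta> j) * w (r j) $$ m = (J (w (r j)) - l *\<^sub>R w (r j)) $$ m - K (w (r j)) $$ m"
        by (simp add: coord_J' w \<beta>_def m_def algebra_simps)
      then have "\<bar>\<beta> j\<bar> * cmod (w (r j) $$ m) \<le> cmod ((J (w (r j)) - l *\<^sub>R w (r j)) $$ m) + cmod (K (w (r j)) $$ m)"
        by (metis norm_mult norm_of_real norm_triangle_ineq4)
      also have "\<dots> \<le> norm (J (w (r j)) - l *\<^sub>R w (r j)) + norm (K (w (r j)))"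
        by (intro add_mono coord_le)
      also have "\<dots> \<le> \<eta> + 2 * M" using w(4)[of "r j"] norm_K[of "w (r j)"] w(3)[of "r j"] by simp
      finally show ?thesis by (simp add: V_def m_def)
    qed
    have "(\<lambda>j. (\<eta> + 2 * M) / \<beta> j) \<longlonglongrightarrow> 0" by (rule tendsto_divide_0[OF tendsto_const inf])
    then have "(\<lambda>j. \<bar>(\<eta> + 2 * M) / \<beta> j\<bar>) \<longlonglongrightarrow> 0" by (rule tendsto_rabs_zero)
    moreover have "\<forall>\<^sub>F j in sequentially. norm (V (r j) $$ n) \<le> \<bar>(\<eta> + 2 * M) / \<beta> j\<bar>"
      using filterlim_at_infinity_imp_eventually_ne[OF inf, of 0]
    proof eventually_elim
      case (elim j)
      then have "norm (V (r j) $$ n) \<le> (\<eta> + 2 * M) / \<bar>\<beta> j\<bar>"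
        using est[of j] by (simp add: pos_le_divide_eq mult.commute)
      then show ?case using \<eta> M_nonneg by (simp add: abs_divide)
    qed
    ultimately have "(\<lambda>j. V (r j) $$ n) \<longlonglongrightarrow> 0" by (rule Lim_null_comparison[rotated])
    then show ?thesis using rx LIMSEQ_unique by blast
  qed
  have supp_v: "supp v \<subseteq> {0..<int L}" "supp v \<subseteq> finite_sites br"
    using x0 x_off by (auto simp: supp_def v) (metis atLeastLessThan_iff)+
  then have vD: "v \<in> R.D" by (intro R.finite_supp_in_D) (auto intro: finite_subset)
  \<comment> \<open>All supports lie in the same \<open>L\<close> sites, so no norm is lost in the
    limit.\<close>
  have "(norm (V (r j)))\<^sup>2 = (\<Sum>n\<in>{0..<int L}. (cmod (V (r j) $$ n))\<^sup>2)" for j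
    by (intro norm_l2_sq_finite V0) auto
  then have "(\<lambda>j. 1) \<longlonglongrightarrow> (\<Sum>n\<in>{0..<int L}. (cmod (x n))\<^sup>2)"
    using tendsto_sum[of "{0..<int L}" "\<lambda>n j. (cmod (V (r j) $$ n))\<^sup>2"] rx by (simp add: nV tendsto_intros)
  then have "(\<Sum>n\<in>{0..<int L}. (cmod (x n))\<^sup>2) = 1" by (simp add: LIMSEQ_const_iff)
  moreover have "(norm v)\<^sup>2 = (\<Sum>n\<in>{0..<int L}. (cmod (v $$ n))\<^sup>2)"
    by (intro norm_l2_sq_finite) (auto simp: v intro!: x0)
  ultimately have nv: "norm v = 1" by (simp add: v power2_eq_1_iff) (smt (verit) norm_ge_zero)
  \<comment> \<open>Removed sites are cut out: there the rows of the right limit are zero, while the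
    residuals of \<open>J\<close> need not tend to zero.\<close>
  define Y where "Y j = trunc (finite_sites br) (shift (int (k (r j))) (J (w (r j)) - l *\<^sub>R w (r j)))" for j
  have Yn: "norm (Y j) \<le> \<eta>" for j
  proof -
    have "norm (Y j) \<le> 1 * norm (shift (int (k (r j))) (J (w (r j)) - l *\<^sub>R w (r j)))"
      unfolding Y_def by (rule norm_l2_mono) auto
    then show ?thesis using w(4)[of "r j"] by simp
  qed
  have Yc: "(\<lambda>j. Y j $$ n) \<longlonglongrightarrow> (R.J v - l *\<^sub>R v) $$ n" for n
  proof (cases "n \<in> finite_sites br")
    case True
    have "\<forall>\<^sub>F j in sequentially.
        complex_of_real (a (nat (int (k (r j)) + (n - 1)))) * V (r j) $$ (n - 1) +
        complex_of_real (a (nat (int (k (r j)) + n))) * V (r j) $$ (n + 1) +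
        complex_of_real (b (nat (int (k (r j)) + n)) - l) * V (r j) $$ n = Y j $$ n"
      using eventually_positive_site[OF kr, of 1 n]
    proof eventually_elim
      case (elim j)
      show ?case
        unfolding Y_def coord_trunc coord_shift shifted_coord_J[OF w(1) elim] V_def
        using True by simp
    qed
    moreover have "(\<lambda>j. complex_of_real (a (nat (int (k (r j)) + (n - 1)))) * V (r j) $$ (n - 1) +
        complex_of_real (a (nat (int (k (r j)) + n))) * V (r j) $$ (n + 1) +
        complex_of_real (b (nat (int (k (r j)) + n)) - l) * V (r j) $$ n)
        \<longlonglongrightarrow> complex_of_real (ar (n - 1)) * x (n - 1) + complex_of_real (ar n) * x (n + 1) +
          complex_of_real (real_of_ereal (br n) - l) * x n"
      by (intro tendsto_intros ra rx finite_part_tendsto[OF rb True])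
    ultimately have "(\<lambda>j. Y j $$ n) \<longlonglongrightarrow> complex_of_real (ar (n - 1)) * x (n - 1) + complex_of_real (ar n) * x (n + 1) +
          complex_of_real (real_of_ereal (br n) - l) * x n"
      by (rule Lim_transform_eventually[rotated])
    then show ?thesis using True by (simp add: R.coord_J' vD R.coord_K v algebra_simps)
  qed (simp add: Y_def R.coord_J' vD R.coord_K v x_off)
  have "norm (Abs_l2 (coord (R.J v - l *\<^sub>R v))) \<le> \<eta>"
    by (rule l2_Fatou(2)[OF Yc Yn])
  moreover have "Abs_l2 (coord (R.J v - l *\<^sub>R v)) = R.J v - l *\<^sub>R v"
    by (rule l2_eqI) (rule coord_Abs[OF coord_in_ell2])
  ultimately have "norm (R.J v - l *\<^sub>R v) < \<epsilon> * norm v" using \<eta> nv by simp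
  then obtain \<nu> where "\<bar>\<nu> - l\<bar> < \<epsilon>" "R.approx_eigenvalue \<nu>"
    using R.approx_eigenvalue_near[OF vD] by blast
  then show ?thesis using that rl by blast
qed

end

section \<open>Extended spectra\<close>

context jacobi
begin

lemma infinite_points_eq:
  "infinite_points (spectrum (ell2 S) (jacobi_domain S b) (jacobi_op S a b)) =
    {x. x = \<infinity> \<and> \<not> bdd_above {\<mu>. approx_eigenvalue \<mu>} \<or> x = -\<infinity> \<and> \<not> bdd_below {\<mu>. approx_eigenvalue \<mu>}}"
proof -
  have "{l. complex_of_real l \<in> complex_of_real ` {\<mu>. approx_eigenvalue \<mu>}} = {\<mu>. approx_eigenvalue \<mu>}" by auto
  then show ?thesis unfolding infinite_points_def spectrum_eq by simp
qed

lemma ext_spectrum_eq: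
  "ext_spectrum (ell2 S) (jacobi_domain S b) (jacobi_op S a b) =
    ereal ` {\<mu>. approx_eigenvalue \<mu>} \<union> {x. x = \<infinity> \<and> \<not> bdd_above {\<mu>. approx_eigenvalue \<mu>} \<or>
      x = -\<infinity> \<and> \<not> bdd_below {\<mu>. approx_eigenvalue \<mu>}}"
proof -
  have "{l. complex_of_real l \<in> complex_of_real ` {\<mu>. approx_eigenvalue \<mu>}} = {\<mu>. approx_eigenvalue \<mu>}" by auto
  then show ?thesis unfolding ext_spectrum_def infinite_points_eq by (simp add: spectrum_eq)
qed

lemma spectral_limit_point_closed:
  assumes "\<And>e. 0 < e \<Longrightarrow> \<exists>\<nu>. spectral_limit_point \<nu> \<and> \<bar>\<nu> - l\<bar> < e"
  shows "spectral_limit_point l"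
  unfolding spectral_limit_point_def
proof (intro allI impI)
  fix e :: real assume e: "0 < e"
  obtain \<nu> where \<nu>: "spectral_limit_point \<nu>" "\<bar>\<nu> - l\<bar> < e" using assms[OF e] by blast
  show "\<exists>\<nu>. \<nu> \<noteq> l \<and> \<bar>\<nu> - l\<bar> < e \<and> approx_eigenvalue \<nu>"
  proof (cases "\<nu> = l")
    case True
    then show ?thesis using \<nu>(1) e unfolding spectral_limit_point_def by blast
  next
    case False
    \<comment> \<open>A radius that keeps \<mu> different from \<open>l\<close> and within
      \<open>e\<close> of it.\<close>
    define d where "d = min \<bar>\<nu> - l\<bar> (e - \<bar>\<nu> - l\<bar>)"
    have "0 < d" using False \<nu>(2) by (simp add: d_def)
    then obtain \<mu> where "\<bar>\<mu> - \<nu>\<bar> < d" "approx_eigenvalue \<mu>"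
      using \<nu>(1) unfolding spectral_limit_point_def by blast
    then show ?thesis by (intro exI[of _ \<mu>]) (auto simp: d_def)
  qed
qed

lemma approx_eigenvalue_of_spectral_limit_point:
  "spectral_limit_point l \<Longrightarrow> approx_eigenvalue l"
  by (rule approx_eigenvalue_closed) (auto simp: spectral_limit_point_def)

lemma islimpt_spectrum_iff:
  "complex_of_real l islimpt spectrum (ell2 S) (jacobi_domain S b) (jacobi_op S a b) \<longleftrightarrow> spectral_limit_point l"
  unfolding spectrum_eq islimpt_approachable spectral_limit_point_def
  by (auto simp: dist_of_real dist_real_def)

end

lemma (in one_sided_jacobi) ext_essential_spectrum_eq:
  "ext_essential_spectrum (ell2 {1..}) (jacobi_domain {1..} b) (jacobi_op {1..} a b) =
    ereal ` {l. spectral_limit_point l} \<union> {x. x = \<infinity> \<and> \<not> bdd_above {\<mu>. approx_eigenvalue \<mu>} \<or>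
      x = -\<infinity> \<and> \<not> bdd_below {\<mu>. approx_eigenvalue \<mu>}}"
proof -
  have "complex_of_real l \<in> essential_spectrum (ell2 {1..}) (jacobi_domain {1..} b) (jacobi_op {1..} a b)
      \<longleftrightarrow> spectral_limit_point l" for l
    unfolding essential_spectrum_def mem_Collect_eq islimpt_spectrum_iff
    using approx_eigenvalue_of_spectral_limit_point[of l] finite_multiplicity_jacobi by (auto simp: spectrum_eq)
  then show ?thesis unfolding ext_essential_spectrum_def infinite_points_eq by simp
qed

section \<open>Closure of the limit spectra, including the points at infinity\<close>

context half_line_jacobi
begin

abbreviation "limit_spectra \<equiv> \<Union>(ar, br)\<in>right_limits a b. right_limit_sigma ar br"

lemma real_in_limit_spectra_iff:
  "ereal l \<in> limit_spectra \<longleftrightarrow> (\<exists>(ar, br)\<in>right_limits a b.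
    selfadjoint.approx_eigenvalue (l2_dom (finite_sites br) (\<lambda>n. real_of_ereal (br n)))
      (l2_jacobi (finite_sites br) ar (\<lambda>n. real_of_ereal (br n))) l)"
proof -
  have "ereal l \<in> right_limit_sigma ar br \<longleftrightarrow>
    selfadjoint.approx_eigenvalue (l2_dom (finite_sites br) (\<lambda>n. real_of_ereal (br n)))
      (l2_jacobi (finite_sites br) ar (\<lambda>n. real_of_ereal (br n))) l"
    if rl: "(ar, br) \<in> right_limits a b" for ar br
  proof -
    interpret R: jacobi "finite_sites br" ar "\<lambda>n. real_of_ereal (br n)" M
      by (rule right_limit_jacobi[OF rl])
    show ?thesis by (auto simp: right_limit_sigma_def R.ext_spectrum_eq dest: sym)
  qed
  then show ?thesis by auto
qed

lemma real_in_closure_limit_spectra_iff: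
  "ereal l \<in> closure limit_spectra \<longleftrightarrow> spectral_limit_point l"
proof
  assume cl: "ereal l \<in> closure limit_spectra"
  show "spectral_limit_point l"
  proof (rule spectral_limit_point_closed)
    fix e :: real assume "0 < e"
    then have "ereal l \<in> {ereal (l - e)<..<ereal (l + e)}" by simp
    then have "limit_spectra \<inter> {ereal (l - e)<..<ereal (l + e)} \<noteq> {}"
      using cl open_greaterThanLessThan unfolding closure_iff_nhds_not_empty by blast
    then obtain y where "y \<in> limit_spectra \<inter> {ereal (l - e)<..<ereal (l + e)}" by blast
    then have y: "y \<in> limit_spectra" "ereal (l - e) < y" "y < ereal (l + e)"
      by (simp_all only: Int_iff greaterThanLessThan_iff)
    then obtain \<nu> where \<nu>: "y = ereal \<nu>" by (cases y) auto
    then obtain ar br where "(ar, br) \<in> right_limits a b"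
      "selfadjoint.approx_eigenvalue (l2_dom (finite_sites br) (\<lambda>n. real_of_ereal (br n)))
      (l2_jacobi (finite_sites br) ar (\<lambda>n. real_of_ereal (br n))) \<nu>"
      using y(1) real_in_limit_spectra_iff[of \<nu>] by auto
    then have "spectral_limit_point \<nu>" by (rule spectral_limit_point_of_right_limit)
    moreover have "\<bar>\<nu> - l\<bar> < e" using y \<nu> by auto
    ultimately show "\<exists>\<nu>. spectral_limit_point \<nu> \<and> \<bar>\<nu> - l\<bar> < e" by blast
  qed
next
  assume l: "spectral_limit_point l"
  show "ereal l \<in> closure limit_spectra"
    unfolding closure_iff_nhds_not_empty
  proof (intro allI impI)
    fix A T :: "ereal set" assume T: "T \<subseteq> A" "open T" "ereal l \<in> T"
    have "open (ereal -` T)" using T(2) by (rule open_ereal_vimage)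
    moreover have "l \<in> ereal -` T" using T(3) by simp
    ultimately obtain e where e: "0 < e" "ball l e \<subseteq> ereal -` T" by (rule openE)
    obtain ar br \<nu> where "(ar, br) \<in> right_limits a b" "\<bar>\<nu> - l\<bar> < e"
      "selfadjoint.approx_eigenvalue (l2_dom (finite_sites br) (\<lambda>n. real_of_ereal (br n)))
      (l2_jacobi (finite_sites br) ar (\<lambda>n. real_of_ereal (br n))) \<nu>"
      using right_limit_near_spectral_limit_point[OF l e(1)] by blast
    moreover from this have "\<nu> \<in> ball l e" by (simp add: dist_real_def abs_minus_commute)
    ultimately have "ereal \<nu> \<in> limit_spectra" "ereal \<nu> \<in> T"
      using real_in_limit_spectra_iff[of \<nu>] e(2) by blast+
    then show "limit_spectra \<inter> A \<noteq> {}" using T(1) by blast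
  qed
qed

text \<open>
  The sign \<open>s\<close> treats the points \<open>\<infinity>\<close> and \<open>-\<infinity>\<close> simultaneously.
\<close>

lemma infinity_in_limit_spectra:
  assumes s: "s = 1 \<or> s = (-1::real)" and unb: "\<And>\<beta>. \<exists>\<mu>. approx_eigenvalue \<mu> \<and> \<beta> < s * \<mu>"
  shows "ereal s * \<infinity> \<in> limit_spectra"
proof -
  have far: "\<exists>n\<ge>1. \<beta> < s * b n" for \<beta>
  proof -
    obtain \<mu> where \<mu>: "approx_eigenvalue \<mu>" "\<beta> + (2 * M + 1) < s * \<mu>" using unb by blast
    obtain n where "n \<in> {1..}" "\<bar>\<mu> - b (nat n)\<bar> \<le> 2 * M + 1"
      using diagonal_near_approx_eigenvalue[OF \<mu>(1)] by blast
    then show ?thesis using \<mu>(2) s by (intro exI[of _ "nat n"]) auto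
  qed
  have farther: "\<exists>n>N. \<beta> < s * b n" for \<beta> and N :: nat
  proof -
    \<comment> \<open>Exceeding the values at all sites up to \<open>N\<close> forces the new site
      to lie beyond \<open>N\<close>.\<close>
    define \<beta>' where "\<beta>' = Max (insert \<beta> ((\<lambda>n. s * b n) ` {..N}))"
    have *: "\<beta> \<le> \<beta>'" "\<And>n. n \<le> N \<Longrightarrow> s * b n \<le> \<beta>'"
      unfolding \<beta>'_def by (rule Max_ge, simp, simp) (rule Max_ge, simp, rule insertI2, rule imageI, simp)
    obtain n where "\<beta>' < s * b n" using far by blast
    then show ?thesis using * by (intro exI[of _ n]) (metis linorder_not_less order_le_less_trans)
  qed
  have "\<exists>k. \<forall>j. real j < s * b (k j) \<and> k j < k (Suc j)"
    by (rule dependent_nat_choice) (use farther in blast)+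
  then obtain k where k: "\<And>j. real j < s * b (k j)" "\<And>j. k j < k (Suc j)" by blast
  have mono: "strict_mono k" using k(2) by (simp add: strict_mono_Suc_iff)
  \<comment> \<open>The sites \<open>k j\<close> of large entries become site 0 of the right limit,
    whose diagonal entry there is infinite; the zero family stands in for the vectors.\<close>
  obtain r ar br where r: "strict_mono r" and rl: "(ar, br) \<in> right_limits a b"
    and rb: "\<And>n. (\<lambda>j. ereal (b (nat (int (k (r j)) + n)))) \<longlonglongrightarrow> br n"
    using right_limit_subsequence[OF mono, of "\<lambda>_ _. 0"] by (metis norm_zero zero_le_one)
  have "filterlim (\<lambda>j. s * b (k (r j))) at_top sequentially"
  proof (rule filterlim_at_top_mono[OF filterlim_real_sequentially], intro always_eventually allI)
    fix j show "real j \<le> s * b (k (r j))"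
      using k(1)[of "r j"] seq_suble[OF r, of j] by linarith
  qed
  then have top: "(\<lambda>j. ereal (s * b (k (r j)))) \<longlonglongrightarrow> \<infinity>" by (simp add: tendsto_PInfty_eq_at_top)
  have "(\<lambda>j. ereal (b (k (r j)))) \<longlonglongrightarrow> ereal s * \<infinity>"
    using s
  proof
    assume "s = -1"
    then show ?thesis using tendsto_uminus_ereal[OF top] by simp
  qed (use top in simp)
  moreover have "(\<lambda>j. ereal (b (k (r j)))) \<longlonglongrightarrow> br 0" using rb[of 0] by simp
  ultimately have "br 0 = ereal s * \<infinity>" using LIMSEQ_unique by blast
  moreover have "\<bar>ereal s * \<infinity>\<bar> = \<infinity>" using s by auto
  ultimately have "ereal s * \<infinity> \<in> right_limit_sigma ar br"
    unfolding right_limit_sigma_def by (intro UnI2 CollectI exI[of _ 0]) simp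
  then show ?thesis using rl by blast
qed

text \<open>A bound on the spectrum bounds the diagonal of \<open>J\<close>, hence every diagonal of
  a right limit and in turn its spectrum; each passage between spectrum and diagonal costs 2M + 1.
  The resulting half-line \<open>Q\<close> is closed in the extended reals, so it contains the
  closure as well, and it omits the infinite point in question.\<close>

lemma infinity_notin_closure_limit_spectra:
  assumes s: "s = 1 \<or> s = (-1::real)" and bnd: "\<And>\<mu>. approx_eigenvalue \<mu> \<Longrightarrow> s * \<mu> \<le> \<beta>"
  shows "ereal s * \<infinity> \<notin> closure limit_spectra"
proof -
  define \<gamma> where "\<gamma> = \<beta> + (2 * M + 1)"
  have b_le: "s * b n \<le> \<gamma>" if n: "1 \<le> n" for n
  proof -
    obtain \<nu> where "\<bar>\<nu> - b n\<bar> < 2 * M + 1" "approx_eigenvalue \<nu>"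
      using approx_eigenvalue_near_diagonal[of "int n"] n by auto
    then show ?thesis using bnd[of \<nu>] s by (auto simp: \<gamma>_def)
  qed
  define Q where "Q = {x. ereal s * x \<le> ereal (\<gamma> + (2 * M + 1))}"
  have Q_eq: "Q = (if s = 1 then {..ereal (\<gamma> + (2 * M + 1))} else {- ereal (\<gamma> + (2 * M + 1))..})"
  proof -
    have "ereal (-1) * x \<le> ereal c \<longleftrightarrow> - ereal c \<le> x" for x c by (cases x) auto
    then show ?thesis using s by (auto simp: Q_def)
  qed
  have "right_limit_sigma ar br \<subseteq> Q" if rl: "(ar, br) \<in> right_limits a b" for ar br
  proof -
    interpret R: jacobi "finite_sites br" ar "\<lambda>n. real_of_ereal (br n)" M
      by (rule right_limit_jacobi[OF rl])
    obtain k where k: "strict_mono k" and kb: "\<And>n. (\<lambda>j. ereal (b (nat (int (k j) + n)))) \<longlonglongrightarrow> br n"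
      using right_limits_cases[OF rl] by metis
    have br_le: "ereal s * br n \<le> ereal \<gamma>" for n
    proof (rule tendsto_upperbound)
      show "(\<lambda>j. ereal s * ereal (b (nat (int (k j) + n)))) \<longlonglongrightarrow> ereal s * br n"
        by (intro tendsto_cmult_ereal kb) simp
      show "\<forall>\<^sub>F j in sequentially. ereal s * ereal (b (nat (int (k j) + n))) \<le> ereal \<gamma>"
        using eventually_positive_site[OF k, of 1 n] by eventually_elim (simp add: b_le)
    qed simp
    have R_le: "s * \<mu> \<le> \<gamma> + (2 * M + 1)" if "R.approx_eigenvalue \<mu>" for \<mu>
    proof -
      obtain n where n: "n \<in> finite_sites br" "\<bar>\<mu> - real_of_ereal (br n)\<bar> \<le> 2 * M + 1"
        using R.diagonal_near_approx_eigenvalue[OF \<open>R.approx_eigenvalue \<mu>\<close>] by blast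
      have "br n = ereal (real_of_ereal (br n))" using n(1) by (simp add: finite_sites_def ereal_real')
      then have "s * real_of_ereal (br n) \<le> \<gamma>" using br_le[of n] by (metis ereal_less_eq(3) times_ereal.simps(1))
      then show ?thesis using n(2) s by auto
    qed
    have "ereal ` {\<mu>. R.approx_eigenvalue \<mu>} \<subseteq> Q" using R_le by (auto simp: Q_def)
    moreover have "{x. x = \<infinity> \<and> \<not> bdd_above {\<mu>. R.approx_eigenvalue \<mu>} \<or> x = -\<infinity> \<and> \<not> bdd_below {\<mu>. R.approx_eigenvalue \<mu>}} \<subseteq> Q"
      using s
    proof
      assume [simp]: "s = 1"
      have "bdd_above {\<mu>. R.approx_eigenvalue \<mu>}"
        using R_le by (intro bdd_aboveI[of _ "\<gamma> + (2 * M + 1)"]) auto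
      then show ?thesis by (auto simp: Q_def)
    next
      assume [simp]: "s = -1"
      have "bdd_below {\<mu>. R.approx_eigenvalue \<mu>}"
        using R_le by (intro bdd_belowI[of _ "- (\<gamma> + (2 * M + 1))"]) force
      then show ?thesis by (auto simp: Q_def)
    qed
    moreover have "{br n |n. \<bar>br n\<bar> = \<infinity>} \<subseteq> Q"
    proof -
      have "ereal \<gamma> \<le> ereal (\<gamma> + (2 * M + 1))" using M_nonneg by simp
      then have "br n \<in> Q" for n unfolding Q_def mem_Collect_eq by (rule order_trans[OF br_le])
      then show ?thesis by blast
    qed
    ultimately show ?thesis by (simp add: right_limit_sigma_def R.ext_spectrum_eq)
  qed
  then have "limit_spectra \<subseteq> Q" by blast
  moreover have "closed Q" unfolding Q_eq by simp
  ultimately have "closure limit_spectra \<subseteq> Q" by (rule closure_minimal)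
  moreover have "ereal s * \<infinity> \<notin> Q" using s by (auto simp: Q_def)
  ultimately show ?thesis by blast
qed

lemma infinity_in_closure_limit_spectra_iff:
  "\<infinity> \<in> closure limit_spectra \<longleftrightarrow> \<not> bdd_above {\<mu>. approx_eigenvalue \<mu>}"
proof
  assume "\<infinity> \<in> closure limit_spectra"
  then have "\<not> (\<forall>\<mu>. approx_eigenvalue \<mu> \<longrightarrow> 1 * \<mu> \<le> m)" for m
    using infinity_notin_closure_limit_spectra[of 1 m] by auto
  then show "\<not> bdd_above {\<mu>. approx_eigenvalue \<mu>}" by (auto simp: bdd_above_def)
next
  assume unb: "\<not> bdd_above {\<mu>. approx_eigenvalue \<mu>}"
  have "\<exists>\<mu>. approx_eigenvalue \<mu> \<and> \<beta> < 1 * \<mu>" for \<beta>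
  proof (rule ccontr)
    assume "\<not> ?thesis"
    then have "bdd_above {\<mu>. approx_eigenvalue \<mu>}" by (intro bdd_aboveI[of _ \<beta>]) (simp add: not_less)
    then show False using unb by contradiction
  qed
  from infinity_in_limit_spectra[OF _ this] have "\<infinity> \<in> limit_spectra" by simp
  then show "\<infinity> \<in> closure limit_spectra" by (rule closure_subset[THEN subsetD])
qed

lemma minus_infinity_in_closure_limit_spectra_iff:
  "-\<infinity> \<in> closure limit_spectra \<longleftrightarrow> \<not> bdd_below {\<mu>. approx_eigenvalue \<mu>}"
proof
  assume "-\<infinity> \<in> closure limit_spectra"
  then have "\<not> (\<forall>\<mu>. approx_eigenvalue \<mu> \<longrightarrow> (-1) * \<mu> \<le> - m)" for m
    using infinity_notin_closure_limit_spectra[of "-1" "- m"] by auto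
  then show "\<not> bdd_below {\<mu>. approx_eigenvalue \<mu>}" by (auto simp: bdd_below_def)
next
  assume unb: "\<not> bdd_below {\<mu>. approx_eigenvalue \<mu>}"
  have "\<exists>\<mu>. approx_eigenvalue \<mu> \<and> \<beta> < (-1) * \<mu>" for \<beta>
  proof (rule ccontr)
    assume "\<not> ?thesis"
    then have "bdd_below {\<mu>. approx_eigenvalue \<mu>}" by (intro bdd_belowI[of _ "- \<beta>"]) force
    then show False using unb by contradiction
  qed
  from infinity_in_limit_spectra[OF _ this] have "-\<infinity> \<in> limit_spectra" by simp
  then show "-\<infinity> \<in> closure limit_spectra" by (rule closure_subset[THEN subsetD])
qed

lemma closure_limit_spectra_eq: "closure limit_spectra = jacobi_sigma_ess a b"
proof (rule set_eqI)
  fix x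
  show "x \<in> closure limit_spectra \<longleftrightarrow> x \<in> jacobi_sigma_ess a b"
    unfolding jacobi_sigma_ess_def ext_essential_spectrum_eq
    by (cases x) (auto simp: real_in_closure_limit_spectra_iff infinity_in_closure_limit_spectra_iff
        minus_infinity_in_closure_limit_spectra_iff)
qed

end

theorem theorem3p4:
  fixes a b :: "nat \<Rightarrow> real"
  assumes "\<And>n. n \<ge> 1 \<Longrightarrow> a n > 0"
    and "bdd_above ((\<lambda>n. \<bar>a n\<bar>) ` {1..})"
  shows "closure (\<Union>(ar, br)\<in>right_limits a b. right_limit_sigma ar br) = jacobi_sigma_ess a b"
proof -
  obtain C where C: "\<And>n. 1 \<le> n \<Longrightarrow> \<bar>a n\<bar> \<le> C"
    using assms(2) by (auto simp: bdd_above_def)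
  \<comment> \<open>\<open>nat\<close> sends nonpositive sites to 0, so the bound required by the
    locale includes \<open>a 0\<close>, on which the hypothesis is silent.\<close>
  have "\<bar>a n\<bar> \<le> max C \<bar>a 0\<bar>" for n
    using C[of n] by (cases "n = 0") (auto simp: le_max_iff_disj)
  then interpret half_line_jacobi a b "max C \<bar>a 0\<bar>"
    using assms(1) by unfold_locales auto
  show ?thesis by (rule closure_limit_spectra_eq)
qed

end
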